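(* Let $k\ge 2$ and let $\mathcal S=\{S_1,\dots,S_k\}$ be a set of strings over an alphabet $\Sigma$, each of length at most $n$. \textsc{MCS Enumeration} (outputting all maximal common subsequences of $\mathcal S$) can be solved with $\mathsf{XP}$ delay with respect to $k$: specifically, after $O(k|\Sigma|n^k)$ preprocessing time, all maximal common subsequences of $\mathcal S$ can be enumerated with delay $O(kn^{2k+1})$.
   Context: A string $Y$ is a subsequence of $X$ if $Y$ is obtained from $X$ by deleting zero or more characters. A maximal common subsequence of $\mathcal S$ is a string that is a subsequence of every $S_i$ and is not a proper subsequence of any other common subsequence of $\mathcal S$. The delay of an enumeration algorithm is the maximum time elapsed between two consecutive outputs (and before the first and after the last). An enumeration algorithm has $\mathsf{XP}$ delay with respect to a parameter $p$ if its delay is $O(f(p)N^{g(p)})$ for computable $f,g$, where $N$ is the non-parameterized input size. *)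

theory Defs
  imports Complex_Main "HOL-Library.Sublist"
begin

section \<open>Maximal common subsequences\<close>

definition common_subseq :: "'a list list \<Rightarrow> 'a list \<Rightarrow> bool" where
  "common_subseq S Y \<longleftrightarrow> (\<forall>X \<in> set S. subseq Y X)"

definition MCS :: "'a list list \<Rightarrow> 'a list set" where
  "MCS S = {Y. common_subseq S Y \<and> \<not> (\<exists>Z. common_subseq S Z \<and> strict_subseq Y Z)}"


section \<open>Word RAM programs\<close>

text \<open>
  The machine is a word RAM, programmed in a deeply embedded structured language.
  A program is a finite piece of syntax that may access finitely many arrays of words, named by
  the numbers occurring in it; array \<open>a\<close> of \<open>m\<close> arrays stands for the cells
  \<open>m * i + a\<close> of a single memory, and a register is a cell with constant index.
\<close>

type_synonym state = "nat \<Rightarrow> nat \<Rightarrow> nat"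

datatype exp =
    Const nat
  | Read nat exp
  | Add exp exp
  | Sub exp exp
  | Mul exp exp
  | Div exp exp
  | Mod exp exp

fun val :: "exp \<Rightarrow> state \<Rightarrow> nat" where
  "val (Const c) s = c"
| "val (Read a e) s = s a (val e s)"
| "val (Add e1 e2) s = val e1 s + val e2 s"
| "val (Sub e1 e2) s = val e1 s - val e2 s"
| "val (Mul e1 e2) s = val e1 s * val e2 s"
| "val (Div e1 e2) s = val e1 s div val e2 s"
| "val (Mod e1 e2) s = val e1 s mod val e2 s"

fun cost :: "exp \<Rightarrow> nat" where
  "cost (Const c) = 1"
| "cost (Read a e) = cost e + 1"
| "cost (Add e1 e2) = cost e1 + cost e2 + 1"
| "cost (Sub e1 e2) = cost e1 + cost e2 + 1"
| "cost (Mul e1 e2) = cost e1 + cost e2 + 1"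
| "cost (Div e1 e2) = cost e1 + cost e2 + 1"
| "cost (Mod e1 e2) = cost e1 + cost e2 + 1"

datatype com =
    Skip
  | Assign nat exp exp
  | Seq com com
  | Cond exp com com
  | While exp com
  | Emit exp
  | Finish

text \<open>
  A run leaves a trace in which every event takes one unit of time: an internal step, writing one
  symbol of the current output string, or completing that string (which makes it an output).
\<close>

datatype event = Tick | Symbol nat | Completed

text \<open>
  The parameter \<open>W\<close> is the largest number that fits into a memory word. A run gets stuck when it
  stores a larger number or stores to a larger address. Intermediate values inside
  an expression are not checked: they occupy a number of words bounded by a constant
  depending on the program only.
\<close>

inductive exec :: "nat \<Rightarrow> com \<Rightarrow> state \<Rightarrow> event list \<Rightarrow> state \<Rightarrow> bool" for W where
  Skip: "exec W Skip s [Tick] s"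
| Assign: "val e1 s \<le> W \<Longrightarrow> val e2 s \<le> W \<Longrightarrow>
    exec W (Assign a e1 e2) s (replicate (cost e1 + cost e2 + 1) Tick)
      (s(a := (s a)(val e1 s := val e2 s)))"
| Seq: "exec W c1 s1 t1 s2 \<Longrightarrow> exec W c2 s2 t2 s3 \<Longrightarrow> exec W (Seq c1 c2) s1 (t1 @ t2) s3"
| CondTrue: "val e s \<noteq> 0 \<Longrightarrow> exec W c1 s t s' \<Longrightarrow>
    exec W (Cond e c1 c2) s (replicate (cost e + 1) Tick @ t) s'"
| CondFalse: "val e s = 0 \<Longrightarrow> exec W c2 s t s' \<Longrightarrow>
    exec W (Cond e c1 c2) s (replicate (cost e + 1) Tick @ t) s'"
| WhileFalse: "val e s = 0 \<Longrightarrow> exec W (While e c) s (replicate (cost e + 1) Tick) s"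
| WhileTrue: "val e s1 \<noteq> 0 \<Longrightarrow> exec W c s1 t1 s2 \<Longrightarrow> exec W (While e c) s2 t2 s3 \<Longrightarrow>
    exec W (While e c) s1 (replicate (cost e + 1) Tick @ t1 @ t2) s3"
| Emit: "exec W (Emit e) s (replicate (cost e) Tick @ [Symbol (val e s)]) s"
| Finish: "exec W Finish s [Completed] s"

definition computable :: "(nat \<Rightarrow> nat) \<Rightarrow> bool" where
  "computable f \<longleftrightarrow>
    (\<exists>c. \<forall>x. \<exists>W t s'. exec W c (\<lambda>a i. if a = 0 \<and> i = 0 then x else 0) t s' \<and> s' 0 0 = f x)"


section \<open>Enumeration with bounded delay\<close>

text \<open>
  The trace is cut after each completed output. The last block is the part of the run after the
  last output, so there is one block more than there are outputs.
\<close>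

fun blocks :: "event list \<Rightarrow> event list list" where
  "blocks [] = [[]]"
| "blocks (ev # t) =
    (if ev = Completed then [ev] # blocks t else (ev # hd (blocks t)) # tl (blocks t))"

definition symbols :: "event list \<Rightarrow> nat list" where
  "symbols b = [x. Symbol x \<leftarrow> b]"

definition outputs :: "event list \<Rightarrow> nat list list" where
  "outputs t = map symbols (butlast (blocks t))"

definition delay :: "event list \<Rightarrow> nat" where
  "delay t = Max (length ` set (blocks t))"

definition enumerates :: "nat \<Rightarrow> com \<Rightarrow> state \<Rightarrow> nat list set \<Rightarrow> nat \<Rightarrow> bool" where
  "enumerates W c s A D \<longleftrightarrow>
    (\<exists>t s'. exec W c s t s' \<and> distinct (outputs t) \<and> set (outputs t) = A \<and>
       symbols (last (blocks t)) = [] \<and> delay t \<le> D)"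

definition enumerates_after_preprocessing ::
    "nat \<Rightarrow> com \<Rightarrow> com \<Rightarrow> state \<Rightarrow> nat list set \<Rightarrow> nat \<Rightarrow> nat \<Rightarrow> bool" where
  "enumerates_after_preprocessing W pre enum s A P D \<longleftrightarrow>
    (\<exists>t s'. exec W pre s t s' \<and> set t \<subseteq> {Tick} \<and> length t \<le> P \<and> enumerates W enum s' A D)"

text \<open>
  For a problem with instances \<open>I\<close>, parameter \<open>p\<close>, input size \<open>N\<close>, input encoding \<open>inp\<close> and
  solution sets \<open>sol\<close>. Words have length logarithmic in the delay bound.
\<close>

definition enumerates_with_XP_delay ::
    "com \<Rightarrow> 'i set \<Rightarrow> ('i \<Rightarrow> nat) \<Rightarrow> ('i \<Rightarrow> nat) \<Rightarrow> ('i \<Rightarrow> state) \<Rightarrow> ('i \<Rightarrow> nat list set) \<Rightarrow> bool" where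
  "enumerates_with_XP_delay c I p N inp sol \<longleftrightarrow>
    (\<exists>f g C. computable f \<and> computable g \<and>
      (\<forall>x \<in> I. enumerates (C * (f (p x) * N x ^ g (p x))) c (inp x) (sol x)
                 (C * (f (p x) * N x ^ g (p x)))))"


section \<open>The problem MCS Enumeration\<close>

text \<open>
  An instance \<open>(\<sigma>, S)\<close> consists of the size of the alphabet \<open>{..<\<sigma>}\<close> and the list of
  the given strings.
\<close>

definition mcs_instances :: "(nat \<times> nat list list) set" where
  "mcs_instances = {(\<sigma>, S). \<sigma> \<ge> 1 \<and> length S \<ge> 2 \<and> (\<forall>X \<in> set S. set X \<subseteq> {..<\<sigma>})}"

definition mcs_parameter :: "nat \<times> nat list list \<Rightarrow> nat" where
  "mcs_parameter = (\<lambda>(\<sigma>, S). length S)"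

definition mcs_size :: "nat \<times> nat list list \<Rightarrow> nat" where
  "mcs_size = (\<lambda>(\<sigma>, S). \<sigma> + sum_list (map length S))"

text \<open>
  Array \<open>0\<close> holds the number of strings and \<open>\<sigma>\<close>, array \<open>1\<close> the lengths of the strings, and
  array \<open>2\<close> their concatenation. Everything else is initially \<open>0\<close>.
\<close>

definition array_of :: "nat list \<Rightarrow> nat \<Rightarrow> nat" where
  "array_of xs i = (if i < length xs then xs ! i else 0)"

definition mcs_input :: "nat \<times> nat list list \<Rightarrow> state" where
  "mcs_input = (\<lambda>(\<sigma>, S). (\<lambda>a i. 0)
     (0 := array_of [length S, \<sigma>], 1 := array_of (map length S), 2 := array_of (concat S)))"

definition mcs_solutions :: "nat \<times> nat list list \<Rightarrow> nat list set" where
  "mcs_solutions = (\<lambda>(\<sigma>, S). MCS S)"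

end

theory Submission
  imports Defs
begin

text \<open>
  A \<open>k\<close>-tuple of positions carrying a common letter is a node; there are at most \<open>n ^ k\<close> of them, and
  two more nodes stand for the positions before and after all strings. A common subsequence \<open>Y\<close> is
  maximal iff no letter fits into any of its gaps, where the gap of a splitting \<open>Y = A @ B\<close> extends
  from the leftmost embedding of \<open>A\<close> to the rightmost embedding of \<open>B\<close>. Hence the maximal common
  subsequences correspond to the paths through pairs (leftmost node of the prefix, rightmost node of
  the suffix) with gaps that contain no common letter. The next leftmost node is determined by the
  letter, and so is the previous rightmost node, so the graph of pairs has only
  \<open>O(n ^ (2 * k + 1))\<close> edges, and the pairs from which the end is reachable can be tabulated
  before the first output. A depth-first search restricted to these pairs has no dead ends; it
  tries at most \<open>O(n ^ k)\<close> nodes on each of its at most \<open>n + 1\<close> levels between two outputs.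
  No preprocessing is necessary: the delay bound leaves enough time for the tables.
\<close>

section \<open>Loops on the word RAM\<close>

text \<open>Maximality constrains both sides of every gap, but the right side is unknown while a
  word grows from the left. A path therefore guesses the rightmost node of the remaining suffix, and
  the guess is checked against the node that follows it. Leftmost and rightmost nodes behave well
  because the nodes of one letter are closed under componentwise minimum and maximum; numbering the
  tuples in base \<open>n\<close> makes these the numerically least and greatest candidates, which a
  plain scan finds. The delay bound contains no factor |\<Sigma>|. Hence a letter is represented by
  its first position in the first string, a number between 1 and \<open>n\<close>, so that the
  tables stay small even over a large alphabet. The factor \<open>k\<close> pays for comparing
  tuples. The tabulation of the useful pairs relies on every edge increasing the leftmost node. The
  time between two outputs is bounded by a potential that falls in every silent step of the
  search.\<close>

lemma exec_mono_word: "exec W c s t s' \<Longrightarrow> W \<le> W' \<Longrightarrow> exec W' c s t s'"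
proof (induction rule: exec.induct)
  case (Assign e1 s e2 a)
  then show ?case by (intro exec.Assign) auto
qed (blast intro: exec.intros)+

text \<open>Covers silent runs only, and bounds the time from above instead of fixing it, so that
  branches of different length share one bound.\<close>

definition runs :: "nat \<Rightarrow> com \<Rightarrow> state \<Rightarrow> state \<Rightarrow> nat \<Rightarrow> bool" where
  "runs W c s s' \<tau> \<longleftrightarrow> (\<exists>m\<le>\<tau>. exec W c s (replicate m Tick) s')"

lemma runs_mono: "runs W c s s' \<tau> \<Longrightarrow> \<tau> \<le> \<tau>' \<Longrightarrow> runs W c s s' \<tau>'"
  unfolding runs_def by (meson le_trans)

lemma runs_Skip: "runs W Skip s s 1"
  unfolding runs_def using exec.Skip by (intro exI[of _ 1]) auto

lemma runs_Assign:
  assumes "val e1 s \<le> W" "val e2 s \<le> W"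
  shows "runs W (Assign a e1 e2) s (s(a := (s a)(val e1 s := val e2 s))) (cost e1 + cost e2 + 1)"
  unfolding runs_def using exec.Assign[OF assms] by blast

lemma runs_Seq:
  assumes "runs W c1 s1 s2 \<tau>1" "runs W c2 s2 s3 \<tau>2"
  shows "runs W (Seq c1 c2) s1 s3 (\<tau>1 + \<tau>2)"
proof -
  obtain m1 m2 where "m1 \<le> \<tau>1" "exec W c1 s1 (replicate m1 Tick) s2"
    "m2 \<le> \<tau>2" "exec W c2 s2 (replicate m2 Tick) s3"
    using assms unfolding runs_def by blast
  then show ?thesis
    unfolding runs_def
    by (intro exI[of _ "m1 + m2"]) (auto simp: replicate_add intro: exec.Seq)
qed

lemma runs_Cond:
  assumes "val e s \<noteq> 0 \<Longrightarrow> runs W c1 s s' \<tau>" "val e s = 0 \<Longrightarrow> runs W c2 s s' \<tau>"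
  shows "runs W (Cond e c1 c2) s s' (cost e + 1 + \<tau>)"
proof (cases "val e s = 0")
  case True
  then obtain m where "m \<le> \<tau>" "exec W c2 s (replicate m Tick) s'"
    using assms(2) unfolding runs_def by blast
  then show ?thesis
    unfolding runs_def using exec.CondFalse[OF True, of W c2 "replicate m Tick" s' c1]
    by (intro exI[of _ "cost e + 1 + m"]) (auto simp: replicate_add)
next
  case False
  then obtain m where "m \<le> \<tau>" "exec W c1 s (replicate m Tick) s'"
    using assms(1) unfolding runs_def by blast
  then show ?thesis
    unfolding runs_def using exec.CondTrue[OF False, of W c1 "replicate m Tick" s' c2]
    by (intro exI[of _ "cost e + 1 + m"]) (auto simp: replicate_add)
qed

lemma runs_WhileFalse: "val e s = 0 \<Longrightarrow> runs W (While e c) s s (cost e + 1)"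
  unfolding runs_def using exec.WhileFalse by blast

lemma runs_WhileTrue:
  assumes "val e s1 \<noteq> 0" "runs W c s1 s2 \<tau>1" "runs W (While e c) s2 s3 \<tau>2"
  shows "runs W (While e c) s1 s3 (cost e + 1 + \<tau>1 + \<tau>2)"
proof -
  obtain m1 m2 where "m1 \<le> \<tau>1" "exec W c s1 (replicate m1 Tick) s2"
    "m2 \<le> \<tau>2" "exec W (While e c) s2 (replicate m2 Tick) s3"
    using assms unfolding runs_def by blast
  moreover have "replicate (cost e + 1 + m1 + m2) Tick =
      replicate (cost e + 1) Tick @ replicate m1 Tick @ replicate m2 Tick"
    by (simp add: replicate_add)
  ultimately show ?thesis
    unfolding runs_def using exec.WhileTrue[OF assms(1)]
    by (intro exI[of _ "cost e + 1 + m1 + m2"]) (auto simp del: replicate_Suc)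
qed

abbreviation Var :: "nat \<Rightarrow> exp" where "Var a \<equiv> Read a (Const 0)"
abbreviation Set :: "nat \<Rightarrow> exp \<Rightarrow> com" where "Set a e \<equiv> Assign a (Const 0) e"

text \<open>The one loop from which every table is built: each round makes at most one store into
  the array \<open>a\<close>. A state inside the loop is therefore described by the counter and the
  contents of \<open>a\<close>.\<close>

definition fill :: "nat \<Rightarrow> exp \<Rightarrow> exp \<Rightarrow> nat \<Rightarrow> exp \<Rightarrow> exp \<Rightarrow> com" where
  "fill v e p a ie xe =
    Seq (Set v (Const 0))
      (While (Sub e (Var v))
        (Seq (Cond p (Assign a ie xe) Skip) (Set v (Add (Var v) (Const 1)))))"

text \<open>A round has a fixed overhead of 12; the constant 15 leaves some room. One additional
  round pays for the initialisation and the final test.\<close>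

definition fill_cost :: "exp \<Rightarrow> exp \<Rightarrow> exp \<Rightarrow> exp \<Rightarrow> nat" where
  "fill_cost e p ie xe = cost e + cost p + cost ie + cost xe + 15"

text \<open>\<open>J i T\<close> relates the number of completed rounds to the contents
  \<open>T\<close> of the array. The last premise is a weakest precondition of the loop body
  expressed with \<open>val\<close>, so that applications reduce to arithmetic.\<close>

lemma runs_fill:
  assumes va: "v \<noteq> a"
    and J0: "J 0 (s a)"
    and B: "\<And>i T. i \<le> B \<Longrightarrow> val e (s(v := (s v)(0 := i), a := T)) = B"
    and BW: "B \<le> W"
    and step: "\<And>i T. i < B \<Longrightarrow> J i T \<Longrightarrow>
      (let st = s(v := (s v)(0 := i), a := T) in
        if val p st = 0 then J (Suc i) T
        else val ie st \<le> W \<and> val xe st \<le> W \<and> J (Suc i) (T(val ie st := val xe st)))"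
  shows "\<exists>T. J B T \<and> runs W (fill v e p a ie xe) s (s(v := (s v)(0 := B), a := T))
     (fill_cost e p ie xe * (B + 1))"
proof -
  let ?st = "\<lambda>i T. s(v := (s v)(0 := i), a := T)"
  let ?body = "Seq (Cond p (Assign a ie xe) Skip) (Set v (Add (Var v) (Const 1)))"
  let ?K = "fill_cost e p ie xe"
  have loop: "\<exists>T'. J B T' \<and> runs W (While (Sub e (Var v)) ?body) (?st i T) (?st B T') (?K * (B - i) + cost e + 5)"
    if "i \<le> B" "J i T" for i T
    using that
  proof (induction "B - i" arbitrary: i T)
    case 0
    then have "i = B" by simp
    have "val (Sub e (Var v)) (?st B T) = 0"
      using B[of B T] va by simp
    from runs_WhileFalse[OF this] have "runs W (While (Sub e (Var v)) ?body) (?st B T) (?st B T) (?K * (B - i) + cost e + 5)"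
      by (rule runs_mono) simp
    then show ?case using 0 \<open>i = B\<close> by metis
  next
    case (Suc d)
    then have i: "i < B" by simp
    define T1 where "T1 = (if val p (?st i T) = 0 then T
      else T(val ie (?st i T) := val xe (?st i T)))"
    have J1: "J (Suc i) T1" and b: "val p (?st i T) \<noteq> 0 \<Longrightarrow> val ie (?st i T) \<le> W \<and> val xe (?st i T) \<le> W"
      using step[OF i Suc.prems(2)] unfolding T1_def Let_def by (auto split: if_splits)
    have r1: "runs W (Cond p (Assign a ie xe) Skip) (?st i T) (?st i T1)
       (cost p + 1 + (cost ie + cost xe + 1))"
    proof (rule runs_Cond)
      assume p: "val p (?st i T) \<noteq> 0"
      show "runs W (Assign a ie xe) (?st i T) (?st i T1) (cost ie + cost xe + 1)"
        using runs_Assign[of ie "?st i T" W xe a] b[OF p] p by (simp add: T1_def)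
    next
      assume p: "val p (?st i T) = 0"
      then have T1: "T1 = T" by (simp add: T1_def)
      show "runs W Skip (?st i T) (?st i T1) (cost ie + cost xe + 1)"
        unfolding T1 by (rule runs_mono[OF runs_Skip]) simp
    qed
    have r2: "runs W (Set v (Add (Var v) (Const 1))) (?st i T1) (?st (Suc i) T1) 6"
    proof -
      have "(?st i T1)(v := ((?st i T1) v)(0 := Suc i)) = ?st (Suc i) T1"
        using va by (auto simp: fun_eq_iff)
      then show ?thesis
        using runs_Assign[of "Const 0" "?st i T1" W "Add (Var v) (Const 1)" v] va i BW
        by (auto intro: runs_mono)
    qed
    obtain T' where T': "J B T'"
      "runs W (While (Sub e (Var v)) ?body) (?st (Suc i) T1) (?st B T') (?K * (B - Suc i) + cost e + 5)"
      using Suc.hyps(1)[OF _ _ J1] Suc.hyps(2) i by (metis Suc_diff_Suc Suc_leI nat.inject)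
    have "val (Sub e (Var v)) (?st i T) \<noteq> 0"
      using B[of i T] i va by simp
    from runs_WhileTrue[OF this runs_Seq[OF r1 r2] T'(2)] T'(1) i
    show ?case
      by (intro exI[of _ T'] conjI) (auto elim!: runs_mono simp: fill_cost_def Suc_diff_Suc[symmetric])
  qed
  obtain T' where T': "J B T'"
    "runs W (While (Sub e (Var v)) ?body) (?st 0 (s a)) (?st B T') (?K * B + cost e + 5)"
    using loop[OF le0 J0] by auto
  have st0: "s(v := (s v)(0 := 0)) = ?st 0 (s a)"
    using va by (auto simp: fun_eq_iff)
  have "runs W (Set v (Const 0)) s (?st 0 (s a)) 3"
    using runs_Assign[of "Const 0" s W "Const 0" v] st0 by (simp add: numeral_3_eq_3)
  from runs_Seq[OF this T'(2)] T'(1) show ?thesis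
    unfolding fill_def
    by (intro exI[of _ T'] conjI) (auto elim!: runs_mono simp: fill_cost_def)
qed

lemma div_mod_Suc_cases:
  fixes m :: nat
  assumes "0 < m"
  shows "z * m + t < Suc i \<and> t < m \<longleftrightarrow> (z * m + t < i \<and> t < m) \<or> (z = i div m \<and> t = i mod m)"
proof -
  have "i = i div m * m + i mod m" "i mod m < m" using assms by auto
  moreover have "z * m + t = i \<Longrightarrow> t < m \<Longrightarrow> z = i div m \<and> t = i mod m" by auto
  ultimately show ?thesis by (metis less_Suc_eq)
qed

text \<open>The cell \<open>z\<close> is written by the iterations \<open>z * m + t\<close> with \<open>t < m\<close>, and the last write wins.\<close>

lemma runs_fill_scan:
  assumes va: "v \<noteq> a" and m: "0 < m" and BW: "A * m \<le> W" 
    and B: "\<And>i T. val e (s(v := (s v)(0 := i), a := T)) = A * m"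
    and step: "\<And>z t T. z < A \<Longrightarrow> t < m \<Longrightarrow>
      (let st = s(v := (s v)(0 := z * m + t), a := T) in
        (val p st \<noteq> 0 \<longleftrightarrow> P z t) \<and> (P z t \<longrightarrow> val ie st = z \<and> val xe st = g z t \<and> g z t \<le> W))"
  shows "\<exists>T. (\<forall>z<A. (\<forall>t<m. P z t \<and> (\<forall>t'. t < t' \<and> t' < m \<longrightarrow> \<not> P z t') \<longrightarrow> T z = g z t) \<and>
                ((\<forall>t<m. \<not> P z t) \<longrightarrow> T z = s a z)) \<and>
     runs W (fill v e p a ie xe) s (s(v := (s v)(0 := A * m), a := T)) (fill_cost e p ie xe * (A * m + 1))"
proof -
  \<comment> \<open>Relative to the completed rounds: the last successful one of a row determines
    its cell, and a row without success keeps its old content.\<close>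
  define J where "J i T \<longleftrightarrow> (\<forall>z<A.
      (\<forall>t<m. z * m + t < i \<and> P z t \<and> (\<forall>t'. t < t' \<and> t' < m \<and> z * m + t' < i \<longrightarrow> \<not> P z t') \<longrightarrow> T z = g z t) \<and>
      ((\<forall>t<m. z * m + t < i \<longrightarrow> \<not> P z t) \<longrightarrow> T z = s a z))" for i and T :: "nat \<Rightarrow> nat"
  have "\<exists>T. J (A * m) T \<and> runs W (fill v e p a ie xe) s (s(v := (s v)(0 := A * m), a := T))
     (fill_cost e p ie xe * (A * m + 1))"
  proof (rule runs_fill[OF va _ B BW])
    show "J 0 (s a)" by (simp add: J_def)
  next
    fix i T
    assume i: "i < A * m" and J: "J i T"
    let ?z = "i div m" and ?t = "i mod m"
    let ?st = "s(v := (s v)(0 := i), a := T)"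
    have z: "?z < A" using i by (simp add: less_mult_imp_div_less)
    have t: "?t < m" using m by simp
    have it: "?z * m + ?t = i" by simp
    have f: "val p ?st \<noteq> 0 \<longleftrightarrow> P ?z ?t"
        "P ?z ?t \<Longrightarrow> val ie ?st = ?z \<and> val xe ?st = g ?z ?t \<and> g ?z ?t \<le> W"
      using step[OF z t, of T] unfolding it Let_def by auto
    have zW: "?z \<le> W" using i BW by (meson div_le_dividend le_trans less_imp_le)
    have D: "z * m + t < Suc i \<longleftrightarrow> z * m + t < i \<or> (z = ?z \<and> t = ?t)" if "t < m" for z t
      using div_mod_Suc_cases[OF m, of z t i] that t it by auto
    have D': "?z * m + t < i \<longleftrightarrow> t < ?t" if "t < m" for t
      using it that by (metis add_less_cancel_left)
    have J1: "J (Suc i) T" if n: "\<not> P ?z ?t"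
      unfolding J_def
    proof (intro allI impI conjI, goal_cases)
      case (1 z t)
      then have "z * m + t < i" using D n by auto
      then show ?case using J 1 D unfolding J_def by auto
    next
      case (2 z)
      then show ?case using J D unfolding J_def by auto
    qed
    have J2: "J (Suc i) (T(?z := g ?z ?t))" if p: "P ?z ?t"
      unfolding J_def
    proof (intro allI impI conjI, goal_cases)
      case (1 z t)
      show ?case
      proof (cases "z = ?z")
        case True
        \<comment> \<open>The pair just handled is successful and the latest in its row, so no
          earlier \<open>t\<close> can be the last success.\<close>
        have "\<not> t < ?t" using 1 p D[of ?t ?z] t True by auto
        then have "t = ?t" using 1 D[of t z] D'[of t] True by auto
        then show ?thesis using True by simp
      next
        case False
        then show ?thesis using J 1 D unfolding J_def by auto
      qed
    next
      case (2 z)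
      show ?case
      proof (cases "z = ?z")
        case True
        then show ?thesis using 2 p t D[of ?t ?z] by auto
      next
        case False
        then show ?thesis using J 2 D unfolding J_def by auto
      qed
    qed
    show "let st = ?st in if val p st = 0 then J (Suc i) T
        else val ie st \<le> W \<and> val xe st \<le> W \<and> J (Suc i) (T(val ie st := val xe st))"
      using f J1 J2 zW unfolding Let_def by auto
  qed
  then obtain T where T: "J (A * m) T" "runs W (fill v e p a ie xe) s (s(v := (s v)(0 := A * m), a := T))
     (fill_cost e p ie xe * (A * m + 1))" by blast
  have all: "z * m + t < A * m" if "z < A" "t < m" for z t
  proof -
    have "z * m + t < Suc z * m" using that by simp
    also have "\<dots> \<le> A * m" using that by (intro mult_le_mono1) simp
    finally show ?thesis .
  qed
  show ?thesis
    by (intro exI[of _ T] conjI T(2)) (use T(1) all in \<open>auto simp: J_def\<close>)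
qed

section \<open>An order with labelled nodes\<close>

text \<open>
  The nodes are \<open>0, \<dots>, snk\<close>; the nodes with a label \<open>\<noteq> 0\<close> are the positions of a common letter,
  while \<open>0\<close> and \<open>snk\<close> stand for the positions before and after all strings.
\<close>

locale labelled_order =
  fixes snk n :: nat and lt :: "nat \<Rightarrow> nat \<Rightarrow> bool" and lab ht :: "nat \<Rightarrow> nat"
  assumes lt_trans: "lt x y \<Longrightarrow> lt y z \<Longrightarrow> lt x z"
    and lt_less: "lt x y \<Longrightarrow> x < y"
    and lt_snk: "lt x y \<Longrightarrow> y \<le> snk"
    and lab_lt: "lab x \<noteq> 0 \<Longrightarrow> lt 0 x \<and> lt x snk"
    and src_snk: "lt 0 snk"
    and lab_0: "lab 0 = 0" and lab_snk: "lab snk = 0"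
    and lab_le: "lab x \<le> n"
    and meet: "\<lbrakk>lab x = lab y; lab x \<noteq> 0; lt a x; lt a y\<rbrakk> \<Longrightarrow>
      \<exists>w. lab w = lab x \<and> lt a w \<and> w \<le> x \<and> w \<le> y \<and> (\<forall>z. lt x z \<or> lt y z \<longrightarrow> lt w z)"
    and join: "\<lbrakk>lab x = lab y; lab x \<noteq> 0; lt x b; lt y b\<rbrakk> \<Longrightarrow>
      \<exists>w. lab w = lab x \<and> lt w b \<and> x \<le> w \<and> y \<le> w \<and> (\<forall>z. lt z x \<or> lt z y \<longrightarrow> lt z w)"
    and ht: "lt x y \<Longrightarrow> ht x < ht y"
    and ht_snk: "ht snk \<le> n + 1"
begin

text \<open>The default \<open>snk\<close> precedes no node, so a failed step stays at
  \<open>snk\<close> and never passes a test of the form \<open>lt (nxt a c) b\<close>. The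
  condition \<open>c \<noteq> 0\<close> keeps unlabelled nodes from counting as occurrences of a
  letter.\<close>

definition nxt :: "nat \<Rightarrow> nat \<Rightarrow> nat" where
  "nxt a c = (if c \<noteq> 0 \<and> (\<exists>x. lab x = c \<and> lt a x) then LEAST x. lab x = c \<and> lt a x else snk)"

text \<open>The default 0 also serves the search: by \<open>prv x 0 = 0\<close>, node 0 passes as
  the predecessor of the first node of a path.\<close>

definition prv :: "nat \<Rightarrow> nat \<Rightarrow> nat" where
  "prv b c = (if c \<noteq> 0 \<and> (\<exists>x. lab x = c \<and> lt x b) then GREATEST x. lab x = c \<and> lt x b else 0)"

definition gap_free :: "nat \<Rightarrow> nat \<Rightarrow> bool" where
  "gap_free a b \<longleftrightarrow> lt a b \<and> \<not> (\<exists>x. lab x \<noteq> 0 \<and> lt a x \<and> lt x b)"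

lemma not_lt_snk: "\<not> lt snk x"
  using lt_less lt_snk by (meson linorder_not_le)

text \<open>The meet of \<open>x\<close> and the least candidate is again a candidate and
  numerically no larger, so it is the least candidate itself. Thus the numerically least candidate
  precedes every node that \<open>x\<close> precedes, which makes the greedy choice safe.\<close>

lemma nxt:
  assumes "lt a x" "lab x \<noteq> 0"
  shows "lab (nxt a (lab x)) = lab x" "lt a (nxt a (lab x))" "lt x z \<Longrightarrow> lt (nxt a (lab x)) z"
proof -
  let ?P = "\<lambda>y. lab y = lab x \<and> lt a y"
  let ?y = "LEAST y. ?P y"
  have y: "nxt a (lab x) = ?y" using assms by (auto simp: nxt_def)
  have P: "?P ?y" using assms by (intro LeastI[of ?P x]) auto
  then show "lab (nxt a (lab x)) = lab x" "lt a (nxt a (lab x))" using y by auto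
  assume "lt x z"
  obtain w where w: "lab w = lab x" "lt a w" "w \<le> ?y" "\<forall>z. lt x z \<or> lt ?y z \<longrightarrow> lt w z"
    using meet[of ?y x a] P assms by auto
  have "w = ?y" using w Least_le[of ?P w] by auto
  then show "lt (nxt a (lab x)) z" using w \<open>lt x z\<close> y by auto
qed

text \<open>Dual, with joins; a greatest candidate exists because all candidates are numerically
  below \<open>b\<close>.\<close>

lemma prv:
  assumes "lt x b" "lab x \<noteq> 0"
  shows "lab (prv b (lab x)) = lab x" "lt (prv b (lab x)) b" "lt z x \<Longrightarrow> lt z (prv b (lab x))"
proof -
  let ?P = "\<lambda>y. lab y = lab x \<and> lt y b"
  let ?y = "GREATEST y. ?P y"
  have bd: "y \<le> b" if "?P y" for y using lt_less[of y b] that by auto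
  have y: "prv b (lab x) = ?y" using assms by (auto simp: prv_def)
  have P: "?P ?y" using assms bd by (intro GreatestI_nat[of ?P x b]) auto
  then show "lab (prv b (lab x)) = lab x" "lt (prv b (lab x)) b" using y by auto
  assume "lt z x"
  obtain w where w: "lab w = lab x" "lt w b" "?y \<le> w" "\<forall>z. lt z x \<or> lt z ?y \<longrightarrow> lt z w"
    using join[of ?y x b] P assms by auto
  have "w = ?y" using w Greatest_le_nat[of ?P w b] bd by (auto intro: antisym)
  then show "lt z (prv b (lab x))" using w \<open>lt z x\<close> y by auto
qed

lemma prv_nonzero:
  assumes "prv b c \<noteq> 0"
  shows "lab (prv b c) = c" "c \<noteq> 0" "lt (prv b c) b"
proof -
  obtain x where "c \<noteq> 0" "lab x = c" "lt x b"
    using assms unfolding prv_def by (auto split: if_splits)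
  then show "lab (prv b c) = c" "c \<noteq> 0" "lt (prv b c) b" using prv by auto
qed

lemma nxt_not_snk:
  assumes "nxt a c \<noteq> snk"
  shows "lab (nxt a c) = c" "c \<noteq> 0" "lt a (nxt a c)"
proof -
  obtain x where "c \<noteq> 0" "lab x = c" "lt a x"
    using assms unfolding nxt_def by (auto split: if_splits)
  then show "lab (nxt a c) = c" "c \<noteq> 0" "lt a (nxt a c)" using nxt by auto
qed

lemma nxt_le_snk: "nxt a c \<le> snk"
  using nxt_not_snk(3)[of a c] lt_snk by (cases "nxt a c = snk") auto

lemma prv_le_snk: "prv b c \<le> snk"
proof (cases "prv b c = 0")
  case False
  then show ?thesis using lab_lt[of "prv b c"] prv_nonzero[of b c] lt_snk
    by (metis lt_less less_imp_le)
qed simp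

text \<open>A letter occurs in a gap iff its leftmost occurrence after \<open>a\<close> does.
  Testing a gap then takes one lookup per label instead of one per node. The label 0 does no harm,
  since \<open>nxt a 0\<close> is \<open>snk\<close>.\<close>

lemma gap_free_iff_nxt:
  "gap_free a b \<longleftrightarrow> lt a b \<and> (\<forall>c\<le>n. \<not> lt (nxt a c) b)"
proof -
  have "\<exists>c\<le>n. lt (nxt a c) b" if "lab x \<noteq> 0" "lt a x" "lt x b" for x
    using nxt(3)[of a x b] lab_le[of x] that by auto
  moreover have "\<exists>x. lab x \<noteq> 0 \<and> lt a x \<and> lt x b" if "lt (nxt a c) b" for c
    using nxt_not_snk[of a c] not_lt_snk that by metis
  ultimately show ?thesis unfolding gap_free_def by blast
qed

section \<open>Chains of labelled nodes\<close>

fun chain :: "nat \<Rightarrow> nat list \<Rightarrow> nat \<Rightarrow> bool" where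
  "chain a [] b \<longleftrightarrow> lt a b"
| "chain a (x # xs) b \<longleftrightarrow> lt a x \<and> lab x \<noteq> 0 \<and> chain x xs b"

definition common :: "nat list \<Rightarrow> bool" where
  "common Y \<longleftrightarrow> (\<exists>xs. chain 0 xs snk \<and> map lab xs = Y)"

abbreviation leftmost :: "nat \<Rightarrow> nat list \<Rightarrow> nat" where
  "leftmost \<equiv> foldl nxt"

abbreviation rightmost :: "nat list \<Rightarrow> nat" where
  "rightmost Y \<equiv> foldr (\<lambda>c b. prv b c) Y snk"

lemma chain_append: "chain a (xs @ z # ys) b \<longleftrightarrow> chain a xs z \<and> lab z \<noteq> 0 \<and> chain z ys b"
  by (induction xs arbitrary: a) auto

lemma chain_mono_start: "chain a xs b \<Longrightarrow> (\<And>z. lt a z \<Longrightarrow> lt a' z) \<Longrightarrow> chain a' xs b"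
  by (cases xs) auto

text \<open>Greedy argument: replacing the first node by \<open>nxt a (lab x)\<close> keeps the rest
  a chain, because everything after \<open>x\<close> also lies after the leftmost
  occurrence.\<close>

lemma chain_leftmost: "chain a xs b \<Longrightarrow> lt (leftmost a (map lab xs)) b"
proof (induction xs arbitrary: a)
  case (Cons x xs)
  then have "chain (nxt a (lab x)) xs b"
    using nxt(3)[of a x] by (auto intro: chain_mono_start)
  then show ?case using Cons.IH by simp
qed simp

lemma chain_rightmost: "chain a xs snk \<Longrightarrow> lt a (rightmost (map lab xs))"
proof (induction xs arbitrary: a)
  case (Cons x xs)
  then have "lt x (rightmost (map lab xs))" by simp
  then show ?case using prv(3)[of x] Cons.prems by simp
qed simp

text \<open>The given chain only guarantees that the greedy steps succeed; its end \<open>b\<close>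
  can then be exchanged for any node after the leftmost embedding.\<close>

lemma leftmost_chain:
  "chain a xs b \<Longrightarrow> lt (leftmost a (map lab xs)) z \<Longrightarrow>
    \<exists>xs'. map lab xs' = map lab xs \<and> chain a xs' z"
proof (induction xs arbitrary: a)
  case (Cons x xs)
  let ?y = "nxt a (lab x)"
  have y: "lab ?y = lab x" "lt a ?y" "lab x \<noteq> 0" using nxt[of a x] Cons.prems by auto
  have "chain ?y xs b" using nxt(3)[of a x] Cons.prems by (auto intro: chain_mono_start)
  then obtain xs' where "map lab xs' = map lab xs" "chain ?y xs' z"
    using Cons.IH[of ?y] Cons.prems by auto
  then show ?case using y by (intro exI[of _ "?y # xs'"]) auto
qed auto

lemma rightmost_chain:
  "chain a xs snk \<Longrightarrow> lt z (rightmost (map lab xs)) \<Longrightarrow>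
    \<exists>xs'. map lab xs' = map lab xs \<and> chain z xs' snk"
proof (induction xs arbitrary: a z)
  case (Cons x xs)
  let ?b = "rightmost (map lab xs)"
  let ?y = "prv ?b (lab x)"
  have "lt x ?b" using Cons.prems chain_rightmost[of x xs] by auto
  then have y: "lab ?y = lab x" "lt ?y ?b" "lab x \<noteq> 0" using prv[of x ?b] Cons.prems by auto
  then obtain xs' where "map lab xs' = map lab xs" "chain ?y xs' snk"
    using Cons.IH[of x ?y] Cons.prems by auto
  then show ?case using y Cons.prems by (intro exI[of _ "?y # xs'"]) auto
qed auto

text \<open>A node of the inserted letter lies after the leftmost embedding of \<open>A\<close> and
  before the rightmost embedding of \<open>B\<close>. Conversely, such a node \<open>z\<close>
  leaves room to embed \<open>A\<close> leftmost before it and \<open>B\<close> rightmost after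
  it.\<close>

lemma common_insert_iff:
  assumes "common (A @ B)"
  shows "common (A @ c # B) \<longleftrightarrow> (\<exists>z. lab z = c \<and> c \<noteq> 0 \<and> lt (leftmost 0 A) z \<and> lt z (rightmost B))"
proof
  assume "common (A @ c # B)"
  then obtain xs z ys where "chain 0 (xs @ z # ys) snk" "map lab xs = A" "lab z = c" "map lab ys = B"
    unfolding common_def by (auto simp: map_eq_append_conv map_eq_Cons_conv)
  then show "\<exists>z. lab z = c \<and> c \<noteq> 0 \<and> lt (leftmost 0 A) z \<and> lt z (rightmost B)"
    using chain_leftmost chain_rightmost unfolding chain_append by metis
next
  assume "\<exists>z. lab z = c \<and> c \<noteq> 0 \<and> lt (leftmost 0 A) z \<and> lt z (rightmost B)"
  then obtain z where z: "lab z = c" "c \<noteq> 0" "lt (leftmost 0 A) z" "lt z (rightmost B)" by blast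
  obtain xs ys where xs: "chain 0 (xs @ ys) snk" "map lab xs = A" "map lab ys = B"
    using assms unfolding common_def by (auto simp: map_eq_append_conv)
  have 1: "\<exists>b. chain 0 xs b"
    using xs(1) by (cases ys) (auto simp: chain_append)
  have 2: "\<exists>a. chain a ys snk"
  proof (cases xs rule: rev_cases)
    case Nil
    then show ?thesis using xs by auto
  next
    case (snoc xs' x)
    then show ?thesis using xs chain_append[of 0 xs' x ys snk] by auto
  qed
  obtain xs' where "map lab xs' = A" "chain 0 xs' z" using 1 leftmost_chain xs(2) z(3) by metis
  moreover obtain ys' where "map lab ys' = B" "chain z ys' snk" using 2 rightmost_chain xs(3) z(4) by metis
  ultimately show "common (A @ c # B)"
    unfolding common_def using z by (intro exI[of _ "xs' @ z # ys'"]) (auto simp: chain_append)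
qed

lemma common_split:
  assumes "common (A @ B)"
  shows "lt (leftmost 0 A) (rightmost B)"
proof -
  obtain xs ys where xs: "chain 0 (xs @ ys) snk" "map lab xs = A" "map lab ys = B"
    using assms unfolding common_def by (auto simp: map_eq_append_conv)
  show ?thesis
  proof (cases ys)
    case Nil
    then show ?thesis using xs chain_leftmost by auto
  next
    case (Cons y ys')
    then have "chain 0 xs y" "lab y \<noteq> 0" "chain y ys' snk" using xs by (auto simp: chain_append)
    then have "lt (leftmost 0 A) y" "lt y (rightmost (map lab ys'))"
      using chain_leftmost chain_rightmost xs by auto
    then show ?thesis using prv(3)[of y "rightmost (map lab ys')"] xs Cons \<open>lab y \<noteq> 0\<close> by auto
  qed
qed

section \<open>Paths\<close>

text \<open>Only the rightmost nodes are listed. The leftmost node is recomputed on the way as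
  \<open>nxt a (lab r)\<close>, whereas a rightmost node depends on the rest of the word: the
  equation \<open>prv r' (lab r) = r\<close> checks it against the following one.\<close>

fun path :: "nat \<Rightarrow> nat list \<Rightarrow> bool" where
  "path a [] \<longleftrightarrow> False"
| "path a [r] \<longleftrightarrow> r = snk \<and> gap_free a r"
| "path a (r # r' # p) \<longleftrightarrow>
    r \<noteq> snk \<and> gap_free a r \<and> prv r' (lab r) = r \<and> path (nxt a (lab r)) (r' # p)"

abbreviation word :: "nat list \<Rightarrow> nat list" where
  "word p \<equiv> map lab (butlast p)"

lemma path_not_Nil: "path a p \<Longrightarrow> p \<noteq> []" by auto

lemma gap_free_less: "gap_free a r \<Longrightarrow> a < r" "gap_free a r \<Longrightarrow> r \<le> snk"
  using lt_less lt_snk by (auto simp: gap_free_def)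

lemma path_Cons_iff:
  assumes "p \<noteq> []"
  shows "path a (r # p) \<longleftrightarrow>
    r \<noteq> snk \<and> gap_free a r \<and> prv (hd p) (lab r) = r \<and> path (nxt a (lab r)) p"
  using assms by (cases p) auto

lemma path_rightmost:
  "path a p \<Longrightarrow> hd p = rightmost (word p)"
proof (induction a p rule: path.induct)
  case (3 a r r' p)
  then show ?case by auto
qed auto

text \<open>After the letters of \<open>A\<close>, the path stands at the pair of the leftmost node
  of \<open>A\<close> and the rightmost node of \<open>B\<close>, and the gap condition at this
  place is part of \<open>path\<close>.\<close>

lemma path_gap_free:
  "path a p \<Longrightarrow> word p = A @ B \<Longrightarrow> gap_free (leftmost a A) (rightmost B)"
proof (induction a p arbitrary: A rule: path.induct)
  case (3 a r r' p)
  show ?case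
  proof (cases A)
    case Nil
    have B: "B = word (r # r' # p)" using 3(3) Nil by simp
    have "rightmost B = r"
      using path_rightmost[OF 3(2)] unfolding B by (simp del: butlast.simps)
    then show ?thesis using 3 Nil by auto
  next
    case (Cons c A')
    then show ?thesis using 3 by auto
  qed
qed auto

lemma path_lab: 
  assumes "path a (r # r' # p)"
  shows "lab r \<noteq> 0" "lt r r'" "lt a r"
proof -
  have "prv r' (lab r) = r" "gap_free a r" using assms by auto
  moreover then have "r \<noteq> 0" using gap_free_less by fastforce
  ultimately show "lab r \<noteq> 0" "lt r r'" "lt a r"
    using prv_nonzero[of r' "lab r"] by (auto simp: gap_free_def)
qed

text \<open>The listed nodes themselves form an embedding: \<open>r\<close> precedes
  \<open>r'\<close> because it is a nonzero value of \<open>prv r'\<close>.\<close>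

lemma path_chain: "path a p \<Longrightarrow> chain a (butlast p) snk"
proof (induction a p rule: path.induct)
  case (3 a r r' p)
  have r: "lab r \<noteq> 0" "lt r r'" "lt a r" using path_lab 3(2) by blast+
  have "chain (nxt a (lab r)) (butlast (r' # p)) snk" using 3 by auto
  then have "chain r (butlast (r' # p)) snk" using r 3(2) by (cases p) auto
  then show ?case using r by auto
qed (auto simp: gap_free_def)

text \<open>The head of a path is the rightmost node of its word and hence determined by the word,
  and so is every later node. Distinct paths therefore give distinct outputs.\<close>

lemma path_word_inj: "path a p \<Longrightarrow> path a q \<Longrightarrow> word p = word q \<Longrightarrow> p = q"
proof (induction a p arbitrary: q rule: path.induct)
  case (2 a r)
  then show ?case by (cases "(a, q)" rule: path.cases) auto
next
  case (3 a r r' p)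
  then obtain s s' q' where q: "q = s # s' # q'" by (cases "(a, q)" rule: path.cases) auto
  have "r = s"
    using path_rightmost[OF 3(2)] path_rightmost[OF 3(3)] unfolding 3(4) q by (simp del: butlast.simps)
  moreover have "word (r' # p) = word (s' # q')" using 3(4) q by simp
  moreover have "path (nxt a (lab r)) (s' # q')" using 3(3) q calculation by simp
  ultimately show ?case using 3(1)[of "s' # q'"] 3(2) q by simp
qed auto

text \<open>Built from the right: the new head is \<open>prv\<close> of the rightmost node of the
  remaining word, so that the consistency check holds by construction.\<close>

lemma path_exists:
  assumes "chain a xs snk" "\<And>A B. map lab xs = A @ B \<Longrightarrow> gap_free (leftmost a A) (rightmost B)"
  shows "\<exists>p. path a p \<and> word p = map lab xs"
  using assms
proof (induction xs arbitrary: a)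
  case Nil
  then show ?case by (intro exI[of _ "[snk]"]) auto
next
  case (Cons x xs)
  let ?a = "nxt a (lab x)"
  have "chain ?a xs snk" using nxt(3)[of a x] Cons.prems(1) by (auto intro: chain_mono_start)
  moreover have "gap_free (leftmost ?a A) (rightmost B)" if "map lab xs = A @ B" for A B
    using Cons.prems(2)[of "lab x # A" B] that by simp
  ultimately obtain p where p: "path ?a p" "word p = map lab xs" using Cons.IH by blast
  let ?b = "rightmost (map lab xs)"
  let ?r = "prv ?b (lab x)"
  have "lt x ?b" using chain_rightmost Cons.prems by auto
  then have r: "lab ?r = lab x" "lt ?r ?b" using prv[of x ?b] Cons.prems by auto
  have "gap_free a ?r" using Cons.prems(2)[of "[]" "lab x # map lab xs"] by simp
  moreover have "?r \<noteq> snk" using r lab_snk Cons.prems by auto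
  ultimately have "path a (?r # p)"
    using p path_rightmost[OF p(1)] r path_not_Nil[OF p(1)] by (simp add: path_Cons_iff)
  then show ?case using p r path_not_Nil[OF p(1)] by (intro exI[of _ "?r # p"]) auto
qed

text \<open>Maximality is tested against insertions of a single letter here; the passage to
  arbitrary proper supersequences happens on the level of strings.\<close>

lemma path_iff_maximal:
  "(\<exists>p. path 0 p \<and> word p = Y) \<longleftrightarrow>
    common Y \<and> (\<forall>A B c. Y = A @ B \<longrightarrow> \<not> common (A @ c # B))"
proof
  assume "\<exists>p. path 0 p \<and> word p = Y"
  then obtain p where p: "path 0 p" "word p = Y" by blast
  have c: "common Y" unfolding common_def using path_chain p by blast
  have "\<not> common (A @ z # B)" if "Y = A @ B" for A B z
    using common_insert_iff[of A B z] path_gap_free[OF p(1), of A B] p(2) c that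
    unfolding gap_free_def by auto
  with c show "common Y \<and> (\<forall>A B c. Y = A @ B \<longrightarrow> \<not> common (A @ c # B))" by blast
next
  assume Y: "common Y \<and> (\<forall>A B c. Y = A @ B \<longrightarrow> \<not> common (A @ c # B))"
  then obtain xs where xs: "chain 0 xs snk" "map lab xs = Y" unfolding common_def by blast
  have "gap_free (leftmost 0 A) (rightmost B)" if "map lab xs = A @ B" for A B
    unfolding gap_free_def
  proof
    show "lt (leftmost 0 A) (rightmost B)" using common_split Y xs that by auto
    show "\<not> (\<exists>x. lab x \<noteq> 0 \<and> lt (leftmost 0 A) x \<and> lt x (rightmost B))"
      using common_insert_iff[of A B] Y xs that by auto
  qed
  from path_exists[OF xs(1) this] xs(2) show "\<exists>p. path 0 p \<and> word p = Y" by auto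
qed

definition good :: "nat \<Rightarrow> nat \<Rightarrow> bool" where
  "good a r \<longleftrightarrow> (\<exists>p. path a (r # p))"

text \<open>The recursion along edges by which the table of good pairs is computed.\<close>

lemma good_iff:
  "good a r \<longleftrightarrow> gap_free a r \<and> (r = snk \<or> (\<exists>r'. prv r' (lab r) = r \<and> good (nxt a (lab r)) r'))"
proof
  assume "good a r"
  then obtain p where p: "path a (r # p)" unfolding good_def by blast
  then show "gap_free a r \<and> (r = snk \<or> (\<exists>r'. prv r' (lab r) = r \<and> good (nxt a (lab r)) r'))"
    unfolding good_def by (cases p) auto
next
  assume g: "gap_free a r \<and> (r = snk \<or> (\<exists>r'. prv r' (lab r) = r \<and> good (nxt a (lab r)) r'))"
  show "good a r"
  proof (cases "r = snk")
    case True
    then show ?thesis using g unfolding good_def by (intro exI[of _ "[]"]) auto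
  next
    case False
    then obtain r' p where "prv r' (lab r) = r" "path (nxt a (lab r)) (r' # p)"
      using g unfolding good_def by blast
    then show ?thesis using g False unfolding good_def by (intro exI[of _ "r' # p"]) auto
  qed
qed

text \<open>The height of the leftmost node grows with every letter. This bounds the depth of the
  search and makes the set of paths finite.\<close>

lemma path_ht: "path a p \<Longrightarrow> length p + ht a \<le> n + 1"
proof (induction a p rule: path.induct)
  case (2 a r)
  then show ?case using ht[of a snk] ht_snk by (auto simp: gap_free_def)
next
  case (3 a r r' p)
  have "lt a (nxt a (lab r))" using nxt(2) path_lab[OF 3(2)] by blast
  then show ?case using ht[of a "nxt a (lab r)"] 3 by auto
qed auto

lemma path_le_snk: "path a p \<Longrightarrow> x \<in> set p \<Longrightarrow> 0 < x \<and> x \<le> snk"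
proof (induction a p rule: path.induct)
  case (2 a r)
  then show ?case using gap_free_less[of a r] by auto
next
  case (3 a r r' p)
  then show ?case using gap_free_less[of a r] by auto
qed auto

lemma path_snk: "path a (xs @ snk # ys) \<Longrightarrow> ys = []"
proof (induction xs arbitrary: a)
  case Nil
  then show ?case by (cases ys) auto
next
  case (Cons x xs)
  then show ?case by (cases xs) auto
qed

lemma finite_paths: "finite {p. path a p}"
proof (rule finite_subset)
  show "{p. path a p} \<subseteq> {p. set p \<subseteq> {..snk} \<and> length p \<le> n + 1}"
  proof (rule subsetI)
    fix p
    assume "p \<in> {p. path a p}"
    then have "path a p" by simp
    then show "p \<in> {p. set p \<subseteq> {..snk} \<and> length p \<le> n + 1}"
      using path_ht[of a p] path_le_snk[of a p] by auto
  qed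
  show "finite {p. set p \<subseteq> {..snk} \<and> length p \<le> n + 1}"
    by (rule finite_lists_length_le) simp
qed

text \<open>Whether a partial path can be extended by a node depends on its last node and its leftmost node only.\<close>

lemma path_swap:
  assumes "path a (xs @ r # p)"
  shows "(\<exists>q. path a (xs @ x # q)) \<longleftrightarrow>
    (xs \<noteq> [] \<longrightarrow> prv x (lab (last xs)) = last xs) \<and> good (leftmost a (map lab xs)) x"
  using assms
proof (induction xs arbitrary: a)
  case Nil
  then show ?case by (simp add: good_def)
next
  case (Cons y ys)
  show ?case
  proof (cases ys)
    case Nil
    then show ?thesis using Cons.prems by (auto simp: good_def)
  next
    case (Cons z zs)
    then have "path (nxt a (lab y)) (ys @ r # p)" using Cons.prems by auto
    from Cons.IH[OF this] show ?thesis using Cons.prems Cons by auto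
  qed
qed

end

section \<open>Nodes as tuples of positions\<close>

lemma concat_nth_offset:
  "j < length S \<Longrightarrow> q < length (S ! j) \<Longrightarrow>
    concat S ! (sum_list (map length (take j S)) + q) = S ! j ! q"
proof (induction S arbitrary: j)
  case (Cons X S)
  then show ?case by (cases j) (auto simp: nth_append add.assoc)
qed simp

lemma array_of_concat:
  assumes "j < length S" "q < length (S ! j)"
  shows "array_of (concat S) (sum_list (map length (take j S)) + q) = S ! j ! q"
proof -
  have "length (concat S) = length (concat (take j S)) + length (S ! j) + length (concat (drop (Suc j) S))"
    using id_take_nth_drop[OF assms(1)] by (metis concat.simps(2) concat_append length_append add.assoc)
  then have "sum_list (map length (take j S)) + q < length (concat S)"
    using assms(2) by (simp add: length_concat)
  then show ?thesis using concat_nth_offset[OF assms] by (simp add: array_of_def)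
qed

text \<open>The first letter of \<open>Z\<close> that the embedding of \<open>Y\<close> skips can be
  inserted at that place. It reduces maximality to insertions of one letter.\<close>

lemma subseq_insert:
  assumes "subseq Y Z" "Y \<noteq> Z"
  shows "\<exists>A B c. Y = A @ B \<and> subseq (A @ c # B) Z"
  using assms
proof (induction rule: list_emb.induct)
  case (list_emb_Nil Z)
  then obtain c Z' where "Z = c # Z'" by (cases Z) auto
  then show ?case by (intro exI[of _ "[]"] exI[of _ c]) auto
next
  case (list_emb_Cons Y Z z)
  then show ?case by (intro exI[of _ "[]"] exI[of _ Y] exI[of _ z]) auto
next
  case (list_emb_Cons2 y z Y Z)
  then obtain A B c where "Y = A @ B" "subseq (A @ c # B) Z" by auto
  then show ?case
    using list_emb_Cons2 by (intro exI[of _ "y # A"] exI[of _ B] exI[of _ c]) auto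
qed

text \<open>Positions count from 1, so \<open>drop p X\<close> is what remains after the letter at
  \<open>p\<close>, and 0 stands for the place before the string.\<close>

lemma subseq_Cons_drop:
  assumes "subseq (c # Y) (drop i X)"
  shows "\<exists>p. i < p \<and> p \<le> length X \<and> X ! (p - 1) = c \<and> subseq Y (drop p X)"
proof -
  obtain us vs where X: "drop i X = us @ c # vs" "subseq Y vs"
    using assms by (auto elim: list_emb_ConsD[THEN exE])
  have "i < length X" using X by (metis drop_all append_is_Nil_conv list.distinct(1) not_le)
  have len: "length X = i + length us + 1 + length vs"
    using arg_cong[OF X(1), of length] \<open>i < length X\<close> by simp
  let ?p = "i + length us + 1"
  have "X ! (?p - 1) = drop i X ! length us" using \<open>i < length X\<close> by simp
  then have "X ! (?p - 1) = c" using X by simp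
  moreover have "drop ?p X = vs"
  proof -
    have "drop ?p X = drop (length us + 1) (drop i X)" by (simp add: add.commute)
    then show ?thesis using X by simp
  qed
  ultimately show ?thesis using len X by (intro exI[of _ ?p]) auto
qed

lemma subseq_drop_Cons:
  assumes "i < p" "p \<le> length X" "subseq Y (drop p X)"
  shows "subseq (X ! (p - 1) # Y) (drop i X)"
proof -
  have "drop (p - 1) X = X ! (p - 1) # drop p X"
    using assms Cons_nth_drop_Suc[of "p - 1" X] by simp
  moreover have "drop (p - 1) X = drop (p - 1 - i) (drop i X)" using assms by simp
  ultimately show ?thesis
    using assms(3) by (metis subseq_Cons2 subseq_order.trans suffix_drop suffix_imp_subseq)
qed

text \<open>The numerical order extends the componentwise order of digit tuples. This is why
  \<open>LEAST\<close> and \<open>GREATEST\<close> pick out componentwise minima and maxima.\<close>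

lemma digits_le:
  fixes x y b :: nat
  assumes "x < b ^ k" "y < b ^ k" "\<And>j. j < k \<Longrightarrow> x div b ^ j mod b \<le> y div b ^ j mod b"
  shows "x \<le> y"
  using assms
proof (induction k arbitrary: x y)
  case (Suc k)
  have "x div b < b ^ k" "y div b < b ^ k" using Suc.prems by (auto intro: less_mult_imp_div_less simp: mult.commute)
  moreover have "x div b div b ^ j mod b \<le> y div b div b ^ j mod b" if "j < k" for j
    using Suc.prems(3)[of "Suc j"] that by (simp add: div_mult2_eq)
  ultimately have "x div b \<le> y div b" by (rule Suc.IH)
  moreover have "x mod b \<le> y mod b" using Suc.prems(3)[of 0] by simp
  ultimately have "x div b * b + x mod b \<le> y div b * b + y mod b"
    by (intro add_mono mult_le_mono1)
  then show ?case by simp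
qed simp

lemma digits_exist:
  fixes b :: nat
  assumes "\<And>j. j < k \<Longrightarrow> f j < b"
  shows "\<exists>x < b ^ k. \<forall>j<k. x div b ^ j mod b = f j"
  using assms
proof (induction k arbitrary: f)
  case (Suc k)
  have f0: "f 0 < b" using Suc.prems by simp
  obtain x where x: "x < b ^ k" "\<forall>j<k. x div b ^ j mod b = f (Suc j)"
    using Suc.IH[of "\<lambda>j. f (Suc j)"] Suc.prems by auto
  let ?y = "f 0 + b * x"
  have y: "?y div b = x" "?y mod b = f 0" using f0 by auto
  have "?y < b * Suc x" using f0 by simp
  also have "\<dots> \<le> b ^ Suc k" using x(1) by (metis Suc_leI mult_le_mono2 power_Suc)
  finally have "?y < b ^ Suc k" .
  moreover have "?y div b ^ j mod b = f j" if "j < Suc k" for j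
    using y x(2) that by (cases j) (auto simp: div_mult2_eq)
  ultimately show ?case by blast
qed simp

section \<open>Positions, labels and order of the nodes for given strings\<close>

locale strings =
  fixes S :: "nat list list"
  assumes nonempty: "S \<noteq> []"
begin

text \<open>The inserted 1 keeps \<open>n\<close> a usable base when all strings are empty.\<close>

definition n :: nat where "n = Max (insert 1 (length ` set S))"
abbreviation k :: nat where "k \<equiv> length S"
definition M :: nat where "M = n ^ k"
definition snk :: nat where "snk = M + 1"

text \<open>The digits of \<open>x - 1\<close> in base \<open>n\<close>, shifted to positions from
  1. The source gets position 0 and the sink \<open>n + 1\<close> in every string, so both compare
  correctly with all tuples.\<close>

definition pos :: "nat \<Rightarrow> nat \<Rightarrow> nat" where
  "pos j x = (if x = 0 then 0 else if x = snk then n + 1 else (x - 1) div n ^ j mod n + 1)"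

definition matched :: "nat \<Rightarrow> bool" where
  "matched x \<longleftrightarrow> x \<noteq> 0 \<and> x \<le> M \<and>
    (\<forall>j<k. pos j x \<le> length (S ! j) \<and> S ! j ! (pos j x - 1) = S ! 0 ! (pos 0 x - 1))"

definition letter :: "nat \<Rightarrow> nat" where
  "letter q = array_of (concat S) (q - 1)"

text \<open>The first position of the letter, instead of the letter itself: it is nonzero, it is at
  most \<open>n\<close> whatever the alphabet, and \<open>letter\<close> recovers the letter from
  it.\<close>

definition lab :: "nat \<Rightarrow> nat" where
  "lab x = (if matched x then LEAST q. q \<noteq> 0 \<and> letter q = letter (pos 0 x) else 0)"

text \<open>The bounds by \<open>snk\<close> are essential: numbers beyond \<open>snk\<close> still
  have digits, but are not nodes.\<close>

definition lt :: "nat \<Rightarrow> nat \<Rightarrow> bool" where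
  "lt x y \<longleftrightarrow> x \<le> snk \<and> y \<le> snk \<and> (\<forall>j<k. pos j x < pos j y)"

lemma n_pos: "1 \<le> n" and length_le_n: "X \<in> set S \<Longrightarrow> length X \<le> n"
  unfolding n_def by (auto intro: Max_ge)

lemma k_pos: "0 < k" using nonempty by simp

lemma M_pos: "1 \<le> M" using n_pos unfolding M_def by simp

lemma pos_bounds: "x \<noteq> 0 \<Longrightarrow> x \<noteq> snk \<Longrightarrow> 1 \<le> pos j x \<and> pos j x \<le> n"
  using n_pos unfolding pos_def by (simp add: Suc_leI)

lemma pos_0: "pos j 0 = 0" and pos_snk: "pos j snk = n + 1"
  by (auto simp: pos_def snk_def)

lemma pos_le: "pos j x \<le> n + 1"
  using pos_bounds[of x j] by (cases "x = 0 \<or> x = snk") (auto simp: pos_0 pos_snk)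

lemma pos_mono:
  assumes "0 < x" "x \<le> M" "0 < y" "y \<le> M" "\<And>j. j < k \<Longrightarrow> pos j x \<le> pos j y"
  shows "x \<le> y"
proof -
  have "x - 1 \<le> y - 1"
    by (rule digits_le[of _ n k]) (use assms in \<open>auto simp: M_def pos_def snk_def split: if_splits\<close>)
  then show ?thesis using assms by linarith
qed

lemma pos_exists:
  assumes "\<And>j. j < k \<Longrightarrow> 1 \<le> p j \<and> p j \<le> n"
  shows "\<exists>x. 0 < x \<and> x \<le> M \<and> (\<forall>j<k. pos j x = p j)"
proof -
  have "\<exists>x<n ^ k. \<forall>j<k. x div n ^ j mod n = p j - 1"
    using assms by (intro digits_exist) fastforce
  then obtain x where "x < n ^ k" "\<forall>j<k. x div n ^ j mod n = p j - 1" by blast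
  then show ?thesis
    using assms by (intro exI[of _ "x + 1"]) (fastforce simp: pos_def M_def snk_def)
qed

lemma letter_eq: "1 \<le> q \<Longrightarrow> q \<le> length (S ! 0) \<Longrightarrow> letter q = S ! 0 ! (q - 1)"
  using array_of_concat[of 0 S "q - 1"] nonempty by (simp add: letter_def)

lemma matched_range: "matched x \<Longrightarrow> 0 < x \<and> x \<le> M \<and> x \<noteq> snk"
  unfolding matched_def snk_def by linarith

lemma matched_letter:
  assumes "matched x" "j < k"
  shows "1 \<le> pos j x" "pos j x \<le> length (S ! j)" "S ! j ! (pos j x - 1) = letter (pos 0 x)"
proof -
  have x: "x \<noteq> 0" "x \<noteq> snk" using matched_range[OF assms(1)] by auto
  have l: "\<And>j. j < k \<Longrightarrow> pos j x \<le> length (S ! j)"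
    "S ! j ! (pos j x - 1) = S ! 0 ! (pos 0 x - 1)"
    using assms unfolding matched_def by blast+
  show "1 \<le> pos j x" using pos_bounds[OF x] by simp
  show "pos j x \<le> length (S ! j)" by (rule l(1)[OF assms(2)])
  show "S ! j ! (pos j x - 1) = letter (pos 0 x)"
    using l(2) letter_eq[of "pos 0 x"] pos_bounds[OF x, of 0] l(1)[OF k_pos] by metis
qed

lemma lab_matched:
  assumes "matched x"
  shows "lab x \<noteq> 0" "lab x \<le> pos 0 x" "letter (lab x) = letter (pos 0 x)"
proof -
  let ?P = "\<lambda>q. q \<noteq> 0 \<and> letter q = letter (pos 0 x)"
  have P: "?P (pos 0 x)" using matched_letter[OF assms k_pos] by simp
  show "lab x \<noteq> 0" "letter (lab x) = letter (pos 0 x)"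
    using LeastI[of ?P, OF P] assms by (auto simp: lab_def)
  show "lab x \<le> pos 0 x" using Least_le[of ?P, OF P] assms by (auto simp: lab_def)
qed

lemma lab_nonzero: "lab x \<noteq> 0 \<longleftrightarrow> matched x" "0 < lab x \<longleftrightarrow> matched x"
  using lab_matched by (auto simp: lab_def)

lemma lt_pos: "lt x y \<Longrightarrow> j < k \<Longrightarrow> pos j x < pos j y"
  by (simp add: lt_def)

lemma letter_lab_inj: "lab x \<noteq> 0 \<Longrightarrow> lab y \<noteq> 0 \<Longrightarrow> letter (lab x) = letter (lab y) \<Longrightarrow> lab x = lab y"
  unfolding lab_nonzero using lab_matched by (simp add: lab_def)

lemma letter_lab: "lab x \<noteq> 0 \<Longrightarrow> j < k \<Longrightarrow> S ! j ! (pos j x - 1) = letter (lab x)"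
  unfolding lab_nonzero using lab_matched matched_letter by simp

lemma matchedI:
  assumes "0 < x" "x \<le> M" "\<And>j. j < k \<Longrightarrow> pos j x \<le> length (S ! j) \<and> S ! j ! (pos j x - 1) = c"
  shows "matched x" "letter (lab x) = c"
proof -
  show "matched x" using assms k_pos unfolding matched_def by auto
  then show "letter (lab x) = c" using letter_lab[of x 0] assms(3)[of 0] k_pos lab_nonzero by auto
qed

text \<open>Choosing in each string the position of one of two nodes with the same letter again
  gives a tuple carrying this letter. The choices \<open>min\<close> and \<open>max\<close> provide
  meets and joins.\<close>

lemma pointwise:
  assumes "lab x = lab y" "lab x \<noteq> 0"
    and p: "\<And>j. j < k \<Longrightarrow> p j = pos j x \<or> p j = pos j y"
  shows "\<exists>w. 0 < w \<and> w \<le> M \<and> lab w = lab x \<and> (\<forall>j<k. pos j w = p j)"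
proof -
  have xy: "matched x" "matched y" using assms(1,2) lab_nonzero by metis+
  have "1 \<le> p j \<and> p j \<le> n" if "j < k" for j
    using xy[THEN matched_range] p[OF that] pos_bounds[of x j] pos_bounds[of y j] by auto
  then obtain w where w: "0 < w" "w \<le> M" "\<forall>j<k. pos j w = p j"
    using pos_exists[of p] by blast
  have "pos j w \<le> length (S ! j) \<and> S ! j ! (pos j w - 1) = letter (lab x)" if "j < k" for j
    using w(3) p[OF that] matched_letter(2)[OF xy(1) that] matched_letter(2)[OF xy(2) that]
      letter_lab[of x j] letter_lab[of y j] assms(1,2) that by auto
  from matchedI[OF w(1,2) this] have "lab w = lab x"
    using letter_lab_inj[of w x] assms lab_nonzero by auto
  then show ?thesis using w by blast
qed

lemma lt_less: "lt x y \<Longrightarrow> x < y"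
proof (rule ccontr)
  assume l: "lt x y" and "\<not> x < y"
  then have le: "y \<le> x" "x \<le> snk" "pos 0 x < pos 0 y" using k_pos by (auto simp: lt_def)
  then have "y \<noteq> 0" "x \<noteq> snk" using pos_le[of 0 y] by (auto simp: pos_0 pos_snk intro: gr0I)
  then have xy: "0 < x" "x \<le> M" "0 < y" "y \<le> M" using le by (auto simp: snk_def)
  have "x \<le> y" by (rule pos_mono[OF xy]) (use l in \<open>auto simp: lt_def less_imp_le\<close>)
  then show False using le by auto
qed

sublocale labelled_order snk n lt lab "pos 0"
proof (unfold_locales, goal_cases)
  case (1 x y z)
  then show ?case unfolding lt_def by force
next
  case (2 x y)
  then show ?case by (rule lt_less)
next
  case (3 x y)
  then show ?case by (simp add: lt_def)
next
  case (4 x)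
  then have x: "x \<noteq> 0" "x \<le> M" using lab_nonzero(1)[of x] matched_range[of x] by auto
  then show ?case
    using pos_bounds[of x] pos_snk by (auto simp: lt_def pos_0 pos_snk snk_def Suc_le_eq less_Suc_eq_le)
next
  case 5
  then show ?case by (auto simp: lt_def pos_0 pos_snk)
next
  case 6
  then show ?case using lab_nonzero(1)[of 0] matched_range[of 0] by auto
next
  case 7
  then show ?case using lab_nonzero(1)[of snk] matched_range[of snk] by auto
next
  case (8 x)
  show ?case
  proof (cases "matched x")
    case True
    have "pos 0 x \<le> n" using pos_bounds[of x 0] matched_range[OF True] by auto
    then show ?thesis using lab_matched(2)[OF True] by simp
  next
    case False
    then show ?thesis by (simp add: lab_def)
  qed
next
  case (9 x y a)
  obtain w where w: "0 < w" "w \<le> M" "lab w = lab x" "\<forall>j<k. pos j w = min (pos j x) (pos j y)"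
    using pointwise[OF 9(1,2), of "\<lambda>j. min (pos j x) (pos j y)"] by (metis min_def)
  have "matched x" "matched y" using lab_nonzero(1)[of x] lab_nonzero(1)[of y] 9(1,2) by auto
  then have xy: "0 < x" "x \<le> M" "0 < y" "y \<le> M" using matched_range by blast+
  have "w \<le> x" using pos_mono[OF w(1,2) xy(1,2)] w(4) by simp
  moreover have "w \<le> y" using pos_mono[OF w(1,2) xy(3,4)] w(4) by simp
  ultimately show ?case using w 9 by (intro exI[of _ w]) (auto simp: lt_def min_less_iff_disj)
next
  case (10 x y b)
  obtain w where w: "0 < w" "w \<le> M" "lab w = lab x" "\<forall>j<k. pos j w = max (pos j x) (pos j y)"
    using pointwise[OF 10(1,2), of "\<lambda>j. max (pos j x) (pos j y)"] by (metis max_def)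
  have "matched x" "matched y" using lab_nonzero(1)[of x] lab_nonzero(1)[of y] 10(1,2) by auto
  then have xy: "0 < x" "x \<le> M" "0 < y" "y \<le> M" using matched_range by blast+
  have "x \<le> w" using pos_mono[OF xy(1,2) w(1,2)] w(4) by simp
  moreover have "y \<le> w" using pos_mono[OF xy(3,4) w(1,2)] w(4) by simp
  ultimately show ?case using w 10 by (intro exI[of _ w]) (auto simp: lt_def less_max_iff_disj snk_def)
next
  case (11 x y)
  then show ?case using k_pos by (simp add: lt_def)
next
  case 12
  then show ?case by (simp add: pos_snk)
qed

section \<open>Chains of nodes as common subsequences\<close>

lemma chain_subseq:
  "chain a xs snk \<Longrightarrow> j < k \<Longrightarrow> subseq (map (letter \<circ> lab) xs) (drop (pos j a) (S ! j))"
proof (induction xs arbitrary: a)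
  case (Cons x xs)
  then have x: "matched x" "pos j a < pos j x" by (auto simp: lab_nonzero dest: lt_pos)
  then show ?case
    using Cons subseq_drop_Cons[of "pos j a" "pos j x" "S ! j"] matched_letter[OF x(1) Cons.prems(2)]
      letter_lab[of x j] by auto
qed simp

text \<open>The positions of the first letter are chosen independently in each string and combined
  into one node. The bound \<open>a \<le> M\<close> excludes \<open>snk\<close>, which nothing
  follows.\<close>

lemma subseq_chain:
  assumes "a \<le> M" "\<And>j. j < k \<Longrightarrow> subseq Y (drop (pos j a) (S ! j))"
  shows "\<exists>xs. chain a xs snk \<and> map (letter \<circ> lab) xs = Y"
  using assms
proof (induction Y arbitrary: a)
  case Nil
  have "pos j a < n + 1" for j
    using Nil(1) pos_bounds[of a j] by (cases "a = 0") (auto simp: pos_0 snk_def)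
  then have "lt a snk" using Nil(1) pos_snk by (simp add: lt_def snk_def)
  then show ?case by (intro exI[of _ "[]"]) simp
next
  case (Cons c Y)
  have "\<forall>j. \<exists>p. j < k \<longrightarrow>
      pos j a < p \<and> p \<le> length (S ! j) \<and> S ! j ! (p - 1) = c \<and> subseq Y (drop p (S ! j))"
    using subseq_Cons_drop[OF Cons.prems(2)] by metis
  then obtain p where p: "\<And>j. j < k \<Longrightarrow>
      pos j a < p j \<and> p j \<le> length (S ! j) \<and> S ! j ! (p j - 1) = c \<and> subseq Y (drop (p j) (S ! j))"
    by metis
  have "1 \<le> p j \<and> p j \<le> n" if "j < k" for j
    using p[OF that] length_le_n[of "S ! j"] that by auto
  then obtain x where x: "0 < x" "x \<le> M" "\<forall>j<k. pos j x = p j" using pos_exists[of p] by blast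
  have m: "matched x" "letter (lab x) = c" using matchedI[OF x(1,2), of c] x(3) p by auto
  obtain xs where "chain x xs snk" "map (letter \<circ> lab) xs = Y"
    using Cons.IH[of x] x p by auto
  moreover have "lt a x" using x p Cons.prems(1) by (auto simp: lt_def snk_def)
  ultimately show ?case using m lab_nonzero by (intro exI[of _ "x # xs"]) auto
qed

lemma common_subseq_iff: "common_subseq S Y \<longleftrightarrow> (\<exists>L. common L \<and> map letter L = Y)"
proof
  assume "common_subseq S Y"
  then have "subseq Y (drop (pos j 0) (S ! j))" if "j < k" for j
    using that by (auto simp: common_subseq_def pos_0)
  then obtain xs where "chain 0 xs snk" "map (letter \<circ> lab) xs = Y" using subseq_chain[of 0 Y] by auto
  then show "\<exists>L. common L \<and> map letter L = Y"
    unfolding common_def by (intro exI[of _ "map lab xs"]) auto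
next
  assume "\<exists>L. common L \<and> map letter L = Y"
  then obtain xs where xs: "chain 0 xs snk" "map (letter \<circ> lab) xs = Y" unfolding common_def by auto
  show "common_subseq S Y"
    unfolding common_subseq_def
    using chain_subseq[OF xs(1)] xs(2) by (auto simp: in_set_conv_nth pos_0)
qed

lemma chain_labels: "chain a xs b \<Longrightarrow> set (map lab xs) \<subseteq> range lab - {0}"
  by (induction xs arbitrary: a) auto

lemma common_labels: "common L \<Longrightarrow> set L \<subseteq> range lab - {0}"
  unfolding common_def using chain_labels by blast

text \<open>Each label is the least position of its letter, so a letter has only one label. Without
  the restriction to labels, repeated letters destroy injectivity.\<close>

lemma inj_on_letter: "inj_on letter (range lab - {0})"
  using letter_lab_inj by (auto intro!: inj_onI)

lemma map_letter_inj:
  assumes "common L" "set L' \<subseteq> range lab - {0}" "map letter L = map letter L'"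
  shows "L = L'"
  using assms common_labels[of L] inj_on_subset[OF inj_on_letter, of "set L \<union> set L'"]
  by (intro map_inj_on[of letter L L']) auto

text \<open>Argued through the strings, where closure under subsequences is immediate; injectivity
  of \<open>letter\<close> leads back to the same word of labels.\<close>

lemma common_delete:
  assumes "common (A @ c # B)"
  shows "common (A @ B)"
proof -
  have "common_subseq S (map letter (A @ c # B))" using common_subseq_iff assms by blast
  moreover have "subseq (map letter (A @ B)) (map letter (A @ c # B))"
    by (auto intro: list_emb_append_mono)
  ultimately have "common_subseq S (map letter (A @ B))"
    unfolding common_subseq_def using subseq_order.trans by blast
  then obtain L where L: "common L" "map letter L = map letter (A @ B)" using common_subseq_iff by blast
  have "L = A @ B"
    using map_letter_inj[OF L(1) _ L(2)] common_labels[OF assms] by auto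
  then show ?thesis using L by simp
qed

lemma MCS_eq: "MCS S = (\<lambda>p. map letter (word p)) ` {p. path 0 p}"
proof (intro equalityI subsetI)
  fix Y
  assume Y: "Y \<in> MCS S"
  then obtain L where L: "common L" "map letter L = Y"
    using common_subseq_iff by (auto simp: MCS_def)
  have "\<not> common (A @ c # B)" if "L = A @ B" for A B c
  proof
    assume "common (A @ c # B)"
    then have "common_subseq S (map letter (A @ c # B))" using common_subseq_iff by blast
    moreover have "strict_subseq Y (map letter (A @ c # B))"
    proof -
      have "length Y \<noteq> length (map letter (A @ c # B))" using L that by auto
      then have "Y \<noteq> map letter (A @ c # B)" by metis
      moreover have "subseq Y (map letter (A @ c # B))"
        using L that by (auto intro: list_emb_append_mono)
      ultimately show ?thesis by (simp add: subseq_order.less_le)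
    qed
    ultimately show False using Y by (auto simp: MCS_def)
  qed
  then obtain p where "path 0 p" "word p = L" using path_iff_maximal[of L] L by blast
  then show "Y \<in> (\<lambda>p. map letter (word p)) ` {p. path 0 p}" using L by auto
next
  fix Y
  assume "Y \<in> (\<lambda>p. map letter (word p)) ` {p. path 0 p}"
  then obtain p where p: "path 0 p" "Y = map letter (word p)" by blast
  define L where "L = word p"
  have L: "common L" "\<And>A B c. L = A @ B \<Longrightarrow> \<not> common (A @ c # B)"
    using path_iff_maximal[of L] p(1) unfolding L_def by blast+
  have Y: "Y = map letter L" using p(2) L_def by simp
  have "\<not> strict_subseq Y Z" if Z: "common_subseq S Z" for Z
  proof
    assume "strict_subseq Y Z"
    \<comment> \<open>A proper supersequence yields a one-letter insertion that is still common.
      Translated into labels, it contradicts the maximality of \<open>L\<close>, once deleting the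
      inserted label is seen to give back \<open>L\<close>.\<close>
    then obtain A B c where AB: "Y = A @ B" "subseq (A @ c # B) Z"
      using subseq_insert[of Y Z] by (auto simp: subseq_order.less_le)
    then have "common_subseq S (A @ c # B)"
      using Z unfolding common_subseq_def using subseq_order.trans by blast
    then obtain L' where L': "common L'" "map letter L' = A @ c # B"
      using common_subseq_iff by blast
    then obtain A' c' B' where L'_eq: "L' = A' @ c' # B'" "map letter A' = A" "map letter B' = B"
      by (auto simp: map_eq_append_conv map_eq_Cons_conv)
    have "map letter L = map letter (A' @ B')" using L'_eq AB(1) Y by simp
    moreover have "common (A' @ B')" using common_delete L'(1) L'_eq(1) by blast
    ultimately have "L = A' @ B'" using map_letter_inj[OF L(1)] common_labels by blast
    then show False using L(2) L'(1) L'_eq(1) by blast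
  qed
  moreover have "common_subseq S Y" using L Y common_subseq_iff by blast
  ultimately show "Y \<in> MCS S" by (auto simp: MCS_def)
qed

lemma inj_on_word: "inj_on (\<lambda>p. map letter (word p)) {p. path 0 p}"
proof (rule inj_onI)
  fix p q
  assume pq: "p \<in> {p. path 0 p}" "q \<in> {p. path 0 p}" "map letter (word p) = map letter (word q)"
  then have "common (word p)" "common (word q)" using path_iff_maximal by auto
  then have "word p = word q" using pq(3) map_letter_inj common_labels by blast
  then show "p = q" using path_word_inj pq by simp
qed

end

section \<open>Computing the tables\<close>

abbreviation (input) "aV \<equiv> 3 :: nat"
abbreviation (input) "aN \<equiv> 4 :: nat"
abbreviation (input) "aPow \<equiv> 5 :: nat"
abbreviation (input) "aOff \<equiv> 6 :: nat"
abbreviation (input) "aPos \<equiv> 7 :: nat"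
abbreviation (input) "aBad \<equiv> 8 :: nat"
abbreviation (input) "aLab \<equiv> 9 :: nat"
abbreviation (input) "aNlt \<equiv> 10 :: nat"
abbreviation (input) "aNxt \<equiv> 11 :: nat"
abbreviation (input) "aPrv \<equiv> 12 :: nat"
abbreviation (input) "aGap \<equiv> 13 :: nat"
abbreviation (input) "aGood \<equiv> 14 :: nat"
abbreviation (input) "aDepth \<equiv> 15 :: nat"
abbreviation (input) "aLeft \<equiv> 16 :: nat"
abbreviation (input) "aNode \<equiv> 17 :: nat"
abbreviation (input) "aSize \<equiv> 18 :: nat"

abbreviation "One \<equiv> Const 1"
abbreviation "eK \<equiv> Var 0"
abbreviation "eI \<equiv> Var aV"
abbreviation "eN \<equiv> Var aN"
abbreviation "eN1 \<equiv> Add eN One"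
abbreviation "eSize \<equiv> Var aSize"
abbreviation "eSnk \<equiv> Sub eSize One"

text \<open>Subtraction is truncated, so this is the absolute difference, which vanishes exactly on
  equality. In the conditions below, \<open>Add\<close> acts as disjunction, \<open>Mul\<close> as
  conjunction and \<open>Sub One\<close> as negation.\<close>

abbreviation "Dist a b \<equiv> Add (Sub a b) (Sub b a)"

text \<open>
  The memory is initially zero, so the tables for the order and for \<open>gap_free\<close> store the negations.
\<close>

definition max_com :: com where
  "max_com = fill aV eK (Sub (Read 1 eI) eN) aN (Const 0) (Read 1 eI)"

definition pow_com :: com where
  "pow_com = fill aV eK One aPow (Add eI One) (Mul (Read aPow eI) eN)"

definition off_com :: com where
  "off_com = fill aV eK One aOff (Add eI One) (Add (Read aOff eI) (Read 1 eI))"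

text \<open>Row 0 is skipped and keeps its zeros. The last summand is \<open>n\<close> exactly for
  the sink, where the digit formula gives 1, so the sum is \<open>n + 1\<close>.\<close>

definition pos_com :: com where
  "pos_com = fill aV (Mul eSize eK) (Div eI eK) aPos eI
    (Add (Add (Mod (Div (Sub (Div eI eK) One) (Read aPow (Mod eI eK))) eN) One)
      (Mul eN (Sub One (Sub eSnk (Div eI eK)))))"

text \<open>A node fails if it is the source, if a position exceeds the length of its string, or if
  a letter differs from the one in the first string. The sink fails by the second test.\<close>

definition bad_com :: com where
  "bad_com = fill aV (Mul eSize eK)
    (Add (Add (Sub One (Div eI eK)) (Sub (Read aPos eI) (Read 1 (Mod eI eK))))
      (Dist (Read 2 (Sub (Add (Read aOff (Mod eI eK)) (Read aPos eI)) One))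
        (Read 2 (Sub (Read aPos (Mul (Div eI eK) eK)) One))))
    aBad (Div eI eK) One"

text \<open>Positions are tried from \<open>n\<close> down to 1, so the write that survives is the
  first occurrence of the letter.\<close>

definition lab_com :: com where
  "lab_com = fill aV (Mul eSize eN)
    (Sub One (Add (Read aBad (Div eI eN))
      (Dist (Read 2 (Sub (Sub eN (Mod eI eN)) One))
        (Read 2 (Sub (Read aPos (Mul (Div eI eN) eK)) One)))))
    aLab (Div eI eN) (Sub eN (Mod eI eN))"

definition nlt_com :: com where
  "nlt_com = fill aV (Mul (Mul eSize eSize) eK)
    (Sub (Add (Read aPos (Add (Mul (Div (Div eI eK) eSize) eK) (Mod eI eK))) One)
      (Read aPos (Add (Mul (Mod (Div eI eK) eSize) eK) (Mod eI eK))))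
    aNlt (Div eI eK) One"

text \<open>Nodes are tried from \<open>snk\<close> downwards and the last write survives, which
  yields the least candidate. The unconditional write for \<open>t = 0\<close> installs the default
  \<open>snk\<close>.\<close>

definition nxt_com :: com where
  "nxt_com = (let z = Div eI eSize; t = Mod eI eSize; x = Sub eSnk t; c = Mod z eN1 in
    fill aV (Mul (Mul eSize eN1) eSize)
      (Add (Sub One t) (Mul c (Sub One (Add (Read aNlt (Add (Mul (Div z eN1) eSize) x))
        (Dist (Read aLab x) c)))))
      aNxt z x)"

text \<open>Nodes are tried upwards, so the greatest candidate survives; the default 0 is the
  initial content of the memory.\<close>

definition prv_com :: com where
  "prv_com = (let z = Div eI eSize; x = Mod eI eSize; c = Mod z eN1 in
    fill aV (Mul (Mul eSize eN1) eSize)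
      (Mul c (Sub One (Add (Read aNlt (Add (Mul x eSize) (Div z eN1)))
        (Dist (Read aLab x) c))))
      aPrv z x)"

definition gap_com :: com where
  "gap_com = (let z = Div eI eN1; c = Mod eI eN1; x = Read aNxt (Add (Mul (Div z eSize) eN1) c) in
    fill aV (Mul (Mul eSize eSize) eN1)
      (Add (Read aNlt z) (Sub One (Read aNlt (Add (Mul x eSize) (Mod z eSize)))))
      aGap z One)"

definition end_com :: com where
  "end_com = (let z = Add (Mul eI eSize) eSnk in
    fill aV eSize (Sub One (Read aGap z)) aGood z One)"

text \<open>A triple of leftmost node \<open>a\<close>, following rightmost node \<open>r'\<close>
  and letter \<open>c\<close> determines one edge, from \<open>(a, prv r' c)\<close> to
  \<open>(nxt a c, r')\<close>. The loop passes over these triples with \<open>a\<close> descending,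
  so that the target of an edge is final when it is read.\<close>

definition good_com :: com where
  "good_com = (let z = Div eI eN1; c = Mod eI eN1; a = Sub eSnk (Div z eSize); r' = Mod z eSize;
      r = Read aPrv (Add (Mul r' eN1) c); x = Read aNxt (Add (Mul a eN1) c) in
    fill aV (Mul (Mul eSize eSize) eN1)
      (Mul (Read aGood (Add (Mul x eSize) r')) (Sub One (Read aGap (Add (Mul a eSize) r))))
      aGood (Add (Mul a eSize) r) One)"

lemma dist_eq_0: "a - b + (b - a) = 0 \<longleftrightarrow> a = (b :: nat)" by arith

lemma Suc_0_le_dist: "Suc 0 \<le> a + (x - y + (y - x)) \<longleftrightarrow> a \<noteq> 0 \<or> x \<noteq> (y :: nat)"
  by arith

lemma mult_add_less: "x < A \<Longrightarrow> y < B \<Longrightarrow> x * B + y < A * (B :: nat)"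
proof -
  assume "x < A" "y < B"
  then have "x * B + y < Suc x * B" by simp
  also have "\<dots> \<le> A * B" using \<open>x < A\<close> by (intro mult_le_mono1) simp
  finally show ?thesis .
qed

lemma flat_bounds:
  fixes z A B :: nat
  assumes "z < A * B"
  shows "z div B < A" "z mod B < B"
proof -
  have "B \<noteq> 0" using assms by (cases B) auto
  then show "z div B < A" "z mod B < B" using assms by (auto simp: less_mult_imp_div_less)
qed

lemma flat_div_mod:
  fixes x c m :: nat
  assumes "c < m"
  shows "(x * m + c) div m = x" "(x * m + c) mod m = c"
  using assms by auto

section \<open>Size bounds and the correctness of the tables\<close>

context strings
begin

definition N :: nat where "N = M + 2"
text \<open>A common bound for the length of every table loop and for all numbers and addresses it
  stores. It is the size of the edge set with a factor \<open>k + 1\<close> for comparing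
  tuples.\<close>

definition X :: nat where "X = N * N * (n + 1) * (k + 1)"
definition off :: "nat \<Rightarrow> nat" where "off j = sum_list (map length (take j S))"

definition input_ok :: "state \<Rightarrow> bool" where
  "input_ok s \<longleftrightarrow> s 0 0 = k \<and> (\<forall>j<k. s 1 j = length (S ! j)) \<and> s 2 = array_of (concat S)"

definition consts_ok :: "state \<Rightarrow> bool" where
  "consts_ok s \<longleftrightarrow> s 0 0 = k \<and> s aN 0 = n \<and> s aSize 0 = N"

lemma N_bounds: "N = Suc snk" "3 \<le> N"
  using M_pos by (auto simp: N_def snk_def)

lemma n_le_M: "n \<le> M"
  unfolding M_def using k_pos n_pos self_le_power[of n k] by simp

lemma sizes:
  "N \<le> X" "N * k \<le> X" "N * n \<le> X" "N * N * k \<le> X" "N * N * (n + 1) \<le> X" "N * (n + 1) * N \<le> X"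
  "k < X" "n + 1 < X" "N * N \<le> X" "k * n \<le> X"
proof -
  have N1: "1 \<le> N" using N_bounds by simp
  have "N * N * (n + 1) * 1 \<le> X" unfolding X_def by (intro mult_le_mono2) simp
  then show 1: "N * N * (n + 1) \<le> X" by simp
  then show "N * (n + 1) * N \<le> X" by (simp only: ac_simps)
  have "N * N * 1 * k \<le> X" unfolding X_def by (intro mult_le_mono) auto
  then show 2: "N * N * k \<le> X" by simp
  have "N * k \<le> N * N * k" using N1 by simp
  then show "N * k \<le> X" using 2 by (rule le_trans)
  have "N * 1 * n \<le> N * N * (n + 1)" using N1 by (intro mult_le_mono) auto
  then show 3: "N * n \<le> X" using 1 by simp
  have "N \<le> N * n" using n_pos by simp
  then show "N \<le> X" using 3 by (rule le_trans)
  have "N * N * 1 \<le> N * N * (n + 1)" by (intro mult_le_mono2) simp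
  then show "N * N \<le> X" using 1 by simp
  have "1 * 1 * (k + 1) \<le> N * N * (k + 1)" using N1 by (intro mult_le_mono) auto
  also have "\<dots> \<le> N * N * (n + 1) * (k + 1)" by (intro mult_le_mono1) simp
  finally show "k < X" unfolding X_def by simp
  have "n + 1 < N * 1" using n_le_M by (simp add: N_def)
  also have "\<dots> \<le> N * N" using N1 by (intro mult_le_mono2)
  finally show "n + 1 < X" using \<open>N * N \<le> X\<close> by simp
  have "k * n \<le> k * N" using \<open>n + 1 < N * 1\<close> by (intro mult_le_mono2) simp
  then show "k * n \<le> X" using \<open>N * k \<le> X\<close> by (metis le_trans mult.commute)
qed

lemma runs_max:
  assumes "input_ok s" "s aN 0 = 1" "X \<le> W"
  shows "\<exists>s'. runs W max_com s s' (200 * (X + 1)) \<and> s' aN 0 = n \<and> (\<forall>b. b \<noteq> aV \<and> b \<noteq> aN \<longrightarrow> s' b = s b)"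
proof -
  let ?J = "\<lambda>i T. T 0 = Max (insert 1 (length ` set (take i S)))"
  have len: "length (S ! i) \<le> W" if "i < k" for i
    using length_le_n[of "S ! i"] that sizes assms(3) by auto
  have "\<exists>T. ?J k T \<and> runs W max_com s (s(aV := (s aV)(0 := k), aN := T))
      (fill_cost eK (Sub (Read 1 eI) eN) (Const 0) (Read 1 eI) * (k + 1))"
    unfolding max_com_def
  proof (rule runs_fill)
    show "aV \<noteq> aN" by simp
    show "?J 0 (s aN)" using assms by simp
    show "k \<le> W" using sizes assms(3) by simp
    fix i T
    show "val eK (s(aV := (s aV)(0 := i), aN := T)) = k" using assms by (simp add: input_ok_def)
    assume i: "i < k" and J: "?J i T"
    have J': "Max (insert 1 (length ` set (take (Suc i) S))) = max (length (S ! i)) (T 0)"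
    proof -
      have "insert 1 (length ` set (take (Suc i) S)) = insert (length (S ! i)) (insert 1 (length ` set (take i S)))"
        using i by (auto simp: take_Suc_conv_app_nth)
      then show ?thesis using J by simp
    qed
    show "let st = s(aV := (s aV)(0 := i), aN := T) in
        if val (Sub (Read 1 eI) eN) st = 0 then ?J (Suc i) T
        else val (Const 0) st \<le> W \<and> val (Read 1 eI) st \<le> W \<and> ?J (Suc i) (T(val (Const 0) st := val (Read 1 eI) st))"
      unfolding J' using assms(1) i len[OF i] by (auto simp: input_ok_def)
  qed
  then obtain T where T: "?J k T" "runs W max_com s (s(aV := (s aV)(0 := k), aN := T))
      (fill_cost eK (Sub (Read 1 eI) eN) (Const 0) (Read 1 eI) * (k + 1))" by blast
  show ?thesis
    by (rule exI, intro conjI, rule runs_mono[OF T(2)])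
      (use T(1) sizes(7) in \<open>auto simp: fill_cost_def n_def\<close>)
qed

lemma runs_pow:
  assumes "s 0 0 = k" "s aN 0 = n" "s aPow 0 = 1" "X \<le> W"
  shows "\<exists>s'. runs W pow_com s s' (200 * (X + 1)) \<and> (\<forall>j\<le>k. s' aPow j = n ^ j) \<and>
    (\<forall>b. b \<noteq> aV \<and> b \<noteq> aPow \<longrightarrow> s' b = s b)"
proof -
  let ?J = "\<lambda>i T. \<forall>j\<le>i. T j = n ^ j"
  have W: "i + 1 \<le> W" "n ^ i * n \<le> W" if "i < k" for i
  proof -
    have "n ^ Suc i \<le> n ^ k" using that n_pos by (intro power_increasing) auto
    then show "i + 1 \<le> W" "n ^ i * n \<le> W"
      using that sizes(1,7) assms(4) by (auto simp: N_def M_def mult.commute)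
  qed
  have "\<exists>T. ?J k T \<and> runs W pow_com s (s(aV := (s aV)(0 := k), aPow := T))
      (fill_cost eK One (Add eI One) (Mul (Read aPow eI) eN) * (k + 1))"
    unfolding pow_com_def
  proof (rule runs_fill)
    show "aV \<noteq> aPow" by simp
    show "?J 0 (s aPow)" using assms by simp
    show "k \<le> W" using sizes assms by simp
    fix i T
    show "val eK (s(aV := (s aV)(0 := i), aPow := T)) = k" using assms by simp
    assume i: "i < k" and J: "?J i T"
    show "let st = s(aV := (s aV)(0 := i), aPow := T) in
        if val One st = 0 then ?J (Suc i) T
        else val (Add eI One) st \<le> W \<and> val (Mul (Read aPow eI) eN) st \<le> W \<and>
          ?J (Suc i) (T(val (Add eI One) st := val (Mul (Read aPow eI) eN) st))"
      using assms(1,2) W[OF i] J by (auto simp: le_Suc_eq mult.commute)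
  qed
  then obtain T where T: "?J k T" "runs W pow_com s (s(aV := (s aV)(0 := k), aPow := T))
      (fill_cost eK One (Add eI One) (Mul (Read aPow eI) eN) * (k + 1))" by blast
  show ?thesis
    by (rule exI, intro conjI, rule runs_mono[OF T(2)])
      (use T(1) sizes(7) in \<open>auto simp: fill_cost_def\<close>)
qed

lemma off_Suc: "j < k \<Longrightarrow> off (Suc j) = off j + length (S ! j)"
  by (simp add: off_def take_Suc_conv_app_nth)

lemma off_le: "j \<le> k \<Longrightarrow> off j \<le> j * n"
proof (induction j)
  case 0
  then show ?case by (simp add: off_def)
next
  case (Suc j)
  then show ?case using off_Suc[of j] length_le_n[of "S ! j"] by simp
qed

lemma runs_off:
  assumes "input_ok s" "s aOff = (\<lambda>_. 0)" "X \<le> W"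
  shows "\<exists>s'. runs W off_com s s' (200 * (X + 1)) \<and> (\<forall>j\<le>k. s' aOff j = off j) \<and>
    (\<forall>b. b \<noteq> aV \<and> b \<noteq> aOff \<longrightarrow> s' b = s b)"
proof -
  let ?J = "\<lambda>i T. \<forall>j\<le>i. T j = off j"
  have W: "i + 1 \<le> W" "off (Suc i) \<le> W" if "i < k" for i
  proof -
    have "off (Suc i) \<le> k * n" using off_le[of "Suc i"] that by (meson Suc_leI le_trans mult_le_mono1)
    then show "i + 1 \<le> W" "off (Suc i) \<le> W" using that sizes(7,10) assms(3) by auto
  qed
  have "\<exists>T. ?J k T \<and> runs W off_com s (s(aV := (s aV)(0 := k), aOff := T))
      (fill_cost eK One (Add eI One) (Add (Read aOff eI) (Read 1 eI)) * (k + 1))"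
    unfolding off_com_def
  proof (rule runs_fill)
    show "aV \<noteq> aOff" by simp
    show "?J 0 (s aOff)" using assms by (simp add: off_def)
    show "k \<le> W" using sizes assms by simp
    fix i T
    show "val eK (s(aV := (s aV)(0 := i), aOff := T)) = k" using assms by (simp add: input_ok_def)
    assume i: "i < k" and J: "?J i T"
    show "let st = s(aV := (s aV)(0 := i), aOff := T) in
        if val One st = 0 then ?J (Suc i) T
        else val (Add eI One) st \<le> W \<and> val (Add (Read aOff eI) (Read 1 eI)) st \<le> W \<and>
          ?J (Suc i) (T(val (Add eI One) st := val (Add (Read aOff eI) (Read 1 eI)) st))"
      using assms(1) W[OF i] J i by (auto simp: le_Suc_eq off_Suc input_ok_def)
  qed
  then obtain T where T: "?J k T" "runs W off_com s (s(aV := (s aV)(0 := k), aOff := T))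
      (fill_cost eK One (Add eI One) (Add (Read aOff eI) (Read 1 eI)) * (k + 1))" by blast
  show ?thesis
    by (rule exI, intro conjI, rule runs_mono[OF T(2)])
      (use T(1) sizes(7) in \<open>auto simp: fill_cost_def\<close>)
qed

text \<open>Turns the description of the array after a scan into a predicate \<open>Q\<close> on
  single cells together with a frame condition; the time is weakened to a bound in
  \<open>X\<close>.\<close>

lemma runs_scan_frame:
  assumes va: "v \<noteq> a" and m: "0 < m" and BW: "A * m \<le> X" "X \<le> W"
    and B: "\<And>i T. val e (s(v := (s v)(0 := i), a := T)) = A * m"
    and step: "\<And>z t T. z < A \<Longrightarrow> t < m \<Longrightarrow>
      (let st = s(v := (s v)(0 := z * m + t), a := T) in
        (val p st \<noteq> 0 \<longleftrightarrow> P z t) \<and> (P z t \<longrightarrow> val ie st = z \<and> val xe st = g z t \<and> g z t \<le> W))"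
    and K: "fill_cost e p ie xe \<le> K"
    and post: "\<And>z T. z < A \<Longrightarrow>
        (\<And>t. t < m \<Longrightarrow> P z t \<Longrightarrow> (\<And>t'. t < t' \<Longrightarrow> t' < m \<Longrightarrow> \<not> P z t') \<Longrightarrow> T z = g z t) \<Longrightarrow>
        ((\<And>t. t < m \<Longrightarrow> \<not> P z t) \<Longrightarrow> T z = s a z) \<Longrightarrow> Q z (T z)"
  shows "\<exists>s'. runs W (fill v e p a ie xe) s s' (K * (X + 1)) \<and> (\<forall>z<A. Q z (s' a z)) \<and>
    (\<forall>b. b \<noteq> v \<and> b \<noteq> a \<longrightarrow> s' b = s b)"
proof -
  have "A * m \<le> W" using BW by simp
  from runs_fill_scan[OF va m this B step] obtain T where
    T: "\<forall>z<A. (\<forall>t<m. P z t \<and> (\<forall>t'. t < t' \<and> t' < m \<longrightarrow> \<not> P z t') \<longrightarrow> T z = g z t) \<and>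
                ((\<forall>t<m. \<not> P z t) \<longrightarrow> T z = s a z)"
      "runs W (fill v e p a ie xe) s (s(v := (s v)(0 := A * m), a := T)) (fill_cost e p ie xe * (A * m + 1))"
    by blast
  have "Q z (T z)" if "z < A" for z
    using T(1) that by (intro post) blast+
  moreover have "fill_cost e p ie xe * (A * m + 1) \<le> K * (X + 1)"
    using K BW by (intro mult_le_mono) auto
  ultimately show ?thesis
    using runs_mono[OF T(2)] by (intro exI[of _ "s(v := (s v)(0 := A * m), a := T)"]) auto
qed

text \<open>The scan for truth values: only ones are written into an array of zeros, so a cell
  computes the disjunction over its row.\<close>

lemma runs_scan_or:
  assumes "v \<noteq> a" "0 < m" "A * m \<le> X" "X \<le> W"
    and "\<And>i T. val e (s(v := (s v)(0 := i), a := T)) = A * m"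
    and step: "\<And>z t T. z < A \<Longrightarrow> t < m \<Longrightarrow>
      (let st = s(v := (s v)(0 := z * m + t), a := T) in
        (val p st \<noteq> 0 \<longleftrightarrow> P z t) \<and> val ie st = z)"
    and "fill_cost e p ie One \<le> K" "s a = (\<lambda>_. 0)"
  shows "\<exists>s'. runs W (fill v e p a ie One) s s' (K * (X + 1)) \<and>
    (\<forall>z<A. s' a z = 0 \<longleftrightarrow> (\<forall>t<m. \<not> P z t)) \<and> (\<forall>b. b \<noteq> v \<and> b \<noteq> a \<longrightarrow> s' b = s b)"
proof (rule runs_scan_frame[where P = P and g = "\<lambda>z t. 1" and m = m])
  fix z t T
  assume "z < A" "t < m"
  moreover have "1 \<le> W" using sizes(1) N_bounds assms(4) by simp
  ultimately show "let st = s(v := (s v)(0 := z * m + t), a := T) in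
      (val p st \<noteq> 0) = P z t \<and> (P z t \<longrightarrow> val ie st = z \<and> val One st = 1 \<and> 1 \<le> W)"
    using step[of z t T] unfolding Let_def by simp
next
  fix z T
  assume *: "\<And>j. j < m \<Longrightarrow> P z j \<Longrightarrow> (\<And>j'. j < j' \<Longrightarrow> j' < m \<Longrightarrow> \<not> P z j') \<Longrightarrow> T z = 1"
    "(\<And>j. j < m \<Longrightarrow> \<not> P z j) \<Longrightarrow> T z = s a z"
  show "T z = 0 \<longleftrightarrow> (\<forall>t<m. \<not> P z t)"
  proof (cases "\<exists>j<m. P z j")
    case True
    let ?Q = "\<lambda>j. j < m \<and> P z j"
    \<comment> \<open>The greatest success is the write that survives.\<close>
    have "?Q (GREATEST j. ?Q j)" using True by (elim exE, intro GreatestI_nat[of ?Q _ m]) auto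
    moreover have "\<not> P z j'" if "(GREATEST j. ?Q j) < j'" "j' < m" for j'
      using Greatest_le_nat[of ?Q j' m] that by auto
    ultimately have "T z = 1" by (intro *(1)[of "GREATEST j. ?Q j"]) auto
    then show ?thesis using True by auto
  next
    case False
    then show ?thesis using *(2) assms by auto
  qed
qed (use assms in auto)

definition pos_ok :: "state \<Rightarrow> bool" where
  "pos_ok s \<longleftrightarrow> (\<forall>x<N. \<forall>j<k. s aPos (x * k + j) = pos j x)"

lemma runs_pos:
  assumes "consts_ok s" "\<forall>j\<le>k. s aPow j = n ^ j" "s aPos = (\<lambda>_. 0)" "X \<le> W"
  shows "\<exists>s'. runs W pos_com s s' (200 * (X + 1)) \<and> pos_ok s' \<and> (\<forall>b. b \<noteq> aV \<and> b \<noteq> aPos \<longrightarrow> s' b = s b)"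
proof -
  have "\<exists>s'. runs W pos_com s s' (200 * (X + 1)) \<and> (\<forall>z<N * k. s' aPos z = pos (z mod k) (z div k)) \<and>
    (\<forall>b. b \<noteq> aV \<and> b \<noteq> aPos \<longrightarrow> s' b = s b)"
    unfolding pos_com_def
  proof (rule runs_scan_frame[where P = "\<lambda>z t. k \<le> z" and g = "\<lambda>z t. pos (z mod k) (z div k)" and m = 1])
    show "aV \<noteq> aPos" "0 < (1 :: nat)" by auto
    show "N * k * 1 \<le> X" "X \<le> W" using sizes assms by auto
    show "val (Mul eSize eK) (s(aV := (s aV)(0 := i), aPos := T)) = N * k * 1" for i T
      using assms by (simp add: consts_ok_def)
    show "fill_cost (Mul eSize eK) (Div eI eK) eI (Add (Add (Mod (Div (Sub (Div eI eK) One) (Read aPow (Mod eI eK))) eN) One)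
      (Mul eN (Sub One (Sub eSnk (Div eI eK))))) \<le> 200" by (simp add: fill_cost_def)
  next
    fix z T
    assume "z < N * k"
      and *: "\<And>t :: nat. t < 1 \<Longrightarrow> k \<le> z \<Longrightarrow> (\<And>t'. t < t' \<Longrightarrow> t' < 1 \<Longrightarrow> \<not> k \<le> z) \<Longrightarrow> T z = pos (z mod k) (z div k)"
      "(\<And>t :: nat. t < 1 \<Longrightarrow> \<not> k \<le> z) \<Longrightarrow> T z = s aPos z"
    show "T z = pos (z mod k) (z div k)"
    proof (cases "k \<le> z")
      case True
      then show ?thesis using *(1)[of 0] by simp
    next
      case False
      then show ?thesis using *(2) assms by (simp add: pos_0)
    qed
  next
    fix z t :: nat and T
    assume z: "z < N * k" and "t < 1"
    let ?x = "z div k" and ?j = "z mod k"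
    have j: "?j < k" using k_pos by simp
    have x: "?x < N" using z by (simp add: less_mult_imp_div_less)
    have e: "k \<le> z \<longleftrightarrow> ?x \<noteq> 0" using k_pos by (simp add: div_eq_0_iff linorder_not_less)
    \<comment> \<open>For the sink, \<open>snk - 1\<close> is \<open>n ^ k\<close>, whose digits
      below place \<open>k\<close> are all zero, so the first part of the formula gives 1.\<close>
    have p: "(?x - 1) div n ^ ?j mod n + 1 + n * (1 - (N - 1 - ?x)) = pos ?j ?x" if "?x \<noteq> 0"
    proof (cases "?x = snk")
      case True
      have "n ^ k = n ^ (k - ?j) * n ^ ?j" using j by (simp flip: power_add)
      then have "M div n ^ ?j = n ^ (k - ?j)" using n_pos by (simp add: M_def)
      also have "\<dots> = n * n ^ (k - ?j - 1)"
        using j power_Suc[of n "k - ?j - 1"] by (simp add: Suc_diff_Suc)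
      finally have "M div n ^ ?j mod n = 0" by simp
      moreover have "snk - 1 = M" "N - 1 - snk = 0" by (auto simp: snk_def N_def)
      ultimately show ?thesis unfolding True pos_snk by (simp del: One_nat_def)
    next
      case False
      then have "1 - (N - 1 - ?x) = 0" using x by (simp add: N_bounds(1))
      then show ?thesis using that False by (simp add: pos_def)
    qed
    have "pos ?j ?x \<le> W" using pos_le[of ?j ?x] sizes(8) assms(4) by simp
    then show "let st = s(aV := (s aV)(0 := z * 1 + t), aPos := T)
       in (val (Div eI eK) st \<noteq> 0) = (k \<le> z) \<and>
          (k \<le> z \<longrightarrow> val eI st = z \<and>
           val (Add (Add (Mod (Div (Sub (Div eI eK) One) (Read aPow (Mod eI eK))) eN) One)
      (Mul eN (Sub One (Sub eSnk (Div eI eK))))) st = pos ?j ?x \<and> pos ?j ?x \<le> W)"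
      using \<open>t < 1\<close> assms(1,2) j e p unfolding Let_def by (auto simp: consts_ok_def)
  qed
  then obtain s' where s': "runs W pos_com s s' (200 * (X + 1))"
    "\<forall>z<N * k. s' aPos z = pos (z mod k) (z div k)" "\<forall>b. b \<noteq> aV \<and> b \<noteq> aPos \<longrightarrow> s' b = s b" by blast
  have "pos_ok s'"
    unfolding pos_ok_def using s'(2) mult_add_less[of _ N _ k] by (simp add: flat_div_mod)
  then show ?thesis using s' by blast
qed

definition bad_ok :: "state \<Rightarrow> bool" where
  "bad_ok s \<longleftrightarrow> (\<forall>x<N. s aBad x = 0 \<longleftrightarrow> matched x)"

lemma runs_bad:
  assumes "consts_ok s" "input_ok s" "\<forall>j\<le>k. s aOff j = off j" "pos_ok s" "s aBad = (\<lambda>_. 0)" "X \<le> W"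
  shows "\<exists>s'. runs W bad_com s s' (200 * (X + 1)) \<and> bad_ok s' \<and> (\<forall>b. b \<noteq> aV \<and> b \<noteq> aBad \<longrightarrow> s' b = s b)"
proof -
  let ?a = "array_of (concat S)"
  let ?P = "\<lambda>x j. x = 0 \<or> length (S ! j) < pos j x \<or> ?a (off j + pos j x - 1) \<noteq> ?a (pos 0 x - 1)"
  have "\<exists>s'. runs W bad_com s s' (200 * (X + 1)) \<and> (\<forall>x<N. s' aBad x = 0 \<longleftrightarrow> (\<forall>j<k. \<not> ?P x j)) \<and>
    (\<forall>b. b \<noteq> aV \<and> b \<noteq> aBad \<longrightarrow> s' b = s b)"
    unfolding bad_com_def
  proof (rule runs_scan_or)
    fix x j T
    assume x: "x < N" and j: "j < k"
    have p0: "s aPos (x * k + j) = pos j x" "s aPos (x * k) = pos 0 x" 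
      using assms(4) x j k_pos unfolding pos_ok_def by (metis, metis add.right_neutral)
    show "let st = s(aV := (s aV)(0 := x * k + j), aBad := T)
       in (val (Add (Add (Sub One (Div eI eK)) (Sub (Read aPos eI) (Read 1 (Mod eI eK))))
      (Dist (Read 2 (Sub (Add (Read aOff (Mod eI eK)) (Read aPos eI)) One))
        (Read 2 (Sub (Read aPos (Mul (Div eI eK) eK)) One)))) st \<noteq> 0) = ?P x j \<and> val (Div eI eK) st = x"
      using assms(1-3) j p0 unfolding Let_def by (auto simp: consts_ok_def input_ok_def flat_div_mod)
  qed (use assms sizes k_pos in \<open>auto simp: consts_ok_def fill_cost_def\<close>)
  then obtain s' where s': "runs W bad_com s s' (200 * (X + 1))"
    "\<forall>x<N. s' aBad x = 0 \<longleftrightarrow> (\<forall>j<k. \<not> ?P x j)" "\<forall>b. b \<noteq> aV \<and> b \<noteq> aBad \<longrightarrow> s' b = s b" by blast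
  have "(\<forall>j<k. \<not> ?P x j) \<longleftrightarrow> matched x" if x: "x < N" for x
  proof (cases "x = 0 \<or> x = snk")
    case True
    \<comment> \<open>The sink is rejected because \<open>n + 1\<close> exceeds the length of any
      string.\<close>
    have "length (S ! 0) < pos 0 snk" using length_le_n[of "S ! 0"] k_pos pos_snk by simp
    then show ?thesis using True matched_range[of x] k_pos by blast
  next
    case False
    then have xM: "x \<noteq> 0" "x \<le> M" using x by (auto simp: N_def snk_def)
    have a: "?a (off j + pos j x - 1) = S ! j ! (pos j x - 1)" if "j < k" "pos j x \<le> length (S ! j)" for j
    proof -
      have "1 \<le> pos j x" using pos_bounds[of x j] False by simp
      then show ?thesis using array_of_concat[of j S "pos j x - 1"] that by (simp add: off_def)
    qed
    have "off 0 = 0" by (simp add: off_def)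
    then have a0: "?a (pos 0 x - 1) = S ! 0 ! (pos 0 x - 1)" if "pos 0 x \<le> length (S ! 0)"
      using a[OF k_pos that] by simp
    show ?thesis
    proof
      assume "\<forall>j<k. \<not> ?P x j"
      then show "matched x" unfolding matched_def using a a0 xM k_pos by (metis not_less)
    next
      assume "matched x"
      then show "\<forall>j<k. \<not> ?P x j" unfolding matched_def using a a0 xM k_pos by (metis not_less)
    qed
  qed
  then have "bad_ok s'" using s'(2) unfolding bad_ok_def by blast
  then show ?thesis using s' by blast
qed

lemma consts_input_frame:
  "consts_ok s \<Longrightarrow> (\<forall>b. b \<noteq> aV \<and> b \<noteq> a \<longrightarrow> s' b = s b) \<Longrightarrow> a \<notin> {0, aN, aSize} \<Longrightarrow> consts_ok s'"
  "input_ok s \<Longrightarrow> (\<forall>b. b \<noteq> aV \<and> b \<noteq> a \<longrightarrow> s' b = s b) \<Longrightarrow> a \<notin> {0, 1, 2} \<Longrightarrow> input_ok s'"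
  by (auto simp: consts_ok_def input_ok_def)

definition lab_ok :: "state \<Rightarrow> bool" where
  "lab_ok s \<longleftrightarrow> (\<forall>x<N. s aLab x = lab x)"

lemma runs_lab:
  assumes "consts_ok s" "input_ok s" "pos_ok s" "bad_ok s" "s aLab = (\<lambda>_. 0)" "X \<le> W"
  shows "\<exists>s'. runs W lab_com s s' (200 * (X + 1)) \<and> lab_ok s' \<and> (\<forall>b. b \<noteq> aV \<and> b \<noteq> aLab \<longrightarrow> s' b = s b)"
  unfolding lab_com_def lab_ok_def
proof (rule runs_scan_frame[where P = "\<lambda>x t. matched x \<and> letter (n - t) = letter (pos 0 x)"
    and g = "\<lambda>x t. n - t" and m = n])
  show "aV \<noteq> aLab" "0 < n" using n_pos by auto
  show "N * n \<le> X" "X \<le> W" using sizes assms by auto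
  show "val (Mul eSize eN) (s(aV := (s aV)(0 := i), aLab := T)) = N * n" for i T
    using assms by (simp add: consts_ok_def)
  show "fill_cost (Mul eSize eN) (Sub One (Add (Read aBad (Div eI eN))
      (Dist (Read 2 (Sub (Sub eN (Mod eI eN)) One))
        (Read 2 (Sub (Read aPos (Mul (Div eI eN) eK)) One))))) (Div eI eN) (Sub eN (Mod eI eN)) \<le> 200"
    by (simp add: fill_cost_def)
next
  fix x T
  assume x: "x < N"
    and *: "\<And>t. t < n \<Longrightarrow> matched x \<and> letter (n - t) = letter (pos 0 x) \<Longrightarrow>
        (\<And>t'. t < t' \<Longrightarrow> t' < n \<Longrightarrow> \<not> (matched x \<and> letter (n - t') = letter (pos 0 x))) \<Longrightarrow> T x = n - t"
      "(\<And>t. t < n \<Longrightarrow> \<not> (matched x \<and> letter (n - t) = letter (pos 0 x))) \<Longrightarrow> T x = s aLab x"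
  show "T x = lab x"
  proof (cases "matched x")
    case True
    then have l: "lab x \<noteq> 0" "lab x \<le> n" "letter (lab x) = letter (pos 0 x)"
      using lab_matched lab_le by auto
    \<comment> \<open>The first occurrence is met in round \<open>n - lab x\<close>; a later success
      would be a smaller position of the same letter.\<close>
    have "T x = n - (n - lab x)"
    proof (rule *(1))
      show "n - lab x < n" using l by simp
      show "matched x \<and> letter (n - (n - lab x)) = letter (pos 0 x)" using l True by simp
      fix t' assume t': "n - lab x < t'" "t' < n"
      have "n - t' < lab x" using t' l by linarith
      moreover have "lab x = (LEAST q. q \<noteq> 0 \<and> letter q = letter (pos 0 x))" using True by (simp add: lab_def)
      ultimately have "\<not> (n - t' \<noteq> 0 \<and> letter (n - t') = letter (pos 0 x))"
        using not_less_Least[of "n - t'" "\<lambda>q. q \<noteq> 0 \<and> letter q = letter (pos 0 x)"] by simp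
      then show "\<not> (matched x \<and> letter (n - t') = letter (pos 0 x))" using t' by auto
    qed
    then show ?thesis using l by simp
  next
    case False
    then show ?thesis using *(2) assms by (simp add: lab_def)
  qed
next
  fix x t T
  assume x: "x < N" and t: "t < n"
  have p0: "s aPos (x * k) = pos 0 x"
    using assms(3) x k_pos unfolding pos_ok_def by (metis add.right_neutral)
  have b: "s aBad x = 0 \<longleftrightarrow> matched x" using assms(4) x by (simp add: bad_ok_def)
  have "n - t \<le> W" using sizes(8) assms(6) by simp
  then show "let st = s(aV := (s aV)(0 := x * n + t), aLab := T)
     in (val (Sub One (Add (Read aBad (Div eI eN))
      (Dist (Read 2 (Sub (Sub eN (Mod eI eN)) One))
        (Read 2 (Sub (Read aPos (Mul (Div eI eN) eK)) One))))) st \<noteq> 0) =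
        (matched x \<and> letter (n - t) = letter (pos 0 x)) \<and>
        (matched x \<and> letter (n - t) = letter (pos 0 x) \<longrightarrow>
         val (Div eI eN) st = x \<and> val (Sub eN (Mod eI eN)) st = n - t \<and> n - t \<le> W)"
    using assms(1,2) t p0 b unfolding Let_def by (auto simp: consts_ok_def input_ok_def letter_def flat_div_mod)
qed

definition nlt_ok :: "state \<Rightarrow> bool" where
  "nlt_ok s \<longleftrightarrow> (\<forall>x<N. \<forall>y<N. s aNlt (x * N + y) = 0 \<longleftrightarrow> lt x y)"

lemma runs_nlt:
  assumes "consts_ok s" "pos_ok s" "s aNlt = (\<lambda>_. 0)" "X \<le> W"
  shows "\<exists>s'. runs W nlt_com s s' (200 * (X + 1)) \<and> nlt_ok s' \<and> (\<forall>b. b \<noteq> aV \<and> b \<noteq> aNlt \<longrightarrow> s' b = s b)"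
proof -
  have "\<exists>s'. runs W nlt_com s s' (200 * (X + 1)) \<and>
    (\<forall>z<N * N. s' aNlt z = 0 \<longleftrightarrow> (\<forall>j<k. \<not> \<not> pos j (z div N) < pos j (z mod N))) \<and>
    (\<forall>b. b \<noteq> aV \<and> b \<noteq> aNlt \<longrightarrow> s' b = s b)"
    unfolding nlt_com_def
  proof (rule runs_scan_or)
    fix z j T
    assume "z < N * N" and j: "j < k"
    then have "s aPos (z div N * k + j) = pos j (z div N)" "s aPos (z mod N * k + j) = pos j (z mod N)"
      using assms(2) flat_bounds[of z N N] unfolding pos_ok_def by blast+
    then show "let st = s(aV := (s aV)(0 := z * k + j), aNlt := T) in
      (val (Sub (Add (Read aPos (Add (Mul (Div (Div eI eK) eSize) eK) (Mod eI eK))) One)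
      (Read aPos (Add (Mul (Mod (Div eI eK) eSize) eK) (Mod eI eK)))) st \<noteq> 0) =
        (\<not> pos j (z div N) < pos j (z mod N)) \<and> val (Div eI eK) st = z"
      using assms(1) j unfolding Let_def by (auto simp: consts_ok_def flat_div_mod)
  qed (use assms sizes k_pos in \<open>auto simp: consts_ok_def fill_cost_def\<close>)
  then obtain s' where s': "runs W nlt_com s s' (200 * (X + 1))"
    "\<forall>z<N * N. s' aNlt z = 0 \<longleftrightarrow> (\<forall>j<k. \<not> \<not> pos j (z div N) < pos j (z mod N))"
    "\<forall>b. b \<noteq> aV \<and> b \<noteq> aNlt \<longrightarrow> s' b = s b" by blast
  have "nlt_ok s'"
    unfolding nlt_ok_def
  proof (intro allI impI)
    fix x y assume xy: "x < N" "y < N"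
    show "s' aNlt (x * N + y) = 0 \<longleftrightarrow> lt x y"
      using s'(2)[rule_format, OF mult_add_less[OF xy]] xy
      unfolding flat_div_mod[OF xy(2)] by (auto simp: lt_def N_bounds(1))
  qed
  then show ?thesis using s' by blast
qed

definition nxt_ok :: "state \<Rightarrow> bool" where
  "nxt_ok s \<longleftrightarrow> (\<forall>x<N. \<forall>c\<le>n. s aNxt (x * (n + 1) + c) = nxt x c)"

definition prv_ok :: "state \<Rightarrow> bool" where
  "prv_ok s \<longleftrightarrow> (\<forall>x<N. \<forall>c\<le>n. s aPrv (x * (n + 1) + c) = prv x c)"

lemma runs_nxt:
  assumes "consts_ok s" "nlt_ok s" "lab_ok s" "s aNxt = (\<lambda>_. 0)" "X \<le> W"
  shows "\<exists>s'. runs W nxt_com s s' (200 * (X + 1)) \<and> nxt_ok s' \<and> (\<forall>b. b \<noteq> aV \<and> b \<noteq> aNxt \<longrightarrow> s' b = s b)"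
proof -
  let ?Q = "\<lambda>z x. z mod (n + 1) \<noteq> 0 \<and> lab x = z mod (n + 1) \<and> lt (z div (n + 1)) x"
  let ?P = "\<lambda>z t. t = 0 \<or> ?Q z (snk - t)"
  have "\<exists>s'. runs W nxt_com s s' (200 * (X + 1)) \<and>
    (\<forall>z<N * (n + 1). s' aNxt z = nxt (z div (n + 1)) (z mod (n + 1))) \<and>
    (\<forall>b. b \<noteq> aV \<and> b \<noteq> aNxt \<longrightarrow> s' b = s b)"
    unfolding nxt_com_def Let_def
  proof (rule runs_scan_frame[where P = ?P and g = "\<lambda>z t. snk - t" and m = N])
    fix z t T
    assume z: "z < N * (n + 1)" and t: "t < N"
    let ?x = "snk - t"
    have x: "?x < N" by (simp add: N_bounds(1))
    have l: "s aNlt (z div (n + 1) * N + ?x) = 0 \<longleftrightarrow> lt (z div (n + 1)) ?x" "s aLab ?x = lab ?x"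
      using assms(2,3) flat_bounds[OF z] x unfolding nlt_ok_def lab_ok_def by auto
    have xW: "?x \<le> W" using x sizes(1) assms(5) by simp
    have c: "s 0 0 = k" "s aN 0 = n" "s aSize 0 = N" "N - 1 = snk"
      using assms(1) N_bounds(1) by (auto simp: consts_ok_def)
    show "let st = s(aV := (s aV)(0 := z * N + t), aNxt := T)
       in (val (Add (Sub One (Mod eI eSize)) (Mul (Mod (Div eI eSize) eN1)
             (Sub One (Add (Read aNlt (Add (Mul (Div (Div eI eSize) eN1) eSize) (Sub eSnk (Mod eI eSize))))
               (Dist (Read aLab (Sub eSnk (Mod eI eSize))) (Mod (Div eI eSize) eN1)))))) st \<noteq> 0) = ?P z t \<and>
          (?P z t \<longrightarrow> val (Div eI eSize) st = z \<and> val (Sub eSnk (Mod eI eSize)) st = snk - t \<and> snk - t \<le> W)"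
      using c t l xW unfolding Let_def by (auto simp: flat_div_mod Suc_0_le_dist simp del: mult_Suc_right)
  next
    fix z T
    assume z: "z < N * (n + 1)"
      and *: "\<And>t. t < N \<Longrightarrow> ?P z t \<Longrightarrow> (\<And>t'. t < t' \<Longrightarrow> t' < N \<Longrightarrow> \<not> ?P z t') \<Longrightarrow> T z = snk - t"
    show "T z = nxt (z div (n + 1)) (z mod (n + 1))"
    proof (cases "\<exists>x. ?Q z x")
      case True
      define x where "x = (LEAST x. lab x = z mod (n + 1) \<and> lt (z div (n + 1)) x)"
      have nx: "nxt (z div (n + 1)) (z mod (n + 1)) = x" using True by (auto simp: nxt_def x_def)
      have Q: "?Q z x" using True nxt(1,2) nx by metis
      then have xs: "x \<le> snk" using lt_snk by blast
      \<comment> \<open>Node \<open>x\<close> is tried in round \<open>snk - x\<close>, and all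
        later rounds try smaller nodes, none of which is a candidate.\<close>
      have "T z = snk - (snk - x)"
      proof (rule *)
        show "snk - x < N" by (simp add: N_bounds(1))
        show "?P z (snk - x)" using Q xs by simp
        fix t' assume t': "snk - x < t'" "t' < N"
        have "snk - t' < x" using t' xs N_bounds(1) by linarith
        then have "\<not> (lab (snk - t') = z mod (n + 1) \<and> lt (z div (n + 1)) (snk - t'))"
          unfolding x_def by (rule not_less_Least)
        then show "\<not> ?P z t'" using t' by auto
      qed
      then show ?thesis using nx xs by simp
    next
      case False
      then have "nxt (z div (n + 1)) (z mod (n + 1)) = snk" unfolding nxt_def by auto
      \<comment> \<open>Only the unconditional write of round 0 takes place.\<close>
      moreover have "T z = snk - 0" using False N_bounds by (intro *) auto
      ultimately show ?thesis by simp
    qed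
  qed (use assms sizes N_bounds in \<open>auto simp: consts_ok_def fill_cost_def\<close>)
  then obtain s' where s': "runs W nxt_com s s' (200 * (X + 1))"
    "\<forall>z<N * (n + 1). s' aNxt z = nxt (z div (n + 1)) (z mod (n + 1))"
    "\<forall>b. b \<noteq> aV \<and> b \<noteq> aNxt \<longrightarrow> s' b = s b" by blast
  have "nxt_ok s'"
    unfolding nxt_ok_def
  proof (intro allI impI)
    fix x c assume xc: "x < N" "c \<le> n"
    then have c: "c < n + 1" by simp
    show "s' aNxt (x * (n + 1) + c) = nxt x c"
      using s'(2)[rule_format, OF mult_add_less[OF xc(1) c]] unfolding flat_div_mod[OF c] .
  qed
  then show ?thesis using s' by blast
qed

lemma runs_prv:
  assumes "consts_ok s" "nlt_ok s" "lab_ok s" "s aPrv = (\<lambda>_. 0)" "X \<le> W"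
  shows "\<exists>s'. runs W prv_com s s' (200 * (X + 1)) \<and> prv_ok s' \<and> (\<forall>b. b \<noteq> aV \<and> b \<noteq> aPrv \<longrightarrow> s' b = s b)"
proof -
  let ?Q = "\<lambda>z x. z mod (n + 1) \<noteq> 0 \<and> lab x = z mod (n + 1) \<and> lt x (z div (n + 1))"
  have "\<exists>s'. runs W prv_com s s' (200 * (X + 1)) \<and>
    (\<forall>z<N * (n + 1). s' aPrv z = prv (z div (n + 1)) (z mod (n + 1))) \<and>
    (\<forall>b. b \<noteq> aV \<and> b \<noteq> aPrv \<longrightarrow> s' b = s b)"
    unfolding prv_com_def Let_def
  proof (rule runs_scan_frame[where P = ?Q and g = "\<lambda>z x. x" and m = N])
    fix z x T
    assume z: "z < N * (n + 1)" and x: "x < N"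
    have l: "s aNlt (x * N + z div (n + 1)) = 0 \<longleftrightarrow> lt x (z div (n + 1))" "s aLab x = lab x"
      using assms(2,3) flat_bounds(1)[OF z] x unfolding nlt_ok_def lab_ok_def by blast+
    have xW: "x \<le> W" using x sizes(1) assms(5) by simp
    have c: "s 0 0 = k" "s aN 0 = n" "s aSize 0 = N"
      using assms(1) by (auto simp: consts_ok_def)
    show "let st = s(aV := (s aV)(0 := z * N + x), aPrv := T)
       in (val (Mul (Mod (Div eI eSize) eN1)
             (Sub One (Add (Read aNlt (Add (Mul (Mod eI eSize) eSize) (Div (Div eI eSize) eN1)))
               (Dist (Read aLab (Mod eI eSize)) (Mod (Div eI eSize) eN1))))) st \<noteq> 0) = ?Q z x \<and>
          (?Q z x \<longrightarrow> val (Div eI eSize) st = z \<and> val (Mod eI eSize) st = x \<and> x \<le> W)"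
      using c x l xW unfolding Let_def by (auto simp: flat_div_mod Suc_0_le_dist simp del: mult_Suc_right)
  next
    fix z T
    assume z: "z < N * (n + 1)"
      and *: "\<And>t. t < N \<Longrightarrow> ?Q z t \<Longrightarrow> (\<And>t'. t < t' \<Longrightarrow> t' < N \<Longrightarrow> \<not> ?Q z t') \<Longrightarrow> T z = t"
        "(\<And>t. t < N \<Longrightarrow> \<not> ?Q z t) \<Longrightarrow> T z = s aPrv z"
    have bd: "x < z div (n + 1)" "x < N" if "?Q z x" for x
      using that lt_less[of x "z div (n + 1)"] flat_bounds[OF z] by auto
    show "T z = prv (z div (n + 1)) (z mod (n + 1))"
    proof (cases "\<exists>x. ?Q z x")
      case True
      define x where "x = (GREATEST x. lab x = z mod (n + 1) \<and> lt x (z div (n + 1)))"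
      have px: "prv (z div (n + 1)) (z mod (n + 1)) = x" using True by (auto simp: prv_def x_def)
      have Q: "?Q z x" using True prv(1,2) px by metis
      have "T z = x"
      proof (rule *(1)[OF bd(2)[OF Q] Q])
        fix t' assume t': "x < t'" "t' < N"
        show "\<not> ?Q z t'"
        proof
          assume q: "?Q z t'"
          have "t' \<le> x" unfolding x_def
            by (rule Greatest_le_nat[where b = N]) (use q bd in \<open>auto simp: less_imp_le lt_less\<close>)
          then show False using t' by simp
        qed
      qed
      then show ?thesis using px by simp
    next
      case False
      then have "prv (z div (n + 1)) (z mod (n + 1)) = 0" unfolding prv_def by auto
      moreover have "T z = s aPrv z" using False by (intro *(2)) auto
      ultimately show ?thesis using assms by simp
    qed
  qed (use assms sizes N_bounds in \<open>auto simp: consts_ok_def fill_cost_def\<close>)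
  then obtain s' where s': "runs W prv_com s s' (200 * (X + 1))"
    "\<forall>z<N * (n + 1). s' aPrv z = prv (z div (n + 1)) (z mod (n + 1))"
    "\<forall>b. b \<noteq> aV \<and> b \<noteq> aPrv \<longrightarrow> s' b = s b" by blast
  have "prv_ok s'"
    unfolding prv_ok_def
  proof (intro allI impI)
    fix x c assume xc: "x < N" "c \<le> n"
    then have c: "c < n + 1" by simp
    show "s' aPrv (x * (n + 1) + c) = prv x c"
      using s'(2)[rule_format, OF mult_add_less[OF xc(1) c]] unfolding flat_div_mod[OF c] .
  qed
  then show ?thesis using s' by blast
qed

definition gap_ok :: "state \<Rightarrow> bool" where
  "gap_ok s \<longleftrightarrow> (\<forall>x<N. \<forall>y<N. s aGap (x * N + y) = 0 \<longleftrightarrow> gap_free x y)"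

lemma runs_gap:
  assumes "consts_ok s" "nlt_ok s" "nxt_ok s" "s aGap = (\<lambda>_. 0)" "X \<le> W"
  shows "\<exists>s'. runs W gap_com s s' (200 * (X + 1)) \<and> gap_ok s' \<and> (\<forall>b. b \<noteq> aV \<and> b \<noteq> aGap \<longrightarrow> s' b = s b)"
proof -
  let ?P = "\<lambda>z c. \<not> lt (z div N) (z mod N) \<or> lt (nxt (z div N) c) (z mod N)"
  have "\<exists>s'. runs W gap_com s s' (200 * (X + 1)) \<and>
    (\<forall>z<N * N. s' aGap z = 0 \<longleftrightarrow> (\<forall>c<n + 1. \<not> ?P z c)) \<and>
    (\<forall>b. b \<noteq> aV \<and> b \<noteq> aGap \<longrightarrow> s' b = s b)"
    unfolding gap_com_def Let_def
  proof (rule runs_scan_or)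
    fix z c T
    assume z: "z < N * N" and c: "c < n + 1"
    then have c': "c \<le> n" by simp
    have "s aNlt (z div N * N + z mod N) = 0 \<longleftrightarrow> lt (z div N) (z mod N)"
      using assms(2) flat_bounds[OF z] unfolding nlt_ok_def by blast
    then have t: "s aNlt z = 0 \<longleftrightarrow> lt (z div N) (z mod N)" by simp
    moreover have "s aNxt (z div N * (n + 1) + c) = nxt (z div N) c"
      using assms(3) flat_bounds(1)[OF z] c' unfolding nxt_ok_def by blast
    moreover have "nxt (z div N) c < N" using nxt_le_snk[of "z div N" c] by (simp add: N_bounds(1))
    then have "s aNlt (nxt (z div N) c * N + z mod N) = 0 \<longleftrightarrow> lt (nxt (z div N) c) (z mod N)"
      using assms(2) flat_bounds[OF z] unfolding nlt_ok_def by blast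
    ultimately show "let st = s(aV := (s aV)(0 := z * (n + 1) + c), aGap := T) in
        (val (Add (Read aNlt (Div eI eN1)) (Sub One (Read aNlt (Add (Mul
          (Read aNxt (Add (Mul (Div (Div eI eN1) eSize) eN1) (Mod eI eN1))) eSize) (Mod (Div eI eN1) eSize))))) st \<noteq> 0) = ?P z c \<and>
        val (Div eI eN1) st = z"
      using assms(1) c unfolding Let_def consts_ok_def by (auto simp: flat_div_mod Suc_0_le_dist simp del: mult_Suc_right)
  qed (use assms sizes in \<open>auto simp: consts_ok_def fill_cost_def\<close>)
  then obtain s' where s': "runs W gap_com s s' (200 * (X + 1))"
    "\<forall>z<N * N. s' aGap z = 0 \<longleftrightarrow> (\<forall>c<n + 1. \<not> ?P z c)"
    "\<forall>b. b \<noteq> aV \<and> b \<noteq> aGap \<longrightarrow> s' b = s b" by blast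
  have "gap_ok s'"
    unfolding gap_ok_def
  proof (intro allI impI)
    fix x y assume xy: "x < N" "y < N"
    show "s' aGap (x * N + y) = 0 \<longleftrightarrow> gap_free x y"
      using s'(2)[rule_format, OF mult_add_less[OF xy]]
      unfolding gap_free_iff_nxt flat_div_mod[OF xy(2)] by auto
  qed
  then show ?thesis using s' by blast
qed

end

definition tables_com :: com where
  "tables_com =
    Seq (Set aN One) (Seq max_com (Seq (Set aPow One) (Seq pow_com (Seq off_com
    (Seq (Set aSize (Add (Read aPow eK) (Const 2)))
    (Seq pos_com (Seq bad_com (Seq lab_com (Seq nlt_com (Seq nxt_com (Seq prv_com
    (Seq gap_com (Seq end_com good_com)))))))))))))"

section \<open>The table of pairs from which the end is reachable\<close>

context strings
begin

definition good_ok :: "state \<Rightarrow> bool" where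
  "good_ok s \<longleftrightarrow> (\<forall>x<N. \<forall>y<N. s aGood (x * N + y) \<noteq> 0 \<longleftrightarrow> good x y)"

definition end_ok :: "state \<Rightarrow> bool" where
  "end_ok s \<longleftrightarrow> (\<forall>x<N. \<forall>y<N. s aGood (x * N + y) \<noteq> 0 \<longleftrightarrow> y = snk \<and> gap_free x snk)"

lemma runs_end:
  assumes "consts_ok s" "gap_ok s" "s aGood = (\<lambda>_. 0)" "X \<le> W"
  shows "\<exists>s'. runs W end_com s s' (200 * (X + 1)) \<and> end_ok s' \<and> (\<forall>b. b \<noteq> aV \<and> b \<noteq> aGood \<longrightarrow> s' b = s b)"
proof -
  let ?z = "Add (Mul eI eSize) eSnk"
  let ?J = "\<lambda>i T. \<forall>x<N. \<forall>y<N. T (x * N + y) \<noteq> (0 :: nat) \<longleftrightarrow> x < i \<and> y = snk \<and> gap_free x snk"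
  have snkN: "snk < N" by (simp add: N_bounds(1))
  have W: "1 \<le> W \<and> x * N + snk \<le> W" if "x < N" for x
    using mult_add_less[OF that snkN] sizes(1,9) assms(4) N_bounds(2) by linarith
  have "\<exists>T. ?J N T \<and> runs W (fill aV eSize (Sub One (Read aGap ?z)) aGood ?z One) s
      (s(aV := (s aV)(0 := N), aGood := T)) (fill_cost eSize (Sub One (Read aGap ?z)) ?z One * (N + 1))"
  proof (rule runs_fill[where J = ?J])
    show "aV \<noteq> aGood" by simp
    show "?J 0 (s aGood)" using assms by simp
    show "N \<le> W" using sizes assms by simp
    fix i T
    show "val eSize (s(aV := (s aV)(0 := i), aGood := T)) = N" using assms by (simp add: consts_ok_def)
    assume i: "i < N" and J: "?J i T"
    have g: "s aGap (i * N + snk) = 0 \<longleftrightarrow> gap_free i snk"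
      using assms(2) i snkN unfolding gap_ok_def by blast
    have z: "val ?z (s(aV := (s aV)(0 := i), aGood := T)) = i * N + snk"
      using assms(1) by (simp add: consts_ok_def N_bounds(1))
    \<comment> \<open>The flattened index is unique once the second component is below
      \<open>N\<close>, so a write changes one pair only.\<close>
    have inj: "x * N + y = i * N + snk \<longleftrightarrow> x = i \<and> y = snk" if "y < N" for x y
      using flat_div_mod[OF that, of x] flat_div_mod[OF snkN, of i] by metis
    have "?J (Suc i) T" if "\<not> gap_free i snk"
      using J that by (auto simp: less_Suc_eq)
    moreover have "?J (Suc i) (T(i * N + snk := 1))" if "gap_free i snk"
      using J that inj by (auto simp: less_Suc_eq)
    moreover have "val (Sub One (Read aGap ?z)) (s(aV := (s aV)(0 := i), aGood := T)) = 0 \<longleftrightarrow> \<not> gap_free i snk"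
    proof -
      have "val (Sub One (Read aGap ?z)) (s(aV := (s aV)(0 := i), aGood := T)) = 1 - s aGap (i * N + snk)"
        using z by simp
      then show ?thesis using g by auto
    qed
    ultimately show "let st = s(aV := (s aV)(0 := i), aGood := T) in
        if val (Sub One (Read aGap ?z)) st = 0 then ?J (Suc i) T
        else val ?z st \<le> W \<and> val One st \<le> W \<and> ?J (Suc i) (T(val ?z st := val One st))"
      unfolding Let_def z using W[OF i] by simp
  qed
  then obtain T where T: "?J N T" "runs W end_com s
      (s(aV := (s aV)(0 := N), aGood := T)) (fill_cost eSize (Sub One (Read aGap ?z)) ?z One * (N + 1))"
    unfolding end_com_def Let_def by blast
  have "end_ok (s(aV := (s aV)(0 := N), aGood := T))"
    using T(1) unfolding end_ok_def by simp
  moreover have "fill_cost eSize (Sub One (Read aGap ?z)) ?z One * (N + 1) \<le> 200 * (X + 1)"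
    using sizes(1) by (intro mult_le_mono) (auto simp: fill_cost_def)
  ultimately show ?thesis
    using runs_mono[OF T(2)] by (intro exI[of _ "s(aV := (s aV)(0 := N), aGood := T)"]) auto
qed

lemma good_le_snk: "good a r \<Longrightarrow> r \<le> snk"
  using gap_free_less(2) good_iff by blast

text \<open>Dynamic programming along \<open>good_iff\<close>. The scan lemmas do not apply, because
  the cell written is found by a table lookup and cells of the same array are read.\<close>

lemma runs_good:
  assumes "consts_ok s" "nxt_ok s" "prv_ok s" "gap_ok s" "end_ok s" "X \<le> W"
  shows "\<exists>s'. runs W good_com s s' (200 * (X + 1)) \<and> good_ok s' \<and> (\<forall>b. b \<noteq> aV \<and> b \<noteq> aGood \<longrightarrow> s' b = s b)"
proof -
  let ?z = "Div eI eN1" and ?c = "Mod eI eN1"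
  let ?a = "Sub eSnk (Div ?z eSize)" and ?r' = "Mod ?z eSize"
  let ?r = "Read aPrv (Add (Mul ?r' eN1) ?c)" and ?x = "Read aNxt (Add (Mul ?a eN1) ?c)"
  let ?idx = "Add (Mul ?a eSize) ?r"
  let ?cond = "Mul (Read aGood (Add (Mul ?x eSize) ?r')) (Sub One (Read aGap ?idx))"
  let ?B = "Mul (Mul eSize eSize) eN1"
  let ?code = "\<lambda>a r' c. ((snk - a) * N + r') * (n + 1) + c"
  \<comment> \<open>Three clauses: every marked pair is good, the pairs that end at once are marked,
    and so is the origin of each edge already handled whose target is good.\<close>
  define J where "J i T \<longleftrightarrow>
    (\<forall>a<N. \<forall>r<N. T (a * N + r) \<noteq> 0 \<longrightarrow> good a r) \<and>
    (\<forall>a<N. gap_free a snk \<longrightarrow> T (a * N + snk) \<noteq> 0) \<and>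
    (\<forall>a<N. \<forall>r'<N. \<forall>c\<le>n. ?code a r' c < i \<and> good (nxt a c) r' \<and> gap_free a (prv r' c) \<longrightarrow>
        T (a * N + prv r' c) \<noteq> 0)" for i and T :: "nat \<Rightarrow> nat"
  have ltN: "x \<le> snk \<longleftrightarrow> x < N" for x by (auto simp: N_bounds(1))
  have "\<exists>T. J (N * N * (n + 1)) T \<and> runs W (fill aV ?B ?cond aGood ?idx One) s
      (s(aV := (s aV)(0 := N * N * (n + 1)), aGood := T)) (fill_cost ?B ?cond ?idx One * (N * N * (n + 1) + 1))"
  proof (rule runs_fill)
    show "aV \<noteq> aGood" by simp
    show "J 0 (s aGood)"
      using assms(5) good_iff ltN unfolding end_ok_def J_def by blast
    show "N * N * (n + 1) \<le> W" using sizes(5) assms by linarith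
    fix i T
    let ?st = "s(aV := (s aV)(0 := i), aGood := T)"
    show "val ?B ?st = N * N * (n + 1)" using assms by (simp add: consts_ok_def)
    assume i: "i < N * N * (n + 1)" and J: "J i T"
    define z where "z = i div (n + 1)"
    define c where "c = i mod (n + 1)"
    define a where "a = snk - z div N"
    define r' where "r' = z mod N"
    have z: "z < N * N" unfolding z_def by (rule flat_bounds(1)[OF i])
    have c: "c < n + 1" "c \<le> n" unfolding c_def by (auto simp: less_Suc_eq_le[symmetric])
    have a: "a < N" unfolding a_def using ltN[of "snk - z div N"] by simp
    have r': "r' < N" unfolding r'_def by (rule flat_bounds(2)[OF z])
    have snk_a: "snk - a = z div N"
      using flat_bounds(1)[OF z] unfolding a_def by (simp add: N_bounds(1))
    have i_eq: "i = ?code a r' c"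
      unfolding snk_a r'_def z_def c_def by (simp only: div_mult_mod_eq)
    have code_inj: "a' = a \<and> r'' = r' \<and> c' = c" if "?code a' r'' c' = i" "a' < N" "r'' < N" "c' \<le> n" for a' r'' c'
    proof -
      have c': "c' < n + 1" using that by simp
      have "c' = c" using that(1) flat_div_mod(2)[OF c'] unfolding c_def by metis
      have zz: "(snk - a') * N + r'' = z" using that(1) flat_div_mod(1)[OF c'] unfolding z_def by metis
      have "r'' = r'" using zz flat_div_mod(2)[OF that(3)] unfolding r'_def by metis
      have "snk - a' = snk - a" using zz flat_div_mod(1)[OF that(3)] snk_a by metis
      then have "a' = a" using that(2) a ltN[of a] ltN[of a'] by simp
      with \<open>c' = c\<close> \<open>r'' = r'\<close> show ?thesis by simp
    qed
    define p where "p = prv r' c"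
    define x where "x = nxt a c"
    have p: "p < N" using prv_le_snk ltN unfolding p_def by blast
    have x: "x < N" using nxt_le_snk ltN unfolding x_def by blast
    have cs: "s 0 0 = k" "s aN 0 = n" "s aSize 0 = N" "N - 1 = snk"
      using assms(1) N_bounds(1) by (auto simp: consts_ok_def)
    have v0: "val ?z ?st = z" "val ?c ?st = c" using cs by (simp_all add: z_def c_def)
    then have v1: "val ?a ?st = a" "val ?r' ?st = r'" using cs by (simp_all add: a_def r'_def)
    have tn: "s aNxt (a * (n + 1) + c) = x" using assms(2) a c unfolding nxt_ok_def x_def by blast
    have tp: "s aPrv (r' * (n + 1) + c) = p" using assms(3) r' c unfolding prv_ok_def p_def by blast
    have ve: "val eN1 ?st = n + 1" "val eSize ?st = N" using cs by simp_all
    have "val ?r ?st = s aPrv (val ?r' ?st * val eN1 ?st + val ?c ?st)"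
      "val ?x ?st = s aNxt (val ?a ?st * val eN1 ?st + val ?c ?st)" by simp_all
    then have v2: "val ?r ?st = p" "val ?x ?st = x"
      unfolding v0 v1 ve tn tp by simp_all
    have vi: "val ?idx ?st = a * N + p"
      by (simp only: val.simps(3,5) v1 v2 ve)
    have tg: "s aGap (a * N + p) = 0 \<longleftrightarrow> gap_free a p" using assms(4) a p unfolding gap_ok_def by blast
    have "val ?cond ?st = T (val ?x ?st * val eSize ?st + val ?r' ?st) * (1 - s aGap (val ?idx ?st))"
      by simp
    then have "val ?cond ?st = T (x * N + r') * (1 - s aGap (a * N + p))"
      unfolding v1 v2 vi ve .
    then have vc: "val ?cond ?st = 0 \<longleftrightarrow> \<not> (T (x * N + r') \<noteq> 0 \<and> gap_free a p)"
      using tg by auto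
    \<comment> \<open>The cell read is final although the table is incomplete: all edges leaving the
      pair \<open>(x, r')\<close> belong to row \<open>x\<close>, and \<open>x = nxt a c\<close> is
      above \<open>a\<close>.\<close>
    have read: "T (x * N + r') \<noteq> 0 \<longleftrightarrow> good x r'"
    proof
      show "T (x * N + r') \<noteq> 0 \<Longrightarrow> good x r'" using J x r' unfolding J_def by blast
      assume g: "good x r'"
      then have gx: "gap_free x r'" using good_iff by blast
      then have "x \<noteq> snk" using not_lt_snk unfolding gap_free_def by blast
      then have ax: "a < x" using nxt_not_snk(3)[of a c] lt_less unfolding x_def by blast
      show "T (x * N + r') \<noteq> 0"
      proof (cases "r' = snk")
        case True
        then show ?thesis using J x gx unfolding J_def by blast
      next
        case False
        then obtain r'' where r'': "prv r'' (lab r') = r'" "good (nxt x (lab r')) r''"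
          using good_iff g by blast
        have r''N: "r'' < N" using good_le_snk[OF r''(2)] ltN by blast
        have "?code x r'' (lab r') < ((snk - x) * N + r'' + 1) * (n + 1)"
          using lab_le[of r'] by simp
        also have "\<dots> \<le> ((snk - a) * N) * (n + 1)"
        proof (rule mult_le_mono1)
          \<comment> \<open>The rounds of row \<open>x\<close> end before those of row
            \<open>a\<close> begin, because \<open>a < x\<close> and each row occupies a block of
            \<open>N\<close> pairs.\<close>
          have "(snk - x) * N + r'' + 1 \<le> (snk - x + 1) * N" using r''N by simp
          also have "\<dots> \<le> (snk - a) * N"
            using ax x ltN[of x] by (intro mult_le_mono1) linarith
          finally show "(snk - x) * N + r'' + 1 \<le> (snk - a) * N" .
        qed
        also have "\<dots> \<le> ?code a r' c" by (simp add: add_mult_distrib)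
        finally have "?code x r'' (lab r') < i" using i_eq by simp
        then have "T (x * N + prv r'' (lab r')) \<noteq> 0"
          using J x r''N lab_le[of r'] r'' gx unfolding J_def by metis
        then show ?thesis using r'' by simp
      qed
    qed
    have inj: "a' * N + r = a * N + p \<longleftrightarrow> a' = a \<and> r = p" if "r < N" for a' r
      using flat_div_mod[OF that, of a'] flat_div_mod[OF p, of a] by metis
    have J1: "J (Suc i) T" if "\<not> (T (x * N + r') \<noteq> 0 \<and> gap_free a p)"
      unfolding J_def
    proof (intro conjI allI impI, goal_cases)
      case (1 a r)
      then show ?case using J unfolding J_def by blast
    next
      case (2 a)
      then show ?case using J unfolding J_def by blast
    next
      case (3 a' r'' c')
      have "?code a' r'' c' \<noteq> i"
        using code_inj[of a' r'' c'] 3 that read unfolding x_def p_def by blast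
      then have "?code a' r'' c' < i" using 3 by linarith
      then show ?case using J 3 unfolding J_def by blast
    qed
    have J2: "J (Suc i) (T(a * N + p := 1))" if g: "T (x * N + r') \<noteq> 0" "gap_free a p"
    proof -
      have "p \<noteq> 0" using gap_free_less(1)[OF g(2)] by simp
      then have "lab p = c" using prv_nonzero(1) unfolding p_def by blast
      then have "prv r' (lab p) = p" "good (nxt a (lab p)) r'"
        using g read by (simp_all add: p_def x_def)
      then have gap: "good a p" using good_iff[of a p] g by blast
      show ?thesis
        unfolding J_def
      proof (intro conjI allI impI, goal_cases)
        case (1 a' r)
        then show ?case using J gap inj[of r a'] unfolding J_def by (cases "a' = a \<and> r = p") auto
      next
        case (2 a')
        then show ?case using J unfolding J_def by auto
      next
        case (3 a' r'' c')
        show ?case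
        proof (cases "?code a' r'' c' = i")
          case True
          then show ?thesis using code_inj[of a' r'' c'] 3 unfolding p_def by auto
        next
          case False
          then have "?code a' r'' c' < i" using 3 by linarith
          then have "T (a' * N + prv r'' c') \<noteq> 0" using J 3 unfolding J_def by blast
          then show ?thesis by simp
        qed
      qed
    qed
    have "a * N + p \<le> W" using mult_add_less[OF a p] sizes(9) assms(6) by linarith
    moreover have "1 \<le> W" using sizes(1) N_bounds assms(6) by linarith
    ultimately show "let st = ?st in if val ?cond st = 0 then J (Suc i) T
        else val ?idx st \<le> W \<and> val One st \<le> W \<and> J (Suc i) (T(val ?idx st := val One st))"
      unfolding Let_def vc vi using J1 J2 by auto
  qed
  then obtain T where T: "J (N * N * (n + 1)) T" "runs W good_com s
      (s(aV := (s aV)(0 := N * N * (n + 1)), aGood := T)) (fill_cost ?B ?cond ?idx One * (N * N * (n + 1) + 1))"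
    unfolding good_com_def Let_def by blast
  have "good_ok (s(aV := (s aV)(0 := N * N * (n + 1)), aGood := T))"
  proof -
    have "T (a * N + r) \<noteq> 0 \<longleftrightarrow> good a r" if ar: "a < N" "r < N" for a r
    proof
      show "T (a * N + r) \<noteq> 0 \<Longrightarrow> good a r" using T(1) ar unfolding J_def by blast
      assume g: "good a r"
      show "T (a * N + r) \<noteq> 0"
      proof (cases "r = snk")
        case True
        then show ?thesis using T(1) ar g good_iff unfolding J_def by blast
      next
        case False
        then obtain r' where r': "prv r' (lab r) = r" "good (nxt a (lab r)) r'" "gap_free a r"
          using good_iff g by blast
        have r'N: "r' < N" using good_le_snk[OF r'(2)] ltN by blast
        have "snk - a < N" using ltN[of "snk - a"] by simp
        from mult_add_less[OF mult_add_less[OF this r'N], of "lab r" "n + 1"]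
        have "?code a r' (lab r) < N * N * (n + 1)" using lab_le[of r] by simp
        then have "T (a * N + prv r' (lab r)) \<noteq> 0"
          using T(1) ar r'N r' lab_le[of r] unfolding J_def by metis
        then show ?thesis using r' by simp
      qed
    qed
    then show ?thesis unfolding good_ok_def by simp
  qed
  moreover have "fill_cost ?B ?cond ?idx One * (N * N * (n + 1) + 1) \<le> 200 * (X + 1)"
    using sizes(5) by (intro mult_le_mono add_right_mono) (simp_all add: fill_cost_def)
  ultimately show ?thesis
    using runs_mono[OF T(2)]
    by (intro exI[of _ "s(aV := (s aV)(0 := N * N * (n + 1)), aGood := T)"]) auto
qed

definition tables_ok :: "state \<Rightarrow> bool" where
  "tables_ok s \<longleftrightarrow> consts_ok s \<and> input_ok s \<and> lab_ok s \<and> nxt_ok s \<and> prv_ok s \<and> good_ok s"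

lemma runs_tables:
  assumes "input_ok s" "\<And>a. 3 \<le> a \<Longrightarrow> s a = (\<lambda>_. 0)" "X \<le> W"
  shows "\<exists>s'. runs W tables_com s s' (3000 * (X + 1)) \<and> tables_ok s' \<and>
    (\<forall>b. 18 < b \<or> b \<in> {aDepth, aLeft, aNode} \<longrightarrow> s' b = (\<lambda>_. 0))"
proof -
  have W: "1 \<le> W" "N \<le> W" using sizes(1) N_bounds assms(3) by linarith+
  define s1 where "s1 = s(aN := (s aN)(0 := 1))"
  have r1: "runs W (Set aN One) s s1 3"
    using runs_Assign[of "Const 0" s W One aN] W by (simp add: s1_def numeral_3_eq_3)
  have "input_ok s1" "s1 aN 0 = 1" using assms by (auto simp: s1_def input_ok_def)
  then obtain s2 where r2: "runs W max_com s1 s2 (200 * (X + 1))" and s2: "s2 aN 0 = n"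
    and f2: "\<And>b. b \<noteq> aV \<Longrightarrow> b \<noteq> aN \<Longrightarrow> s2 b = s1 b" using runs_max assms(3) by blast
  define s3 where "s3 = s2(aPow := (s2 aPow)(0 := 1))"
  have r3: "runs W (Set aPow One) s2 s3 3"
    using runs_Assign[of "Const 0" s2 W One aPow] W by (simp add: s3_def numeral_3_eq_3)
  have i3: "input_ok s3" "s3 aN 0 = n" "s3 aPow 0 = 1"
    using assms s2 f2 by (auto simp: s3_def s1_def input_ok_def)
  then obtain s4 where r4: "runs W pow_com s3 s4 (200 * (X + 1))" and s4: "\<forall>j\<le>k. s4 aPow j = n ^ j"
    and f4: "\<And>b. b \<noteq> aV \<Longrightarrow> b \<noteq> aPow \<Longrightarrow> s4 b = s3 b"
    using runs_pow assms(3) unfolding input_ok_def by blast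
  have z4: "s4 b = (\<lambda>_. 0)" if "6 \<le> b" for b
    using that f4[of b] f2[of b] assms(2)[of b] by (simp add: s3_def s1_def)
  have i4: "input_ok s4" "s4 aN 0 = n" using i3 f4 by (auto simp: input_ok_def)
  then obtain s5 where r5: "runs W off_com s4 s5 (200 * (X + 1))" and s5: "\<forall>j\<le>k. s5 aOff j = off j"
    and f5: "\<And>b. b \<noteq> aV \<Longrightarrow> b \<noteq> aOff \<Longrightarrow> s5 b = s4 b"
    using runs_off[of s4 W] assms(3) z4[of aOff] by auto
  define s6 where "s6 = s5(aSize := (s5 aSize)(0 := N))"
  have "s5 0 0 = k" "s5 aPow k = M" using f5 i4 s4 by (auto simp: input_ok_def M_def)
  then have r6: "runs W (Set aSize (Add (Read aPow eK) (Const 2))) s5 s6 10"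
    using runs_mono[OF runs_Assign[of "Const 0" s5 W "Add (Read aPow eK) (Const 2)" aSize], of 10] W
    by (simp add: s6_def N_def)
  have z6: "s6 b = (\<lambda>_. 0)" if "7 \<le> b" "b \<noteq> aSize" for b
    using that f5[of b] z4[of b] by (simp add: s6_def)
  have i6: "input_ok s6" "consts_ok s6" "\<forall>j\<le>k. s6 aPow j = n ^ j" "\<forall>j\<le>k. s6 aOff j = off j"
    using i4 f5 s4 s5 by (auto simp: s6_def input_ok_def consts_ok_def)
  obtain s7 where r7: "runs W pos_com s6 s7 (200 * (X + 1))" and s7: "pos_ok s7"
    and f7: "\<forall>b. b \<noteq> aV \<and> b \<noteq> aPos \<longrightarrow> s7 b = s6 b"
    using runs_pos[OF i6(2,3) z6[of aPos] assms(3)] by auto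
  have i7: "input_ok s7" "consts_ok s7" "\<forall>j\<le>k. s7 aOff j = off j" "s7 aBad = (\<lambda>_. 0)"
    using consts_input_frame[OF _ f7] i6 f7 z6[of aBad] by auto
  obtain s8 where r8: "runs W bad_com s7 s8 (200 * (X + 1))" and s8: "bad_ok s8"
    and f8: "\<forall>b. b \<noteq> aV \<and> b \<noteq> aBad \<longrightarrow> s8 b = s7 b"
    using runs_bad[OF i7(2,1,3) s7 i7(4) assms(3)] by auto
  have i8: "input_ok s8" "consts_ok s8" "pos_ok s8" "s8 aLab = (\<lambda>_. 0)"
    using consts_input_frame[OF _ f8] i7 f8 f7 s7 z6[of aLab] by (auto simp: pos_ok_def)
  obtain s9 where r9: "runs W lab_com s8 s9 (200 * (X + 1))" and s9: "lab_ok s9"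
    and f9: "\<forall>b. b \<noteq> aV \<and> b \<noteq> aLab \<longrightarrow> s9 b = s8 b"
    using runs_lab[OF i8(2,1,3) s8 i8(4) assms(3)] by auto
  have i9: "input_ok s9" "consts_ok s9" "pos_ok s9" "s9 aNlt = (\<lambda>_. 0)"
    using consts_input_frame[OF _ f9] i8 f9 f8 f7 z6[of aNlt] by (auto simp: pos_ok_def)
  obtain s10 where r10: "runs W nlt_com s9 s10 (200 * (X + 1))" and s10: "nlt_ok s10"
    and f10: "\<forall>b. b \<noteq> aV \<and> b \<noteq> aNlt \<longrightarrow> s10 b = s9 b"
    using runs_nlt[OF i9(2,3,4) assms(3)] by auto
  have i10: "input_ok s10" "consts_ok s10" "lab_ok s10" "s10 aNxt = (\<lambda>_. 0)"
    using consts_input_frame[OF _ f10] i9 s9 f10 f9 f8 f7 z6[of aNxt] by (auto simp: lab_ok_def)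
  obtain s11 where r11: "runs W nxt_com s10 s11 (200 * (X + 1))" and s11: "nxt_ok s11"
    and f11: "\<forall>b. b \<noteq> aV \<and> b \<noteq> aNxt \<longrightarrow> s11 b = s10 b"
    using runs_nxt[OF i10(2) s10 i10(3,4) assms(3)] by auto
  have i11: "input_ok s11" "consts_ok s11" "lab_ok s11" "nlt_ok s11" "s11 aPrv = (\<lambda>_. 0)"
    using consts_input_frame[OF _ f11] i10 s10 f11 f10 f9 f8 f7 z6[of aPrv] by (auto simp: lab_ok_def nlt_ok_def)
  obtain s12 where r12: "runs W prv_com s11 s12 (200 * (X + 1))" and s12: "prv_ok s12"
    and f12: "\<forall>b. b \<noteq> aV \<and> b \<noteq> aPrv \<longrightarrow> s12 b = s11 b"
    using runs_prv[OF i11(2,4,3,5) assms(3)] by auto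
  have i12: "input_ok s12" "consts_ok s12" "lab_ok s12" "nlt_ok s12" "nxt_ok s12" "s12 aGap = (\<lambda>_. 0)"
    using consts_input_frame[OF _ f12] i11 s11 f12 f11 f10 f9 f8 f7 z6[of aGap]
    by (auto simp: lab_ok_def nlt_ok_def nxt_ok_def)
  obtain s13 where r13: "runs W gap_com s12 s13 (200 * (X + 1))" and s13: "gap_ok s13"
    and f13: "\<forall>b. b \<noteq> aV \<and> b \<noteq> aGap \<longrightarrow> s13 b = s12 b"
    using runs_gap[OF i12(2,4,5,6) assms(3)] by auto
  have i13: "input_ok s13" "consts_ok s13" "lab_ok s13" "nxt_ok s13" "prv_ok s13" "s13 aGood = (\<lambda>_. 0)"
    using consts_input_frame[OF _ f13] i12 s12 f13 f12 f11 f10 f9 f8 f7 z6[of aGood]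
    by (auto simp: lab_ok_def prv_ok_def nxt_ok_def)
  obtain s14 where r14: "runs W end_com s13 s14 (200 * (X + 1))" and s14: "end_ok s14"
    and f14: "\<forall>b. b \<noteq> aV \<and> b \<noteq> aGood \<longrightarrow> s14 b = s13 b"
    using runs_end[OF i13(2) s13 i13(6) assms(3)] by auto
  have i14: "input_ok s14" "consts_ok s14" "lab_ok s14" "nxt_ok s14" "prv_ok s14" "gap_ok s14"
    using consts_input_frame[OF _ f14] i13 s13 f14
    by (auto simp: lab_ok_def prv_ok_def nxt_ok_def gap_ok_def)
  obtain s15 where r15: "runs W good_com s14 s15 (200 * (X + 1))" and s15: "good_ok s15"
    and f15: "\<forall>b. b \<noteq> aV \<and> b \<noteq> aGood \<longrightarrow> s15 b = s14 b"
    using runs_good[OF i14(2,4,5,6) s14 assms(3)] by auto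
  have "tables_ok s15"
    using consts_input_frame[OF _ f15] i14 s15 f15
    by (auto simp: tables_ok_def lab_ok_def prv_ok_def nxt_ok_def)
  moreover have "s15 b = (\<lambda>_. 0)" if b: "18 < b \<or> b \<in> {aDepth, aLeft, aNode}" for b
    using b z6[of b] f15 f14 f13 f12 f11 f10 f9 f8 f7 by auto
  moreover have "runs W tables_com s s15 (3000 * (X + 1))"
    unfolding tables_com_def
    by (rule runs_mono[OF runs_Seq[OF r1 runs_Seq[OF r2 runs_Seq[OF r3 runs_Seq[OF r4 runs_Seq[OF r5
      runs_Seq[OF r6 runs_Seq[OF r7 runs_Seq[OF r8 runs_Seq[OF r9 runs_Seq[OF r10 runs_Seq[OF r11
      runs_Seq[OF r12 runs_Seq[OF r13 runs_Seq[OF r14 r15]]]]]]]]]]]]]]]) simp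
  ultimately show ?thesis by blast
qed

end

section \<open>Depth-first search\<close>

lemma blocks_not_Nil: "blocks t \<noteq> []"
  by (induction t) auto

lemma blocks_append:
  "Completed \<notin> set t1 \<Longrightarrow> blocks (t1 @ t) = (t1 @ hd (blocks t)) # tl (blocks t)"
  by (induction t1) (auto simp: blocks_not_Nil)

lemma symbols_append: "symbols (t1 @ t2) = symbols t1 @ symbols t2"
  by (simp add: symbols_def)

lemma symbols_ticks: "symbols (replicate m Tick) = []"
  by (induction m) (auto simp: symbols_def)

text \<open>Traces are built from the back, by prepending steps. Only the first block can still
  grow, so it has a bound \<open>b\<close> of its own.\<close>

definition enum_trace :: "event list \<Rightarrow> nat list set \<Rightarrow> nat \<Rightarrow> nat \<Rightarrow> bool" where
  "enum_trace t A b D \<longleftrightarrow> distinct (outputs t) \<and> set (outputs t) = A \<and> symbols (last (blocks t)) = [] \<and>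
    length (hd (blocks t)) \<le> b \<and> (\<forall>x \<in> set (tl (blocks t)). length x \<le> D)"

lemma enum_trace_mono: "enum_trace t A b D \<Longrightarrow> b \<le> b' \<Longrightarrow> D \<le> D' \<Longrightarrow> enum_trace t A b' D'"
  unfolding enum_trace_def by (meson le_trans)

lemma enum_trace_ticks: "enum_trace (replicate m Tick) {} m D"
  using blocks_append[of "replicate m Tick" "[]"]
  by (auto simp: enum_trace_def outputs_def symbols_ticks)

lemma enum_trace_prefix:
  assumes "enum_trace t A b D" "m + b \<le> b'"
  shows "enum_trace (replicate m Tick @ t) A b' D"
proof -
  have b: "blocks (replicate m Tick @ t) = (replicate m Tick @ hd (blocks t)) # tl (blocks t)"
    by (rule blocks_append) auto
  obtain x xs where x: "blocks t = x # xs" using blocks_not_Nil by (cases "blocks t") auto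
  show ?thesis
    using assms unfolding enum_trace_def outputs_def b x
    by (cases xs) (auto simp: symbols_append symbols_ticks)
qed

text \<open>The former first block becomes a complete later one, hence the premise
  \<open>b \<le> D\<close>.\<close>

lemma enum_trace_output:
  assumes "enum_trace t A b D" "b \<le> D" "Completed \<notin> set t1" "symbols t1 = y" "y \<notin> A"
  shows "enum_trace (t1 @ Completed # t) (insert y A) (length t1 + 1) D"
proof -
  have b: "blocks (t1 @ Completed # t) = (t1 @ [Completed]) # blocks t"
    using blocks_append[OF assms(3), of "Completed # t"] by simp
  have "symbols (t1 @ [Completed]) = y" using assms(4) by (simp add: symbols_append) (simp add: symbols_def)
  moreover obtain x xs where x: "blocks t = x # xs" using blocks_not_Nil by (cases "blocks t") auto
  ultimately show ?thesis
    using assms unfolding enum_trace_def outputs_def b by auto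
qed

section \<open>The search program\<close>

abbreviation "eD \<equiv> Var aDepth"
abbreviation "eNode \<equiv> Read aNode eD"
abbreviation "eLeft \<equiv> Read aLeft eD"
abbreviation "ePrev \<equiv> Read aNode (Sub eD One)"

text \<open>The new node must form a good pair with the leftmost node of the prefix and must confirm
  the guess made for the previous node. On the first level the previous node is the sentinel 0, for
  which the second test holds since \<open>prv x 0 = 0\<close>.\<close>

definition step_test :: exp where
  "step_test = Mul (Read aGood (Add (Mul eLeft eSize) eNode))
    (Sub One (Dist (Read aPrv (Add (Mul eNode eN1) (Read aLab ePrev))) ePrev))"

definition push_com :: com where
  "push_com = Seq (Assign aLeft (Add eD One) (Read aNxt (Add (Mul eLeft eN1) (Read aLab eNode))))
    (Seq (Assign aNode (Add eD One) (Const 0)) (Set aDepth (Add eD One)))"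

definition emit_com :: com where
  "emit_com = While (Sub eD eI)
    (Seq (Emit (Read 2 (Sub (Read aLab (Read aNode eI)) One))) (Set aV (Add eI One)))"

definition output_com :: com where
  "output_com = Seq (Set aV One) (Seq emit_com Finish)"

text \<open>The candidate is increased before it is tested: a fresh level starts from 0, which
  occurs in no path, and a level resumed after backtracking goes on with its next candidate.\<close>

definition step_com :: com where
  "step_com = Seq (Assign aNode eD (Add eNode One))
    (Cond (Sub eNode eSnk) (Set aDepth (Sub eD One))
      (Cond step_test (Cond (Sub eSnk eNode) push_com output_com) Skip))"

definition dfs_com :: com where
  "dfs_com = Seq (Set aDepth One) (While eD step_com)"

lemma while_step:
  assumes "val e s \<noteq> 0" "runs W c s s1 K" "exec W (While e c) s1 t s'" "enum_trace t A b D" "cost e + 1 + K + b \<le> b'"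
  shows "\<exists>t'. exec W (While e c) s t' s' \<and> enum_trace t' A b' D"
proof -
  obtain m where m: "m \<le> K" "exec W c s (replicate m Tick) s1" using assms(2) unfolding runs_def by blast
  have "exec W (While e c) s (replicate (cost e + 1) Tick @ replicate m Tick @ t) s'"
    by (rule exec.WhileTrue[OF assms(1) m(2) assms(3)])
  moreover have "replicate (cost e + 1) Tick @ replicate m Tick @ t = replicate (cost e + 1 + m) Tick @ t"
    by (simp add: replicate_add)
  moreover have "enum_trace (replicate (cost e + 1 + m) Tick @ t) A b' D"
    using assms m by (intro enum_trace_prefix) auto
  ultimately show ?thesis by metis
qed

text \<open>Later in lexicographic order by a larger entry at the first difference. Extensions of
  the second list do not count: it ends with the last candidate, whose continuations are
  finished.\<close>

fun beyond :: "nat list \<Rightarrow> nat list \<Rightarrow> bool" where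
  "beyond p [] \<longleftrightarrow> False"
| "beyond [] (r # rs) \<longleftrightarrow> False"
| "beyond (x # p) (r # rs) \<longleftrightarrow> r < x \<or> x = r \<and> beyond p rs"

lemma beyond_snoc: "beyond p (rs @ [r]) \<longleftrightarrow> beyond p rs \<or> (\<exists>x q. p = rs @ x # q \<and> r < x)"
proof (induction rs arbitrary: p)
  case Nil
  then show ?case by (cases p) auto
next
  case (Cons a rs)
  then show ?case by (cases p) auto
qed

context strings
begin

lemma path_last: "path a p \<Longrightarrow> last p = snk"
  by (induction a p rule: path.induct) auto

definition prefix_ok :: "nat list \<Rightarrow> bool" where
  "prefix_ok rs \<longleftrightarrow> rs = [] \<or> (\<exists>q. q \<noteq> [] \<and> path 0 (rs @ q))"

lemma prefix_ok_length: "prefix_ok rs \<Longrightarrow> length rs \<le> n"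
proof (cases "rs = []")
  case False
  assume "prefix_ok rs"
  then obtain q where "q \<noteq> []" "path 0 (rs @ q)" using False by (auto simp: prefix_ok_def)
  then show ?thesis using path_ht[of 0 "rs @ q"] by (cases q) auto
qed simp

lemma prefix_ok_le: "prefix_ok rs \<Longrightarrow> x \<in> set rs \<Longrightarrow> x \<le> snk"
  using path_le_snk[of 0 "rs @ _" x] unfolding prefix_ok_def by fastforce

text \<open>The right-hand side is what the program tests. It looks only at the top of the stack,
  and it is exact, so the search never enters a dead end.\<close>

lemma prefix_extend:
  assumes "prefix_ok rs"
  shows "(\<exists>q. path 0 (rs @ x # q)) \<longleftrightarrow>
    good (leftmost 0 (map lab rs)) x \<and> prv x (lab (last (0 # rs))) = last (0 # rs)"
proof (cases "rs = []")
  case True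
  have "prv x 0 = 0" by (simp add: prv_def)
  then show ?thesis using True lab_0 by (auto simp: good_def)
next
  case False
  then obtain q where "q \<noteq> []" "path 0 (rs @ q)" using assms by (auto simp: prefix_ok_def)
  then obtain r q' where "path 0 (rs @ r # q')" by (cases q) auto
  from path_swap[OF this, of x] show ?thesis using False by auto
qed

lemma prefix_push:
  assumes "path 0 (rs @ x # q)" "x \<noteq> snk"
  shows "q \<noteq> []" "prefix_ok (rs @ [x])"
proof -
  show "q \<noteq> []" using path_last[OF assms(1)] assms(2) by auto
  then show "prefix_ok (rs @ [x])" using assms(1) unfolding prefix_ok_def by auto
qed

lemma prefix_pop: "prefix_ok (rs @ [x]) \<Longrightarrow> prefix_ok rs"
  unfolding prefix_ok_def by auto

section \<open>Progress towards the next output\<close>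

definition remaining :: "nat list \<Rightarrow> nat \<Rightarrow> nat list set" where
  "remaining rs r = {p. path 0 p \<and> beyond p (rs @ [r])}"

definition pending :: "nat list \<Rightarrow> nat \<Rightarrow> bool" where
  "pending rs r \<longleftrightarrow> (\<exists>x q. r < x \<and> path 0 (rs @ x # q))"

text \<open>
  Bounds the number of steps before the next output: as long as the current prefix has an
  unexplored extension the search descends, and otherwise it first backtracks.
\<close>

definition rank :: "nat list \<Rightarrow> nat \<Rightarrow> nat" where
  "rank rs r = N - r + (if pending rs r then n + 1 - length rs else length rs + n + 2) * (N + 1)"

text \<open>The factor in \<open>rank\<close> is at most \<open>2 * n + 2\<close>; one more
  \<open>N + 1\<close> absorbs the term \<open>N - r\<close>.\<close>

definition max_rank :: nat where "max_rank = (2 * n + 3) * (N + 1)"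

lemma finite_remaining: "finite (remaining rs r)"
  using finite_paths unfolding remaining_def by (rule finite_subset[rotated]) auto

lemma rank_less: "length rs \<le> n \<Longrightarrow> rank rs r < max_rank"
proof -
  assume l: "length rs \<le> n"
  let ?m = "if pending rs r then n + 1 - length rs else length rs + n + 2"
  have "?m * (N + 1) \<le> (2 * n + 2) * (N + 1)"
    using l by (intro mult_le_mono1) auto
  then have "rank rs r < (2 * n + 2) * (N + 1) + (N + 1)" unfolding rank_def by linarith
  also have "\<dots> = max_rank" unfolding max_rank_def by (simp add: algebra_simps)
  finally show ?thesis .
qed

text \<open>A candidate that starts no path leaves the set of unexplored extensions unchanged, so
  only the term \<open>N - r\<close> falls.\<close>

lemma skip_step:
  assumes "r < snk" "\<nexists>q. path 0 (rs @ (r + 1) # q)"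
  shows "remaining rs (r + 1) = remaining rs r" "rank rs (r + 1) < rank rs r"
proof -
  have *: "r < x \<longleftrightarrow> r + 1 < x \<or> x = r + 1" for x by auto
  show "remaining rs (r + 1) = remaining rs r"
    unfolding remaining_def beyond_snoc * using assms(2) by blast
  have "pending rs (r + 1) \<longleftrightarrow> pending rs r"
    unfolding pending_def * using assms(2) by blast
  then show "rank rs (r + 1) < rank rs r"
    using assms(1) unfolding rank_def by (simp add: N_bounds(1))
qed

text \<open>Below a candidate that starts a path there is an unexplored extension. The factor for
  pending prefixes thus falls by one, which pays for the candidate returning to 0. No path is lost:
  all nodes of a path are positive, and none ends before \<open>snk\<close>.\<close>

lemma push_step:
  assumes "r + 1 < snk" "path 0 (rs @ (r + 1) # q)"
  shows "remaining (rs @ [r + 1]) 0 = remaining rs r" "rank (rs @ [r + 1]) 0 < rank rs r"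
proof -
  have *: "r < x \<longleftrightarrow> r + 1 < x \<or> x = r + 1" for x by auto
  have pos: "0 < x" "q' \<noteq> [] \<Longrightarrow> 0 < hd q'" if "path 0 (rs @ x # q')" for x q'
    using path_le_snk[OF that] by (auto simp: hd_in_set)
  have "beyond p ((rs @ [r + 1]) @ [0]) \<longleftrightarrow> beyond p (rs @ [r])" if p: "path 0 p" for p
  proof -
    have "(\<exists>x q. p = (rs @ [r + 1]) @ x # q \<and> 0 < x) \<longleftrightarrow> (\<exists>q. p = rs @ (r + 1) # q)"
    proof
      assume "\<exists>q. p = rs @ (r + 1) # q"
      then obtain q' where q': "p = rs @ (r + 1) # q'" by blast
      have "q' \<noteq> []" using prefix_push(1) p assms(1) q' by (metis less_irrefl)
      then show "\<exists>x q. p = (rs @ [r + 1]) @ x # q \<and> 0 < x"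
        using pos(2) p q' by (intro exI[of _ "hd q'"] exI[of _ "tl q'"]) auto
    qed auto
    then show ?thesis unfolding beyond_snoc * by blast
  qed
  then show "remaining (rs @ [r + 1]) 0 = remaining rs r" unfolding remaining_def by blast
  have "q \<noteq> []" using prefix_push(1)[OF assms(2)] assms(1) by auto
  then obtain x q' where q: "q = x # q'" by (cases q) auto
  have "pending rs r" unfolding pending_def using assms(2) by (intro exI[of _ "r + 1"]) auto
  moreover have "pending (rs @ [r + 1]) 0"
    unfolding pending_def using assms(2) path_le_snk[OF assms(2), of x] q
    by (intro exI[of _ x] exI[of _ q']) auto
  moreover have "length rs + 1 \<le> n" using path_ht[OF assms(2)] q by simp
  then have "(n + 1 - length rs) * (N + 1) = (n - length rs) * (N + 1) + (N + 1)"
    by (simp add: Suc_diff_le)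
  moreover have "N < (N + 1) + (N - r)" by simp
  ultimately show "rank (rs @ [r + 1]) 0 < rank rs r"
    unfolding rank_def by simp
qed

lemma beyond_snk: "path 0 p \<Longrightarrow> beyond p (rs @ [snk]) \<longleftrightarrow> beyond p rs"
  unfolding beyond_snoc using path_le_snk[of 0 p] by fastforce

lemma not_pending_snk: "\<not> pending rs snk"
  unfolding pending_def using path_le_snk[of 0 "rs @ _ # _"] by fastforce

text \<open>Nothing is pending at \<open>snk\<close>. Pending or not, the shorter prefix has a
  factor smaller by at least one, and \<open>N + 1\<close> outweighs the change of
  \<open>N - r\<close>.\<close>

lemma pop_step:
  assumes "a \<le> snk"
  shows "remaining rs a = remaining (rs @ [a]) snk"
    "length rs < n \<Longrightarrow> rank rs a < rank (rs @ [a]) snk"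
proof -
  show "remaining rs a = remaining (rs @ [a]) snk"
    unfolding remaining_def using beyond_snk by blast
  assume l: "length rs < n"
  let ?m = "if pending rs a then n + 1 - length rs else length rs + n + 2"
  have "?m * (N + 1) \<le> (length rs + n + 2) * (N + 1)" by (intro mult_le_mono1) auto
  then have "rank rs a < (length rs + n + 2) * (N + 1) + (N + 1)" unfolding rank_def by linarith
  also have "\<dots> = (length (rs @ [a]) + n + 2) * (N + 1)" by (simp add: algebra_simps)
  also have "\<dots> \<le> rank (rs @ [a]) snk" unfolding rank_def using not_pending_snk by simp
  finally show "rank rs a < rank (rs @ [a]) snk" .
qed

lemma remaining_Nil_snk: "remaining [] snk = {}"
  unfolding remaining_def using beyond_snk[of _ "[]"] by auto

text \<open>A path ends where it meets \<open>snk\<close>, so this candidate accounts for exactly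
  one path.\<close>

lemma output_step:
  assumes "r + 1 = snk" "path 0 (rs @ snk # q)"
  shows "remaining rs r = insert (rs @ [snk]) (remaining rs snk)" "rs @ [snk] \<notin> remaining rs snk"
    "path 0 (rs @ [snk])"
proof -
  have q: "q = []" using path_snk[OF assms(2)] .
  then show p: "path 0 (rs @ [snk])" using assms(2) by simp
  have *: "r < x \<longleftrightarrow> snk < x \<or> x = snk" for x using assms(1) by auto
  have "(\<exists>q. p = rs @ snk # q) \<longleftrightarrow> p = rs @ [snk]" if "path 0 p" for p
    using path_snk that by blast
  then show "remaining rs r = insert (rs @ [snk]) (remaining rs snk)"
    unfolding remaining_def beyond_snoc * using p by blast
  have "\<not> beyond (rs @ [snk]) rs" by (induction rs) auto
  then show "rs @ [snk] \<notin> remaining rs snk" unfolding remaining_def using beyond_snk by auto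
qed

section \<open>The invariant and the single steps of the search loop\<close>

text \<open>Levels start at 1, with the sentinel 0 stored below them. The top of the node stack
  holds the last candidate \<open>r\<close>, which is not part of the prefix \<open>rs\<close>; the
  other stack caches the leftmost node of each initial segment.\<close>

definition dfs_inv :: "state \<Rightarrow> nat list \<Rightarrow> nat \<Rightarrow> bool" where
  "dfs_inv s rs r \<longleftrightarrow> tables_ok s \<and> s aDepth 0 = length rs + 1 \<and> s aNode 0 = 0 \<and>
    (\<forall>j<length rs. s aNode (j + 1) = rs ! j) \<and> s aNode (length rs + 1) = r \<and>
    (\<forall>j\<le>length rs. s aLeft (j + 1) = leftmost 0 (map lab (take j rs))) \<and>
    r \<le> snk \<and> prefix_ok rs"

lemma tables_ok_frame:
  assumes "tables_ok s" "\<And>b. b \<noteq> aV \<Longrightarrow> b \<noteq> aDepth \<Longrightarrow> b \<noteq> aLeft \<Longrightarrow> b \<noteq> aNode \<Longrightarrow> s' b = s b"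
  shows "tables_ok s'"
  using assms unfolding tables_ok_def consts_ok_def input_ok_def lab_ok_def nxt_ok_def prv_ok_def good_ok_def
  by simp

lemma leftmost_le: "leftmost 0 Y \<le> snk"
  by (cases Y rule: rev_cases) (auto simp: nxt_le_snk)

lemma runs_advance:
  assumes "dfs_inv s rs r" "X \<le> W"
  shows "runs W (Assign aNode eD (Add eNode One)) s (s(aNode := (s aNode)(length rs + 1 := r + 1))) 10"
proof -
  have d: "s aDepth 0 = length rs + 1" "s aNode (length rs + 1) = r" using assms unfolding dfs_inv_def by auto
  have "length rs \<le> n" "r \<le> snk" using assms prefix_ok_length unfolding dfs_inv_def by auto
  then have "length rs + 1 \<le> W" "r + 1 \<le> W" using sizes(1,8) assms(2) N_bounds(1) by linarith+
  then show ?thesis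
    using runs_Assign[of eD s W "Add eNode One" aNode] d by (auto elim: runs_mono)
qed

lemma val_step_test:
  assumes "dfs_inv s rs r" "r < snk"
  defines "s1 \<equiv> s(aNode := (s aNode)(length rs + 1 := r + 1))"
  shows "val step_test s1 \<noteq> 0 \<longleftrightarrow> (\<exists>q. path 0 (rs @ (r + 1) # q))"
proof -
  have d: "s1 aDepth 0 = length rs + 1" "s1 aNode (length rs + 1) = r + 1"
    "s1 aLeft (length rs + 1) = leftmost 0 (map lab rs)" and p: "prefix_ok rs"
    using assms(1) unfolding dfs_inv_def s1_def by auto
  have t: "tables_ok s1"
    using assms(1) unfolding dfs_inv_def s1_def by (auto elim!: tables_ok_frame)
  let ?L = "leftmost 0 (map lab rs)" and ?p = "last (0 # rs)"
  \<comment> \<open>For the empty prefix this is the sentinel.\<close>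
  have prev: "s1 aNode (length rs) = ?p"
    using assms(1) unfolding dfs_inv_def s1_def by (cases rs rule: rev_cases) (auto simp: nth_append)
  have "?p \<le> snk" using prefix_ok_le[OF p] by auto
  then have N: "?L < N" "r + 1 < N" "?p < N" using leftmost_le assms(2) by (auto simp: N_bounds(1) less_Suc_eq_le)
  have c: "s1 aN 0 = n" "s1 aSize 0 = N" using t by (auto simp: tables_ok_def consts_ok_def)
  have l: "s1 aLab ?p = lab ?p" using t N unfolding tables_ok_def lab_ok_def by blast
  have pr: "s1 aPrv ((r + 1) * (n + 1) + lab ?p) = prv (r + 1) (lab ?p)"
    using t N lab_le unfolding tables_ok_def prv_ok_def by blast
  have g: "s1 aGood (?L * N + (r + 1)) \<noteq> 0 \<longleftrightarrow> good ?L (r + 1)"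
    using t N unfolding tables_ok_def good_ok_def by blast
  have v: "val eD s1 = length rs + 1" "val eNode s1 = r + 1" "val eLeft s1 = ?L" "val ePrev s1 = ?p"
    "val eSize s1 = N" "val eN1 s1 = n + 1"
    using d c prev by simp_all
  have "val step_test s1 = s1 aGood (val eLeft s1 * val eSize s1 + val eNode s1) *
      (1 - (s1 aPrv (val eNode s1 * val eN1 s1 + s1 aLab (val ePrev s1)) - val ePrev s1 +
        (val ePrev s1 - s1 aPrv (val eNode s1 * val eN1 s1 + s1 aLab (val ePrev s1)))))"
    unfolding step_test_def by simp
  then have "val step_test s1 = s1 aGood (?L * N + (r + 1)) *
      (1 - (prv (r + 1) (lab ?p) - ?p + (?p - prv (r + 1) (lab ?p))))"
    unfolding v l pr .
  then have "val step_test s1 \<noteq> 0 \<longleftrightarrow> good ?L (r + 1) \<and> prv (r + 1) (lab ?p) = ?p"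
    using g dist_eq_0[of "prv (r + 1) (lab ?p)" ?p] by auto
  then show ?thesis using prefix_extend[OF p] by blast
qed

lemma step_skip:
  assumes "dfs_inv s rs r" "r < snk" "X \<le> W" "\<nexists>q. path 0 (rs @ (r + 1) # q)"
  shows "\<exists>s'. runs W step_com s s' 100 \<and> dfs_inv s' rs (r + 1)"
proof -
  define s1 where "s1 = s(aNode := (s aNode)(length rs + 1 := r + 1))"
  have d: "s1 aDepth 0 = length rs + 1" "s1 aNode (length rs + 1) = r + 1" "s1 aSize 0 = N"
    using assms(1) unfolding dfs_inv_def tables_ok_def consts_ok_def s1_def by auto
  have t: "val step_test s1 = 0" using val_step_test[OF assms(1,2)] assms(4) unfolding s1_def by blast
  have v: "val (Sub eNode eSnk) s1 = 0" using d assms(2) by (simp add: N_bounds(1))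
  have "runs W (Cond (Sub eNode eSnk) (Set aDepth (Sub eD One))
      (Cond step_test (Cond (Sub eSnk eNode) push_com output_com) Skip)) s1 s1
      (cost (Sub eNode eSnk) + 1 + (cost step_test + 1 + 1))"
    using runs_Skip t v by (intro runs_Cond) auto
  from runs_Seq[OF runs_advance[OF assms(1,3)] this[unfolded s1_def]]
  have "runs W step_com s s1 100"
    unfolding step_com_def s1_def by (rule runs_mono) (simp add: step_test_def)
  moreover have "tables_ok s1"
    using assms(1) unfolding dfs_inv_def s1_def by (auto elim!: tables_ok_frame)
  then have "dfs_inv s1 rs (r + 1)"
    using assms(1,2) unfolding dfs_inv_def s1_def by auto
  ultimately show ?thesis by blast
qed

lemma step_push:
  assumes "dfs_inv s rs r" "r + 1 < snk" "X \<le> W" "path 0 (rs @ (r + 1) # q)"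
  shows "\<exists>s'. runs W step_com s s' 200 \<and> dfs_inv s' (rs @ [r + 1]) 0"
proof -
  define s1 where "s1 = s(aNode := (s aNode)(length rs + 1 := r + 1))"
  have d: "s1 aDepth 0 = length rs + 1" "s1 aNode (length rs + 1) = r + 1" "s1 aSize 0 = N" "s1 aN 0 = n"
    "s1 aLeft (length rs + 1) = leftmost 0 (map lab rs)"
    using assms(1) unfolding dfs_inv_def tables_ok_def consts_ok_def s1_def by auto
  have t: "val step_test s1 \<noteq> 0" using val_step_test[OF assms(1)] assms(2,4) unfolding s1_def by auto
  have v: "val (Sub eNode eSnk) s1 = 0" "val (Sub eSnk eNode) s1 \<noteq> 0"
    using d assms(2) by (auto simp: N_bounds(1))
  have t1: "tables_ok s1"
    using assms(1) unfolding dfs_inv_def s1_def by (auto elim!: tables_ok_frame)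
  let ?L = "leftmost 0 (map lab rs)" and ?L' = "leftmost 0 (map lab (rs @ [r + 1]))"
  have N: "?L < N" "r + 1 < N" "?L' < N" 
    using leftmost_le[of "map lab rs"] leftmost_le[of "map lab (rs @ [r + 1])"] assms(2) N_bounds(1)
    by linarith+
  have nx: "s1 aNxt (?L * (n + 1) + s1 aLab (r + 1)) = ?L'"
  proof -
    have "s1 aLab (r + 1) = lab (r + 1)" using t1 N unfolding tables_ok_def lab_ok_def by blast
    moreover have "s1 aNxt (?L * (n + 1) + lab (r + 1)) = nxt ?L (lab (r + 1))"
      using t1 N lab_le unfolding tables_ok_def nxt_ok_def by blast
    ultimately show ?thesis by simp
  qed
  have p: "prefix_ok (rs @ [r + 1])" using prefix_push(2)[OF assms(4)] assms(2) by auto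
  then have "length rs + 1 \<le> n" using prefix_ok_length by fastforce
  then have W: "length rs + 2 \<le> W" "?L' \<le> W" using N(3) sizes(1,8) assms(3) by linarith+
  define s2 where "s2 = s1(aLeft := (s1 aLeft)(length rs + 2 := ?L'))"
  define s3 where "s3 = s2(aNode := (s2 aNode)(length rs + 2 := 0))"
  define s4 where "s4 = s3(aDepth := (s3 aDepth)(0 := length rs + 2))"
  have val_nxt: "val (Read aNxt (Add (Mul eLeft eN1) (Read aLab eNode))) s1 = ?L'"
  proof -
    have "val (Read aNxt (Add (Mul eLeft eN1) (Read aLab eNode))) s1 =
        s1 aNxt (val eLeft s1 * val eN1 s1 + s1 aLab (val eNode s1))" by simp
    moreover have "val eLeft s1 = ?L" "val eN1 s1 = n + 1" "val eNode s1 = r + 1" using d by simp_all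
    ultimately show ?thesis using nx by metis
  qed
  have "runs W (Assign aLeft (Add eD One) (Read aNxt (Add (Mul eLeft eN1) (Read aLab eNode)))) s1 s2 30"
  proof -
    have "val (Add eD One) s1 = length rs + 2" using d by simp
    then have "runs W (Assign aLeft (Add eD One) (Read aNxt (Add (Mul eLeft eN1) (Read aLab eNode)))) s1 s2
        (cost (Add eD One) + cost (Read aNxt (Add (Mul eLeft eN1) (Read aLab eNode))) + 1)"
      using runs_Assign[of "Add eD One" s1 W "Read aNxt (Add (Mul eLeft eN1) (Read aLab eNode))" aLeft] W val_nxt
      unfolding s2_def by metis
    then show ?thesis by (rule runs_mono) simp
  qed
  moreover have "runs W (Assign aNode (Add eD One) (Const 0)) s2 s3 10"
    using runs_Assign[of "Add eD One" s2 W "Const 0" aNode] W d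
    by (auto simp: s2_def s3_def elim: runs_mono)
  moreover have "runs W (Set aDepth (Add eD One)) s3 s4 10"
    using runs_Assign[of "Const 0" s3 W "Add eD One" aDepth] W d
    by (auto simp: s2_def s3_def s4_def elim: runs_mono)
  ultimately have "runs W push_com s1 s4 (30 + (10 + 10))"
    unfolding push_com_def by (intro runs_Seq)
  then have "runs W (Cond (Sub eNode eSnk) (Set aDepth (Sub eD One))
      (Cond step_test (Cond (Sub eSnk eNode) push_com output_com) Skip)) s1 s4
      (cost (Sub eNode eSnk) + 1 + (cost step_test + 1 + (cost (Sub eSnk eNode) + 1 + (30 + (10 + 10)))))"
    using t v by (intro runs_Cond) auto
  from runs_Seq[OF runs_advance[OF assms(1,3)] this[unfolded s1_def]]
  have "runs W step_com s s4 200"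
    unfolding step_com_def by (rule runs_mono) (simp add: step_test_def)
  moreover have "dfs_inv s4 (rs @ [r + 1]) 0"
  proof -
    have "tables_ok s4"
      using t1 unfolding s4_def s3_def s2_def by (auto elim!: tables_ok_frame)
    moreover have "s4 aNode (j + 1) = (rs @ [r + 1]) ! j" if "j < length (rs @ [r + 1])" for j
      using that assms(1) unfolding dfs_inv_def s4_def s3_def s2_def s1_def by (auto simp: nth_append)
    moreover have "s4 aLeft (j + 1) = leftmost 0 (map lab (take j (rs @ [r + 1])))" if "j \<le> length (rs @ [r + 1])" for j
      using that assms(1) unfolding dfs_inv_def s4_def s3_def s2_def s1_def
      by (cases "j = length rs + 1") auto
    ultimately show ?thesis
      using p assms(1) unfolding dfs_inv_def by (auto simp: s4_def s3_def s2_def s1_def)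
  qed
  ultimately show ?thesis by blast
qed

lemma step_pop:
  assumes "dfs_inv s rs snk" "X \<le> W"
  shows "\<exists>s'. runs W step_com s s' 100 \<and> s' aDepth 0 = length rs \<and>
    (rs \<noteq> [] \<longrightarrow> dfs_inv s' (butlast rs) (last rs))"
proof -
  define s1 where "s1 = s(aNode := (s aNode)(length rs + 1 := snk + 1))"
  have d: "s1 aDepth 0 = length rs + 1" "s1 aNode (length rs + 1) = snk + 1" "s1 aSize 0 = N"
    using assms(1) unfolding dfs_inv_def tables_ok_def consts_ok_def s1_def by auto
  have v: "val (Sub eNode eSnk) s1 \<noteq> 0" using d by (simp add: N_bounds(1))
  define s2 where "s2 = s1(aDepth := (s1 aDepth)(0 := length rs))"
  have "length rs \<le> n" using assms prefix_ok_length unfolding dfs_inv_def by auto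
  then have "length rs \<le> W" using sizes(8) assms(2) by linarith
  then have "runs W (Set aDepth (Sub eD One)) s1 s2 10"
    using runs_Assign[of "Const 0" s1 W "Sub eD One" aDepth] d
    by (auto simp: s2_def elim: runs_mono)
  then have "runs W (Cond (Sub eNode eSnk) (Set aDepth (Sub eD One))
      (Cond step_test (Cond (Sub eSnk eNode) push_com output_com) Skip)) s1 s2
      (cost (Sub eNode eSnk) + 1 + 10)"
    using v by (intro runs_Cond) auto
  from runs_Seq[OF runs_advance[OF assms(1,2)] this[unfolded s1_def]]
  have "runs W step_com s s2 100"
    unfolding step_com_def by (rule runs_mono) simp
  moreover have "s2 aDepth 0 = length rs" by (simp add: s2_def)
  moreover have "dfs_inv s2 (butlast rs) (last rs)" if rs: "rs \<noteq> []"
  proof -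
    obtain rs' a where rs': "rs = rs' @ [a]" using rs by (cases rs rule: rev_cases) auto
    have "tables_ok s2"
      using assms(1) unfolding dfs_inv_def s2_def s1_def by (auto elim!: tables_ok_frame)
    moreover have "a \<le> snk" "prefix_ok rs'"
      using assms(1) prefix_ok_le prefix_pop unfolding dfs_inv_def rs' by auto
    moreover have "s aNode (j + 1) = rs' ! j" if "j < length rs'" for j
      using assms(1) that unfolding dfs_inv_def rs' by (auto simp: nth_append)
    moreover have "s aLeft (j + 1) = leftmost 0 (map lab (take j rs'))" if "j \<le> length rs'" for j
      using assms(1) that unfolding dfs_inv_def rs' by auto
    moreover have "s aNode (length rs' + 1) = a" "s aNode 0 = 0"
      using assms(1) unfolding dfs_inv_def rs' by (auto simp: nth_append)
    ultimately show ?thesis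
      unfolding dfs_inv_def rs' s2_def s1_def by (auto simp: rs')
  qed
  ultimately show ?thesis by blast
qed

text \<open>Generalised over the current level \<open>v\<close> for the induction: the suffix from
  \<open>v\<close> on is still to be written.\<close>

lemma exec_emit:
  assumes "tables_ok s" "s aDepth 0 = length rs + 1" "1 \<le> v" "v \<le> length rs + 1" "s aV 0 = v"
    "\<forall>j<length rs. s aNode (j + 1) = rs ! j" "\<forall>x\<in>set rs. x \<le> snk" "length rs + 1 \<le> W"
  shows "\<exists>t s'. exec W emit_com s t s' \<and> (\<forall>b. b \<noteq> aV \<longrightarrow> s' b = s b) \<and> Completed \<notin> set t \<and>
    symbols t = map letter (map lab (drop (v - 1) rs)) \<and> length t \<le> 30 * (length rs + 1 - v) + 10"
  using assms
proof (induction "length rs + 1 - v" arbitrary: s v)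
  case 0
  then have v: "v = length rs + 1" by simp
  have "val (Sub eD eI) s = 0" using 0 v by simp
  then have "exec W emit_com s (replicate (cost (Sub eD eI) + 1) Tick) s"
    unfolding emit_com_def by (rule exec.WhileFalse)
  then show ?case
    using v symbols_ticks
    by (intro exI[of _ "replicate (cost (Sub eD eI) + 1) Tick"] exI[of _ s]) (auto simp del: replicate_Suc)
next
  case (Suc d)
  then have v: "v \<le> length rs" by simp
  define x where "x = rs ! (v - 1)"
  have x: "s aNode v = x" "x \<le> snk"
    using Suc.prems(3,6,7) v unfolding x_def by (auto dest: spec[of _ "v - 1"])
  have "s aLab x = lab x" "s 2 = array_of (concat S)"
    using Suc.prems(1) x(2) unfolding tables_ok_def lab_ok_def input_ok_def by (auto simp: N_bounds(1))
  then have e: "val (Read 2 (Sub (Read aLab (Read aNode eI)) One)) s = letter (lab x)"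
    using x(1) Suc.prems(5) by (simp add: letter_def)
  define s1 where "s1 = s(aV := (s aV)(0 := v + 1))"
  let ?e = "Read 2 (Sub (Read aLab (Read aNode eI)) One)"
  have 1: "exec W (Emit ?e) s (replicate (cost ?e) Tick @ [Symbol (letter (lab x))]) s"
    using exec.Emit[of W ?e s] e by simp
  have 2: "exec W (Set aV (Add eI One)) s (replicate (cost (Const 0) + cost (Add eI One) + 1) Tick) s1"
    using exec.Assign[of "Const 0" s W "Add eI One" aV] Suc.prems(5,8) v unfolding s1_def by auto
  obtain t s' where t: "exec W emit_com s1 t s'" "\<forall>b. b \<noteq> aV \<longrightarrow> s' b = s1 b" "Completed \<notin> set t"
    "symbols t = map letter (map lab (drop v rs))" "length t \<le> 30 * (length rs - v) + 10"
  proof -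
    have "d = length rs + 1 - (v + 1)" using Suc.hyps(2) by simp
    moreover have "tables_ok s1" using Suc.prems(1) unfolding s1_def by (auto elim!: tables_ok_frame)
    ultimately show ?thesis
      using Suc.hyps(1)[of "v + 1" s1] Suc.prems v that unfolding s1_def by auto
  qed
  let ?t = "replicate (cost (Sub eD eI) + 1) Tick @ ((replicate (cost ?e) Tick @ [Symbol (letter (lab x))]) @
      replicate (cost (Const 0) + cost (Add eI One) + 1) Tick) @ t"
  have "val (Sub eD eI) s \<noteq> 0" using Suc.prems(2,5) v by simp
  from exec.WhileTrue[OF this exec.Seq[OF 1 2] t(1)[unfolded emit_com_def]]
  have "exec W emit_com s ?t s'" unfolding emit_com_def .
  moreover have "Completed \<notin> set ?t" using t(3) by auto
  moreover have "symbols ?t = map letter (map lab (drop (v - 1) rs))"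
  proof -
    have "drop (v - 1) rs = x # drop v rs"
      using Suc.prems(3) v Cons_nth_drop_Suc[of "v - 1" rs] unfolding x_def by simp
    moreover have "symbols [Symbol (letter (lab x))] = [letter (lab x)]" by (simp add: symbols_def)
    ultimately show ?thesis using t(4) by (simp only: symbols_append symbols_ticks list.map append.simps)
  qed
  moreover have "length ?t \<le> 30 * (length rs + 1 - v) + 10"
    using t(5) v by (simp add: Suc_diff_le)
  moreover have "\<forall>b. b \<noteq> aV \<longrightarrow> s' b = s b" using t(2) unfolding s1_def by simp
  ultimately show ?case by blast
qed

lemma step_output:
  assumes "dfs_inv s rs r" "r + 1 = snk" "X \<le> W" "path 0 (rs @ snk # q)"
  shows "\<exists>t s'. exec W step_com s (t @ [Completed]) s' \<and> Completed \<notin> set t \<and>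
    symbols t = map letter (map lab rs) \<and> length t \<le> 100 + 30 * (n + 1) \<and> dfs_inv s' rs snk"
proof -
  define s1 where "s1 = s(aNode := (s aNode)(length rs + 1 := snk))"
  have d: "s1 aDepth 0 = length rs + 1" "s1 aNode (length rs + 1) = snk" "s1 aSize 0 = N"
    using assms(1) unfolding dfs_inv_def tables_ok_def consts_ok_def s1_def by auto
  have t: "val step_test s1 \<noteq> 0" using val_step_test[OF assms(1)] assms(2,4) unfolding s1_def by auto
  have v: "val (Sub eNode eSnk) s1 = 0" "val (Sub eSnk eNode) s1 = 0"
    using d by (auto simp: N_bounds(1))
  have t1: "tables_ok s1"
    using assms(1) unfolding dfs_inv_def s1_def by (auto elim!: tables_ok_frame)
  have p: "prefix_ok rs" using assms(1) unfolding dfs_inv_def by blast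
  then have len: "length rs \<le> n" by (rule prefix_ok_length)
  then have W: "length rs + 1 \<le> W" "1 \<le> W" using sizes(8) assms(3) by linarith+
  obtain m where m: "m \<le> 10" "exec W (Assign aNode eD (Add eNode One)) s (replicate m Tick) s1"
    using runs_advance[OF assms(1,3)] assms(2) unfolding runs_def s1_def by auto
  define s2 where "s2 = s1(aV := (s1 aV)(0 := 1))"
  obtain t s3 where e: "exec W emit_com s2 t s3" "\<forall>b. b \<noteq> aV \<longrightarrow> s3 b = s2 b" "Completed \<notin> set t"
    "symbols t = map letter (map lab rs)" "length t \<le> 30 * length rs + 10"
  proof -
    have "tables_ok s2" using t1 unfolding s2_def by (auto elim!: tables_ok_frame)
    moreover have "s2 aDepth 0 = length rs + 1" "s2 aV 0 = 1" using d by (auto simp: s2_def)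
    moreover have "\<forall>j<length rs. s2 aNode (j + 1) = rs ! j"
      using assms(1) unfolding dfs_inv_def s2_def s1_def by auto
    moreover have "\<forall>x\<in>set rs. x \<le> snk" using prefix_ok_le[OF p] by blast
    ultimately show ?thesis using exec_emit[of s2 rs 1 W] W(1) that by auto
  qed
  have 1: "exec W (Set aV One) s1 (replicate 3 Tick) s2"
    using exec.Assign[of "Const 0" s1 W One aV] W(2) by (simp add: s2_def numeral_3_eq_3)
  have out: "exec W output_com s1 (replicate 3 Tick @ t @ [Completed]) s3"
    unfolding output_com_def by (rule exec.Seq[OF 1 exec.Seq[OF e(1) exec.Finish]])
  let ?t = "replicate m Tick @ replicate (cost (Sub eNode eSnk) + 1) Tick @ replicate (cost step_test + 1) Tick @
    replicate (cost (Sub eSnk eNode) + 1) Tick @ replicate 3 Tick @ t"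
  from exec.Seq[OF m(2) exec.CondFalse[OF v(1) exec.CondTrue[OF t exec.CondFalse[OF v(2) out]]]]
  have "exec W step_com s (?t @ [Completed]) s3" unfolding step_com_def append_assoc .
  moreover have "Completed \<notin> set ?t" using e(3) by auto
  moreover have "symbols ?t = map letter (map lab rs)"
    by (simp only: symbols_append symbols_ticks e(4) append.simps)
  moreover have "length ?t \<le> 100 + 30 * (n + 1)"
    using e(5) m(1) len by (simp add: step_test_def)
  moreover have "dfs_inv s3 rs snk"
  proof -
    have f: "s3 b = s1 b" if "b \<noteq> aV" for b using e(2) that unfolding s2_def by simp
    then have "tables_ok s3" using tables_ok_frame[OF t1] by blast
    then show ?thesis
      using assms(1) p f unfolding dfs_inv_def s1_def by auto
  qed
  ultimately show ?thesis by blast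
qed

section \<open>The delay of the search\<close>

text \<open>Covers what is not charged to the rank: writing a word of at most \<open>n\<close>
  letters, and leaving the loop at the end.\<close>

definition slack :: nat where "slack = 300 * (n + 5)"

text \<open>Induction on a lexicographic measure put into one number: an output removes a remaining
  path, and every other step lowers the rank, which stays below \<open>max_rank\<close>. Each unit
  of rank is worth 300 units of time.\<close>

lemma exec_dfs_loop:
  assumes "dfs_inv s rs r" "X \<le> W"
  shows "\<exists>t s'. exec W (While eD step_com) s t s' \<and>
    enum_trace t ((\<lambda>p. map letter (word p)) ` remaining rs r) (300 * rank rs r + slack) (300 * max_rank + slack)"
  using assms
proof (induction "card (remaining rs r) * max_rank + rank rs r" arbitrary: s rs r rule: less_induct)
  case less
  have inv: "dfs_inv s rs r" and XW: "X \<le> W" by fact+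
  have d: "val eD s \<noteq> 0" "r \<le> snk" "prefix_ok rs" using inv unfolding dfs_inv_def by auto
  have len: "length rs \<le> n" using d prefix_ok_length by blast
  let ?A = "\<lambda>rs r. (\<lambda>p. map letter (word p)) ` remaining rs r"
  let ?D = "300 * max_rank + slack"
  have go: ?case
    if g: "runs W step_com s s' 200" "dfs_inv s' rs' r'" "remaining rs' r' = remaining rs r"
      "rank rs' r' < rank rs r" for s' rs' r'
  proof -
    obtain t s'' where t: "exec W (While eD step_com) s' t s''" "enum_trace t (?A rs' r') (300 * rank rs' r' + slack) ?D"
      using less.hyps[OF _ g(2) XW] g(3,4) by auto
    \<comment> \<open>A silent step with its loop test takes at most 203 units, less than the 300
      freed by the smaller rank.\<close>
    have "cost eD + 1 + 200 + (300 * rank rs' r' + slack) \<le> 300 * rank rs r + slack"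
      using g(4) by simp
    from while_step[OF d(1) g(1) t this] show ?thesis using g(3) by auto
  qed
  consider (pop) "r = snk" | (skip) "r < snk" "\<nexists>q. path 0 (rs @ (r + 1) # q)"
    | (push) q where "r + 1 < snk" "path 0 (rs @ (r + 1) # q)"
    | (emit) q where "r + 1 = snk" "path 0 (rs @ snk # q)"
    using d(2) by (metis Suc_eq_plus1 Suc_leI le_neq_implies_less)
  then show ?case
  proof cases
    case pop
    obtain s' where s': "runs W step_com s s' 100" "s' aDepth 0 = length rs"
      "rs \<noteq> [] \<Longrightarrow> dfs_inv s' (butlast rs) (last rs)"
      using step_pop inv XW pop by blast
    show ?thesis
    proof (cases rs rule: rev_cases)
      case Nil
      have "val eD s' = 0" using s' Nil by simp
      then have "exec W (While eD step_com) s' (replicate (cost eD + 1) Tick) s'" by (rule exec.WhileFalse)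
      from while_step[OF d(1) s'(1) this enum_trace_ticks, of "300 * rank rs r + slack" ?D]
      show ?thesis using remaining_Nil_snk Nil pop by (auto simp: slack_def)
    next
      case (snoc rs' a)
      have "dfs_inv s' rs' a" using s'(3) snoc by simp
      moreover have "a \<le> snk" using prefix_ok_le[OF d(3), of a] snoc by simp
      moreover have "length rs' < n" using len snoc by simp
      ultimately show ?thesis
        using go[OF runs_mono[OF s'(1)]] pop_step[of a rs'] snoc pop by auto
    qed
  next
    case skip
    obtain s' where "runs W step_com s s' 100" "dfs_inv s' rs (r + 1)"
      using step_skip[OF inv skip(1) XW skip(2)] by blast
    then show ?thesis using go[OF runs_mono] skip_step[OF skip] by auto
  next
    case push
    obtain s' where "runs W step_com s s' 200" "dfs_inv s' (rs @ [r + 1]) 0"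
      using step_push[OF inv push(1) XW push(2)] by blast
    then show ?thesis using go push_step[OF push] by blast
  next
    case emit
    note out = output_step[OF emit]
    obtain t s' where t: "exec W step_com s (t @ [Completed]) s'" "Completed \<notin> set t"
      "symbols t = map letter (map lab rs)" "length t \<le> 100 + 30 * (n + 1)" "dfs_inv s' rs snk"
      using step_output[OF inv emit(1) XW emit(2)] by blast
    have "card (remaining rs r) = Suc (card (remaining rs snk))"
      using out finite_remaining by simp
    \<comment> \<open>The rank may jump up after an output, but by less than the
      \<open>max_rank\<close> gained from the smaller set.\<close>
    then have "card (remaining rs snk) * max_rank + rank rs snk < card (remaining rs r) * max_rank + rank rs r"
      using rank_less[OF len, of snk] by simp
    then obtain t2 s'' where t2: "exec W (While eD step_com) s' t2 s''"
      "enum_trace t2 (?A rs snk) (300 * rank rs snk + slack) ?D"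
      using less.hyps[OF _ t(5) XW] by blast
    let ?t1 = "replicate (cost eD + 1) Tick @ t"
    have "exec W (While eD step_com) s (replicate (cost eD + 1) Tick @ (t @ [Completed]) @ t2) s''"
      by (rule exec.WhileTrue[OF d(1) t(1) t2(1)])
    then have ex: "exec W (While eD step_com) s (?t1 @ Completed # t2) s''" by simp
    have tr: "enum_trace (?t1 @ Completed # t2) (insert (map letter (map lab rs)) (?A rs snk)) (length ?t1 + 1) ?D"
    proof (rule enum_trace_output[OF t2(2)])
      show "300 * rank rs snk + slack \<le> ?D" using rank_less[OF len, of snk] by simp
      show "Completed \<notin> set ?t1" using t(2) by auto
      show "symbols ?t1 = map letter (map lab rs)" using t(3) by (simp only: symbols_append symbols_ticks append.simps)
      show "map letter (map lab rs) \<notin> ?A rs snk"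
      proof
        assume "map letter (map lab rs) \<in> ?A rs snk"
        then obtain p where p: "p \<in> remaining rs snk" "map letter (word p) = map letter (word (rs @ [snk]))" by auto
        then have "p = rs @ [snk]"
          using inj_onD[OF inj_on_word p(2)] out(3) unfolding remaining_def by blast
        then show False using p(1) out(2) by blast
      qed
    qed
    have A: "?A rs r = insert (map letter (map lab rs)) (?A rs snk)" using out(1) by simp
    have "length ?t1 + 1 \<le> 300 * rank rs r + slack" using t(4) by (simp add: slack_def)
    from enum_trace_mono[OF tr this order_refl] ex show ?thesis unfolding A by blast
  qed
qed

lemma exec_dfs:
  assumes "tables_ok s" "\<And>b. b \<in> {aDepth, aLeft, aNode} \<Longrightarrow> s b = (\<lambda>_. 0)" "X \<le> W"
  shows "\<exists>t s'. exec W dfs_com s t s' \<and> enum_trace t (MCS S) (10 + 300 * max_rank + slack) (10 + 300 * max_rank + slack)"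
proof -
  define s1 where "s1 = s(aDepth := (s aDepth)(0 := 1))"
  have "1 \<le> W" using sizes(8) assms(3) by linarith
  then have 1: "exec W (Set aDepth One) s (replicate 3 Tick) s1"
    using exec.Assign[of "Const 0" s W One aDepth] by (simp add: s1_def numeral_3_eq_3)
  have "tables_ok s1" using assms(1) unfolding s1_def by (auto elim!: tables_ok_frame)
  then have inv: "dfs_inv s1 [] 0"
    using assms(2) unfolding dfs_inv_def s1_def by (auto simp: prefix_ok_def)
  obtain t s' where t: "exec W (While eD step_com) s1 t s'"
    "enum_trace t ((\<lambda>p. map letter (word p)) ` remaining [] 0) (300 * rank [] 0 + slack) (300 * max_rank + slack)"
    using exec_dfs_loop[OF inv assms(3)] by blast
  have "remaining [] 0 = {p. path 0 p}"
  proof -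
    have "beyond p [0]" if "path 0 p" for p
      using that path_le_snk[OF that, of "hd p"] by (cases p) auto
    then show ?thesis unfolding remaining_def by auto
  qed
  then have "enum_trace t (MCS S) (300 * rank [] 0 + slack) (300 * max_rank + slack)"
    using t(2) MCS_eq by simp
  then have "enum_trace t (MCS S) (7 + 300 * max_rank + slack) (10 + 300 * max_rank + slack)"
    by (rule enum_trace_mono) (use rank_less[of "[]" 0] in auto)
  from enum_trace_prefix[OF this, of 3 "10 + 300 * max_rank + slack"] exec.Seq[OF 1 t(1)]
  show ?thesis unfolding dfs_com_def by auto
qed

end

section \<open>The bounds of the complete program\<close>

definition mcs_com :: com where
  "mcs_com = Seq tables_com dfs_com"

lemma enumerates_iff:
  "enumerates W c s A D \<longleftrightarrow> (\<exists>t s'. exec W c s t s' \<and> enum_trace t A D D)"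
proof -
  have "delay t \<le> D \<longleftrightarrow> length (hd (blocks t)) \<le> D \<and> (\<forall>x \<in> set (tl (blocks t)). length x \<le> D)" for t
    using blocks_not_Nil[of t] by (cases "blocks t") (auto simp: delay_def)
  then show ?thesis unfolding enumerates_def enum_trace_def by blast
qed

text \<open>Preprocessing is silent, so its time is added to the first block only.\<close>

lemma enumerates_Seq:
  assumes "enumerates_after_preprocessing W pre enum s A P D" "W \<le> W'" "P + D \<le> D'"
  shows "enumerates W' (Seq pre enum) s A D'"
proof -
  obtain t s' where t: "exec W pre s t s'" "set t \<subseteq> {Tick}" "length t \<le> P" "enumerates W enum s' A D"
    using assms(1) unfolding enumerates_after_preprocessing_def by blast
  obtain u s'' where u: "exec W enum s' u s''" "enum_trace u A D D"
    using t(4) enumerates_iff by blast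
  have "t = replicate (length t) Tick"
    using t(2) by (intro replicate_eqI) auto
  then obtain m where m: "t = replicate m Tick" "m \<le> P" using t(3) by blast
  have "enum_trace (replicate m Tick @ u) A D' D"
    using u(2) assms(3) m(2) by (intro enum_trace_prefix) auto
  then have "enum_trace (t @ u) A D' D'"
    unfolding m(1) using assms(3) by (auto elim: enum_trace_mono)
  moreover have "exec W' (Seq pre enum) s (t @ u) s''"
    using exec.Seq[OF t(1) u(1)] assms(2) by (rule exec_mono_word)
  ultimately show ?thesis using enumerates_iff by blast
qed

context strings
begin

text \<open>The four factors of \<open>X\<close> lose constants 3, 3, 2 and 2, hence 36.\<close>

lemma X_le:
  assumes "n \<le> b"
  shows "X \<le> 36 * (k * b ^ (2 * k + 1))"
proof -
  have "N \<le> 3 * M" "n + 1 \<le> 2 * n" "k + 1 \<le> 2 * k"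
    using M_pos n_pos k_pos unfolding N_def by linarith+
  then have "X \<le> (3 * M) * (3 * M) * (2 * n) * (2 * k)"
    unfolding X_def by (intro mult_le_mono)
  also have "\<dots> = 36 * (k * (M * M * n))" by (simp add: algebra_simps)
  also have "M * M * n = n ^ (2 * k + 1)"
    by (simp add: M_def mult_2 power_add)
  also have "36 * (k * n ^ (2 * k + 1)) \<le> 36 * (k * b ^ (2 * k + 1))"
    using assms by (intro mult_le_mono2 power_mono) auto
  finally show ?thesis by simp
qed

lemma enumerates_MCS:
  assumes "X \<le> W"
  shows "enumerates W mcs_com (mcs_input (\<sigma>, S)) (MCS S) (5000 * (X + 1))"
proof -
  let ?s = "mcs_input (\<sigma>, S)"
  have "input_ok ?s" by (auto simp: input_ok_def mcs_input_def array_of_def)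
  moreover have "?s a = (\<lambda>_. 0)" if "3 \<le> a" for a using that by (auto simp: mcs_input_def)
  ultimately obtain s1 where s1: "runs W tables_com ?s s1 (3000 * (X + 1))" "tables_ok s1"
    "\<And>b. b \<in> {aDepth, aLeft, aNode} \<Longrightarrow> s1 b = (\<lambda>_. 0)"
    using runs_tables[of ?s W] assms by blast
  obtain t s2 where t: "exec W dfs_com s1 t s2"
    "enum_trace t (MCS S) (10 + 300 * max_rank + slack) (10 + 300 * max_rank + slack)"
    using exec_dfs[OF s1(2,3) assms] by blast
  obtain m where m: "m \<le> 3000 * (X + 1)" "exec W tables_com ?s (replicate m Tick) s1"
    using s1(1) unfolding runs_def by blast
  \<comment> \<open>Uses \<open>2 * n + 3 \<le> 3 * (n + 1)\<close> and
    \<open>N + 1 \<le> 2 * N\<close>; the constants 3 and 2 then disappear in the factors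
    \<open>N\<close> and \<open>k + 1\<close>.\<close>
  have "max_rank \<le> X"
  proof -
    have "max_rank \<le> (3 * (n + 1)) * (2 * N)"
      unfolding max_rank_def using N_bounds by (intro mult_le_mono) auto
    also have "\<dots> = N * 3 * (n + 1) * 2" by (simp add: algebra_simps)
    also have "\<dots> \<le> N * N * (n + 1) * (k + 1)"
      using k_pos N_bounds(2) by (intro mult_le_mono[OF mult_le_mono1[OF mult_le_mono2]]) linarith+
    finally show ?thesis by (simp add: X_def)
  qed
  moreover have "n + 1 \<le> X" using sizes(8) by simp
  ultimately have "3000 * (X + 1) + (10 + 300 * max_rank + slack) \<le> 5000 * (X + 1)"
    unfolding slack_def by simp
  with m(1) have "enum_trace (replicate m Tick @ t) (MCS S) (5000 * (X + 1)) (10 + 300 * max_rank + slack)"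
    by (intro enum_trace_prefix[OF t(2)]) simp
  then have "enum_trace (replicate m Tick @ t) (MCS S) (5000 * (X + 1)) (5000 * (X + 1))"
    using \<open>3000 * (X + 1) + (10 + 300 * max_rank + slack) \<le> 5000 * (X + 1)\<close> by (auto elim: enum_trace_mono)
  then show ?thesis
    using exec.Seq[OF m(2) t(1)] unfolding mcs_com_def enumerates_iff by blast
qed

lemma n_le: "(\<And>Y. Y \<in> set S \<Longrightarrow> length Y \<le> b) \<Longrightarrow> 1 \<le> b \<Longrightarrow> n \<le> b"
  unfolding n_def by auto

end

lemma enumerates_mono:
  "enumerates W c s A D \<Longrightarrow> W \<le> W' \<Longrightarrow> D \<le> D' \<Longrightarrow> enumerates W' c s A D'"
  unfolding enumerates_iff using exec_mono_word enum_trace_mono by blast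

text \<open>Since \<open>X\<close> is at most 36 times \<open>k * n ^ (2 * k + 1)\<close>, the
  factor 200000 dominates \<open>5000 * (X + 1)\<close>. The word bound is a power of the
  preprocessing bound \<open>y\<close>, and already the cube of \<open>y\<close> is at least
  \<open>X\<close>.\<close>

lemma mcs_enumerates:
  assumes "2 \<le> k" "1 \<le> n" "length S = k" "\<forall>Y \<in> set S. length Y \<le> n" "(\<sigma>, S) \<in> mcs_instances" "200000 \<le> C"
  shows "enumerates_after_preprocessing ((C * (k * \<sigma> * n ^ k)) ^ C) Skip mcs_com
         (mcs_input (\<sigma>, S)) (mcs_solutions (\<sigma>, S))
         (C * (k * \<sigma> * n ^ k)) (C * (k * n ^ (2 * k + 1)))"
proof -
  define y where "y = C * (k * \<sigma> * n ^ k)"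
  have \<sigma>: "1 \<le> \<sigma>" using assms(5) by (simp add: mcs_instances_def)
  have nk: "n \<le> n ^ k" "1 \<le> n ^ k" using assms(1,2) self_le_power[of n k] by auto
  have "1 * (1 * n ^ k) \<le> \<sigma> * (k * n ^ k)" using \<sigma> assms(1) by (intro mult_le_mono) auto
  then have k\<sigma>: "n ^ k \<le> k * \<sigma> * n ^ k" by (simp add: ac_simps)
  have "1 * (k * n ^ k) \<le> \<sigma> * (k * n ^ k)" using \<sigma> by (intro mult_le_mono1)
  then have kn: "k * n ^ k \<le> k * \<sigma> * n ^ k" by (simp add: ac_simps)
  have C: "36 \<le> C" "1 \<le> C" using assms(6) by auto
  have y1: "36 * (k * n ^ k) \<le> y" unfolding y_def by (rule mult_le_mono[OF C(1) kn])
  have "1 * n ^ k \<le> y" unfolding y_def by (rule mult_le_mono[OF C(2) k\<sigma>])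
  then have y2: "n ^ k \<le> y" "1 \<le> y" using nk by auto
  \<comment> \<open>From here on, the given bound \<open>n\<close> and the maximal length
    \<open>local.n\<close> used by the program are different numbers, the second at most the
    first.\<close>
  interpret strings S by unfold_locales (use assms(1,3) in auto)
  have n: "local.n \<le> n" using n_le assms(2,4) by blast
  have X: "X \<le> 36 * (k * n ^ (2 * k + 1))" using X_le[OF n] assms(3) by simp
  also have "36 * (k * n ^ (2 * k + 1)) = 36 * (k * n ^ k) * n ^ k * n"
  proof -
    have "n ^ (2 * k + 1) = n ^ k * n ^ k * n" by (simp add: mult_2 power_add)
    then show ?thesis by (simp only: ac_simps)
  qed
  also have "\<dots> \<le> y * y * y" using y1 y2 nk by (intro mult_le_mono) auto
  also have "\<dots> = y ^ 3" by (simp add: power3_eq_cube)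
  also have "\<dots> \<le> y ^ C" using y2 assms(6) by (intro power_increasing) auto
  finally have "X \<le> y ^ C" .
  then have e: "enumerates (y ^ C) mcs_com (mcs_input (\<sigma>, S)) (MCS S) (5000 * (X + 1))"
    by (rule enumerates_MCS)
  define q where "q = k * n ^ (2 * k + 1)"
  have "1 * 1 \<le> q" unfolding q_def using assms(1,2) by (intro mult_le_mono) auto
  then have "5000 * (X + 1) \<le> 200000 * q" using X unfolding q_def[symmetric] by simp
  also have "\<dots> \<le> C * q" using assms(6) by (rule mult_le_mono1)
  finally have "enumerates (y ^ C) mcs_com (mcs_input (\<sigma>, S)) (MCS S) (C * (k * n ^ (2 * k + 1)))"
    unfolding q_def using enumerates_mono[OF e] by blast
  moreover have "exec (y ^ C) Skip (mcs_input (\<sigma>, S)) [Tick] (mcs_input (\<sigma>, S))" by (rule exec.Skip)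
  moreover have "length [Tick] \<le> y" using y2 by simp
  ultimately show ?thesis
    unfolding enumerates_after_preprocessing_def y_def[symmetric] mcs_solutions_def by fastforce
qed

fun pow_exp :: "nat \<Rightarrow> exp" where
  "pow_exp 0 = Const 1"
| "pow_exp (Suc m) = Mul (Var 0) (pow_exp m)"

lemma val_pow_exp: "val (pow_exp m) s = s 0 0 ^ m"
  by (induction m) auto

text \<open>A single assignment computes the function; the word size may depend on the argument and
  is taken to be the value itself.\<close>

lemma computable_exp:
  assumes "\<And>x s. s 0 0 = x \<Longrightarrow> val e s = f x"
  shows "computable f"
  unfolding computable_def
proof (intro exI allI conjI)
  fix x :: nat
  let ?s = "\<lambda>a i. if a = 0 \<and> i = 0 then x else 0 :: nat"
  show "exec (val e ?s) (Assign 0 (Const 0) e) ?s (replicate (cost (Const 0) + cost e + 1) Tick)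
      (?s(0 := (?s 0)(0 := val e ?s)))"
    using exec.Assign[of "Const 0" ?s "val e ?s" e 0] by simp
  show "(?s(0 := (?s 0)(0 := val e ?s))) 0 0 = f x" using assms[of ?s x] by simp
qed

text \<open>Here \<open>N\<close> bounds both the lengths and the alphabet size. The exponents
  \<open>C\<close> and \<open>C * (k + 1)\<close> are dictated by the word bound, which is a
  \<open>C\<close>-th power; the summand \<open>2 * C\<close> accounts for the two time
  bounds.\<close>

lemma XP_bounds:
  fixes C k N \<sigma> :: nat
  assumes "3 \<le> C" "1 \<le> k" "1 \<le> N" "\<sigma> \<le> N"
  defines "Q \<equiv> k ^ C * N ^ (C * (k + 1))"
  shows "(C * (k * \<sigma> * N ^ k)) ^ C \<le> (C ^ C + 2 * C) * Q"
    "C * (k * \<sigma> * N ^ k) + C * (k * N ^ (2 * k + 1)) \<le> (C ^ C + 2 * C) * Q"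
proof -
  have kC: "k \<le> k ^ C" using assms self_le_power[of k C] by simp
  have \<sigma>: "k * \<sigma> * N ^ k \<le> k * N ^ (k + 1)" using assms(4) by (simp add: mult_le_mono)
  then have "(C * (k * \<sigma> * N ^ k)) ^ C \<le> (C * (k * N ^ (k + 1))) ^ C"
    by (intro power_mono mult_le_mono2) auto
  also have "\<dots> = C ^ C * Q" unfolding Q_def by (simp only: power_mult_distrib power_mult[symmetric] mult.commute[of C "k + 1"])
  also have "\<dots> \<le> (C ^ C + 2 * C) * Q" by (intro mult_le_mono1) simp
  finally show "(C * (k * \<sigma> * N ^ k)) ^ C \<le> (C ^ C + 2 * C) * Q" .
  have C: "3 * (k + 1) \<le> C * (k + 1)" using assms(1) by (rule mult_le_mono1)
  have "k * N ^ (k + 1) \<le> Q"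
    unfolding Q_def using kC C assms(3) by (intro mult_le_mono power_increasing) auto
  moreover have "k * N ^ (2 * k + 1) \<le> Q"
    unfolding Q_def using kC C assms(3) by (intro mult_le_mono power_increasing) auto
  ultimately have "C * (k * \<sigma> * N ^ k) + C * (k * N ^ (2 * k + 1)) \<le> C * Q + C * Q"
    using \<sigma> by (intro add_mono mult_le_mono2) (rule le_trans)
  also have "\<dots> \<le> (C ^ C + 2 * C) * Q" by (simp add: add_mult_distrib mult_2)
  finally show "C * (k * \<sigma> * N ^ k) + C * (k * N ^ (2 * k + 1)) \<le> (C ^ C + 2 * C) * Q" .
qed

theorem theorem4:
  shows "\<exists>pre enum.
    enumerates_with_XP_delay (Seq pre enum)
      mcs_instances mcs_parameter mcs_size mcs_input mcs_solutions \<and>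
    (\<exists>C. \<forall>(k::nat) (n::nat) (\<sigma>::nat) (S::nat list list).
       k \<ge> 2 \<longrightarrow> n \<ge> 1 \<longrightarrow> length S = k \<longrightarrow> (\<forall>X \<in> set S. length X \<le> n) \<longrightarrow>
       (\<sigma>, S) \<in> mcs_instances \<longrightarrow>
       enumerates_after_preprocessing ((C * (k * \<sigma> * n ^ k)) ^ C) pre enum
         (mcs_input (\<sigma>, S)) (mcs_solutions (\<sigma>, S))
         (C * (k * \<sigma> * n ^ k)) (C * (k * n ^ (2 * k + 1))))"
proof -
  obtain C :: nat where C: "200000 \<le> C" by blast
  have "enumerates_with_XP_delay (Seq Skip mcs_com)
      mcs_instances mcs_parameter mcs_size mcs_input mcs_solutions"
    unfolding enumerates_with_XP_delay_def
  proof (intro exI conjI ballI)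
    show "computable (\<lambda>k. k ^ C)"
      by (rule computable_exp[of "pow_exp C"]) (simp add: val_pow_exp)
    show "computable (\<lambda>k. C * (k + 1))"
      by (rule computable_exp[of "Mul (Const C) (Add (Var 0) (Const 1))"]) simp
    fix x
    assume x: "x \<in> mcs_instances"
    obtain \<sigma> S where x_eq: "x = (\<sigma>, S)" by (cases x)
    let ?k = "mcs_parameter x" and ?N = "mcs_size x"
    have k: "?k = length S" "2 \<le> ?k" "1 \<le> \<sigma>"
      using x unfolding x_eq by (auto simp: mcs_parameter_def mcs_instances_def)
    have N: "1 \<le> ?N" "\<sigma> \<le> ?N" using k by (auto simp: mcs_size_def x_eq)
    \<comment> \<open>The total input size takes the place of the length bound, so that both it and
      the alphabet size are at most \<open>?N\<close>.\<close>
    have len: "\<forall>Y \<in> set S. length Y \<le> ?N"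
      using member_le_sum_list[of _ "map length S"] unfolding x_eq mcs_size_def by (auto intro: trans_le_add2)
    have "3 \<le> C" "1 \<le> ?k" using C k by auto
    note bd = XP_bounds[OF this N]
    show "enumerates ((C ^ C + 2 * C) * (?k ^ C * ?N ^ (C * (?k + 1)))) (Seq Skip mcs_com)
        (mcs_input x) (mcs_solutions x) ((C ^ C + 2 * C) * (?k ^ C * ?N ^ (C * (?k + 1))))"
      using enumerates_Seq[OF mcs_enumerates[OF k(2) N(1) k(1)[symmetric] len x[unfolded x_eq] C] bd]
      unfolding x_eq .
  qed
  then show ?thesis using mcs_enumerates C by blast
qed

end
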